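(* Let $S=M/H$ be a global quotient orbifold of dimension $\geq 2$ with at least one singular point, where $H$ is a finite group acting effectively on a connected manifold $M$. Let $n\geq 2$. Then, for $*=a,b$, the homomorphism $F^*:PB^*_n(\mathcal{G}(M,H))\to PB^*_{n-1}(\mathcal{G}(M,H))$ is not a $*$-fibration of Lie groupoids. In fact, the object level map $F^*_0$ is not even a quasifibration.
   Context: Conventions: all manifolds are smooth, Hausdorff and paracompact; maps (and actions) are smooth; a fibration means a Hurewicz fibration. An orbifold $S$ is a global quotient if there is a finite group $H$ acting effectively on a connected manifold $M$ with $S=M/H$ (so $M\to S$ is an orbifold covering map). A singular point of $S$ is the image of a point of $M$ with nontrivial isotropy group in $H$. A quasifibration is a map which induces a long exact sequence of homotopy groups similar to the one induced by a Serre fibration; equivalently, for path connected base, the homotopy fiber is weakly homotopy equivalent to the fiber (over every point). A Lie groupoid $\mathcal{G}$ is a groupoid whose object space $\mathcal{G}_0$ and morphism space $\mathcal{G}_1$ are smooth manifolds, with all structure maps smooth and source $s$ and target $t$ submersions. A homomorphism $f$ of Lie groupoids is a smooth functor, with object map $f_0$ and morphism map $f_1$. The orbit of $x\in\mathcal{G}_0$ is $t(s^{-1}(x))$, $|\mathcal{G}|$ is the orbit space, and $\mathcal{G}$ is Hausdorff if $|\mathcal{G}|$ is Hausdorff. The translation groupoid $\mathcal{G}(M,H)$ has object space $M$, morphism space $H\times M$, $s(h,x)=x$, $t(h,x)=h(x)$, $u(x)=(1,x)$, composition $(h',h(x))\circ(h,x)=(h'h,x)$; it is Hausdorff for $M,H$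 as in the claim. Left $\mathcal{G}$-space: a manifold $M'$ with a smooth map $\pi:M'\to\mathcal{G}_0$ and a smooth action map $\mu:\mathcal{G}_1\times_{\mathcal{G}_0}M'\to M'$, defined on pairs $(\alpha,x)$ with $\pi(x)=s(\alpha)$, such that $\pi(\mu(\alpha,x))=t(\alpha)$, $\mu(1_{\pi(x)},x)=x$, $\mu(\alpha,\mu(\beta,x))=\mu(\alpha\beta,x)$. Let $f:\mathcal{H}\to\mathcal{G}$ be a homomorphism of Lie groupoids such that $f_0$ is both a submersion and a fibration. $f$ is an a-fibration if $\mathcal{H}_0$ is a left $\mathcal{G}$-space with $\pi=f_0$, $\mathcal{H}_1=\mathcal{G}_1\times_{\mathcal{G}_0}\mathcal{H}_0$, $f_1$ is the first projection, and the source and target maps of $\mathcal{H}$ are respectively the second projection and the action map. $f$ is a b-fibration if $\mathcal{H}_1\to\mathcal{G}_1\times_{\mathcal{G}_0}\mathcal{H}_0$, $\alpha\mapsto(f_1(\alpha),s(\alpha))$, is a surjective submersion. (In particular, in both cases $f_0$ must be a fibration.) Configuration Lie groupoids of a Hausdorff Lie groupoid $\mathcal{G}$. For both types the object space is $$PB_n(\mathcal{G})_0=\{(x_1,\ldots,x_n)\in\mathcal{G}_0^n \mid x_i,x_j \text{ have distinct orbits for all } i\neq j\}.$$ (a) $PB^a_1(\mathcal{G})=\mathcal{G}$, and inductively $PB^a_n(\mathcal{G})_1=PB^a_{n-1}(\mathcal{G})_1\times_{PB_{n-1}(\mathcal{G})_0}PB_n(\mathcal{G})_0$ (fibered product of the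 source map of $PB^a_{n-1}(\mathcal{G})$ and projection to the first $n-1$ coordinates), with $s_n(\alpha_{n-1},x)=x$, $t_n(\alpha_{n-1},x)=(t_{n-1}(\alpha_{n-1}),x_n)$, and composition $(\alpha'_{n-1},x')\circ(\alpha_{n-1},x)=(\alpha'_{n-1}\circ\alpha_{n-1},x)$. (b) $PB^b_n(\mathcal{G})_1=(s^n,t^n)^{-1}(PB_n(\mathcal{G})_0\times PB_n(\mathcal{G})_0)\subset\mathcal{G}_1^n$ with coordinatewise structure maps. $F^a$ is projection to the first $n-1$ coordinates on objects and $(\alpha_{n-1},x)\mapsto\alpha_{n-1}$ on morphisms; $F^b$ is projection to the first $n-1$ coordinates on objects and on morphisms. Thus $F^a_0=F^b_0$ is the projection $PB_n(\mathcal{G}(M,H))_0\to PB_{n-1}(\mathcal{G}(M,H))_0$. *)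

theory Defs
  imports "HOL-Analysis.Analysis" "HOL-Algebra.Group_Action"
begin

section \<open>Smooth manifolds\<close>

text \<open>
  The model space of dimension \<open>d\<close> is \<^const>\<open>Euclidean_space\<close> \<open>d\<close>: real sequences vanishing from
  index \<open>d\<close> on. This keeps dimensions as numbers, which the configuration spaces need, and makes
  the standard inclusion of a model space into a larger one a literal inclusion of sets.
\<close>

definition partial_d :: "nat \<Rightarrow> ((nat \<Rightarrow> real) \<Rightarrow> real) \<Rightarrow> (nat \<Rightarrow> real) \<Rightarrow> real" where
  "partial_d i f x = deriv (\<lambda>t. f (x(i := t))) (x i)"

primrec Ck_on :: "nat \<Rightarrow> nat \<Rightarrow> (nat \<Rightarrow> real) set \<Rightarrow> ((nat \<Rightarrow> real) \<Rightarrow> real) \<Rightarrow> bool" where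
  "Ck_on 0 d V f \<longleftrightarrow> continuous_map (subtopology (Euclidean_space d) V) euclideanreal f"
| "Ck_on (Suc r) d V f \<longleftrightarrow>
     continuous_map (subtopology (Euclidean_space d) V) euclideanreal f \<and>
     (\<forall>i<d. (\<forall>x\<in>V. (\<lambda>t. f (x(i := t))) field_differentiable (at (x i))) \<and>
            Ck_on r d V (partial_d i f))"

text \<open>Smoothness of a map from an open set \<open>V\<close> of the model space of dimension \<open>d\<close> to the model
  space of dimension \<open>e\<close>.\<close>

definition smooth_on :: "nat \<Rightarrow> nat \<Rightarrow> (nat \<Rightarrow> real) set \<Rightarrow> ((nat \<Rightarrow> real) \<Rightarrow> nat \<Rightarrow> real) \<Rightarrow> bool" where
  "smooth_on d e V F \<longleftrightarrow> (\<forall>j<e. \<forall>r. Ck_on r d V (\<lambda>z. F z j))"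

definition surj_differential ::
    "nat \<Rightarrow> nat \<Rightarrow> ((nat \<Rightarrow> real) \<Rightarrow> nat \<Rightarrow> real) \<Rightarrow> (nat \<Rightarrow> real) \<Rightarrow> bool" where
  "surj_differential d e F z \<longleftrightarrow>
     (\<forall>w::nat \<Rightarrow> real. \<exists>v::nat \<Rightarrow> real. \<forall>j<e. (\<Sum>i<d. partial_d i (\<lambda>y. F y j) z * v i) = w j)"

text \<open>A chart is an open set together with a coordinate map; the values of the latter outside the
  open set are irrelevant. Manifolds have a fixed dimension.\<close>

type_synonym 'a chart = "'a set \<times> ('a \<Rightarrow> nat \<Rightarrow> real)"

record 'a mfd =
  mtop :: "'a topology"
  mdim :: nat
  atlas :: "'a chart set"

abbreviation mspace :: "'a mfd \<Rightarrow> 'a set" where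
  "mspace X \<equiv> topspace (mtop X)"

definition is_chart :: "'a topology \<Rightarrow> nat \<Rightarrow> 'a chart \<Rightarrow> bool" where
  "is_chart T d c \<longleftrightarrow> (case c of (U, \<phi>) \<Rightarrow>
     openin T U \<and> openin (Euclidean_space d) (\<phi> ` U) \<and>
     homeomorphic_map (subtopology T U) (subtopology (Euclidean_space d) (\<phi> ` U)) \<phi>)"

definition smooth_transition :: "nat \<Rightarrow> 'a chart \<Rightarrow> 'a chart \<Rightarrow> bool" where
  "smooth_transition d c c' \<longleftrightarrow> (case (c, c') of ((U, \<phi>), (V, \<psi>)) \<Rightarrow>
     smooth_on d d (\<phi> ` (U \<inter> V)) (\<lambda>z. \<psi> (inv_into U \<phi> z)))"

definition paracompact_top :: "'a topology \<Rightarrow> bool" where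
  "paracompact_top T \<longleftrightarrow>
     (\<forall>\<C>. (\<forall>U\<in>\<C>. openin T U) \<and> \<Union>\<C> = topspace T \<longrightarrow>
        (\<exists>\<D>. (\<forall>V\<in>\<D>. openin T V \<and> (\<exists>U\<in>\<C>. V \<subseteq> U)) \<and> \<Union>\<D> = topspace T \<and> locally_finite_in T \<D>))"

definition smooth_manifold :: "'a mfd \<Rightarrow> bool" where
  "smooth_manifold X \<longleftrightarrow>
     Hausdorff_space (mtop X) \<and> paracompact_top (mtop X) \<and>
     (\<forall>c\<in>atlas X. is_chart (mtop X) (mdim X) c) \<and>
     (\<Union>c\<in>atlas X. fst c) = mspace X \<and>
     (\<forall>c\<in>atlas X. \<forall>c'\<in>atlas X. smooth_transition (mdim X) c c')"

definition max_atlas :: "'a mfd \<Rightarrow> 'a chart set" where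
  "max_atlas X = {c. is_chart (mtop X) (mdim X) c \<and>
     (\<forall>c'\<in>atlas X. smooth_transition (mdim X) c c' \<and> smooth_transition (mdim X) c' c)}"

definition smooth_map :: "'a mfd \<Rightarrow> 'b mfd \<Rightarrow> ('a \<Rightarrow> 'b) \<Rightarrow> bool" where
  "smooth_map X Y f \<longleftrightarrow>
     continuous_map (mtop X) (mtop Y) f \<and>
     (\<forall>(U, \<phi>)\<in>atlas X. \<forall>(V, \<psi>)\<in>atlas Y.
        smooth_on (mdim X) (mdim Y) (\<phi> ` {x\<in>U. f x \<in> V}) (\<lambda>z. \<psi> (f (inv_into U \<phi> z))))"

definition submersion :: "'a mfd \<Rightarrow> 'b mfd \<Rightarrow> ('a \<Rightarrow> 'b) \<Rightarrow> bool" where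
  "submersion X Y f \<longleftrightarrow>
     smooth_map X Y f \<and>
     (\<forall>(U, \<phi>)\<in>atlas X. \<forall>(V, \<psi>)\<in>atlas Y. \<forall>x\<in>U. f x \<in> V \<longrightarrow>
        surj_differential (mdim X) (mdim Y) (\<lambda>z. \<psi> (f (inv_into U \<phi> z))) (\<phi> x))"

definition diffeomorphism :: "'a mfd \<Rightarrow> 'b mfd \<Rightarrow> ('a \<Rightarrow> 'b) \<Rightarrow> bool" where
  "diffeomorphism X Y f \<longleftrightarrow>
     bij_betw f (mspace X) (mspace Y) \<and> smooth_map X Y f \<and>
     smooth_map Y X (inv_into (mspace X) f)"

subsection \<open>Constructions\<close>

definition discrete_mfd :: "'a set \<Rightarrow> 'a mfd" where
  "discrete_mfd A = \<lparr>mtop = discrete_topology A, mdim = 0,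
     atlas = {({a}, \<lambda>_ _. 0) | a. a \<in> A}\<rparr>"

definition prod_mfd :: "'a mfd \<Rightarrow> 'b mfd \<Rightarrow> ('a \<times> 'b) mfd" where
  "prod_mfd X Y = \<lparr>mtop = prod_topology (mtop X) (mtop Y), mdim = mdim X + mdim Y,
     atlas = {(U \<times> V, \<lambda>(x, y) j. if j < mdim X then \<phi> x j else \<psi> y (j - mdim X)) | U \<phi> V \<psi>.
                (U, \<phi>) \<in> atlas X \<and> (V, \<psi>) \<in> atlas Y}\<rparr>"

text \<open>The power \<open>X\<^sup>n\<close> consists of the extensional functions on \<open>{..<n}\<close>.\<close>

definition power_mfd :: "nat \<Rightarrow> 'a mfd \<Rightarrow> (nat \<Rightarrow> 'a) mfd" where
  "power_mfd n X = \<lparr>mtop = product_topology (\<lambda>_. mtop X) {..<n}, mdim = n * mdim X,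
     atlas = {(\<Pi>\<^sub>E i\<in>{..<n}. fst (c i),
               \<lambda>x j. if j < n * mdim X
                      then snd (c (j div mdim X)) (x (j div mdim X)) (j mod mdim X) else 0) | c.
                \<forall>i<n. c i \<in> atlas X}\<rparr>"

text \<open>The embedded submanifold of dimension \<open>k\<close> carried by \<open>S\<close>, with the slice charts of \<open>X\<close>. For
  \<open>k = mdim X\<close> this is the open submanifold.\<close>

definition sub_mfd :: "nat \<Rightarrow> 'a mfd \<Rightarrow> 'a set \<Rightarrow> 'a mfd" where
  "sub_mfd k X S = \<lparr>mtop = subtopology (mtop X) S, mdim = k,
     atlas = {(U \<inter> S, \<phi>) | U \<phi>. (U, \<phi>) \<in> max_atlas X \<and>
                \<phi> ` (U \<inter> S) = \<phi> ` U \<inter> topspace (Euclidean_space k)}\<rparr>"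

text \<open>The fibered product of \<open>a : X \<rightarrow> Z\<close> and \<open>b : Y \<rightarrow> Z\<close>, one of which is meant to be a
  submersion.\<close>

definition fibre_prod ::
    "'a mfd \<Rightarrow> ('a \<Rightarrow> 'c) \<Rightarrow> 'b mfd \<Rightarrow> ('b \<Rightarrow> 'c) \<Rightarrow> 'c mfd \<Rightarrow> ('a \<times> 'b) mfd" where
  "fibre_prod X a Y b Z = sub_mfd (mdim X + mdim Y - mdim Z) (prod_mfd X Y)
     {(x, y). x \<in> mspace X \<and> y \<in> mspace Y \<and> a x = b y}"

text \<open>The structure on \<open>A\<close> transported along a bijection \<open>f\<close> from \<open>A\<close> onto \<open>X\<close>.\<close>

definition transport_mfd :: "'a set \<Rightarrow> ('a \<Rightarrow> 'b) \<Rightarrow> 'b mfd \<Rightarrow> 'a mfd" where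
  "transport_mfd A f X = \<lparr>mtop = pullback_topology A f (mtop X), mdim = mdim X,
     atlas = {(f -` U \<inter> A, \<phi> \<circ> f) | U \<phi>. (U, \<phi>) \<in> atlas X}\<rparr>"

section \<open>Hurewicz fibrations\<close>

text \<open>The homotopy lifting property is required for all test spaces on the type
  \<open>'e \<times> (real \<Rightarrow> 'b)\<close>. This is no restriction: the universal lifting problem has as its test space
  the set of pairs of a point \<open>e\<close> and a path in the base starting at \<open>p e\<close>, which lives on this type,
  and every other lifting problem is pulled back from it.\<close>

definition hurewicz_fibration :: "'e topology \<Rightarrow> 'b topology \<Rightarrow> ('e \<Rightarrow> 'b) \<Rightarrow> bool" where
  "hurewicz_fibration E B p \<longleftrightarrow>
     continuous_map E B p \<and>
     (\<forall>(Z :: ('e \<times> (real \<Rightarrow> 'b)) topology) g h.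
        continuous_map Z E g \<and>
        continuous_map (prod_topology Z (top_of_set {0..1::real})) B h \<and>
        (\<forall>z\<in>topspace Z. h (z, 0) = p (g z)) \<longrightarrow>
        (\<exists>k. continuous_map (prod_topology Z (top_of_set {0..1::real})) E k \<and>
             (\<forall>z\<in>topspace Z. k (z, 0) = g z) \<and>
             (\<forall>z\<in>topspace Z. \<forall>t\<in>{0..1}. p (k (z, t)) = h (z, t))))"

section \<open>Homotopy groups and quasifibrations\<close>

definition cube :: "nat \<Rightarrow> (nat \<Rightarrow> real) topology" where
  "cube q = product_topology (\<lambda>_. top_of_set {0..1}) {..<q}"

definition cube_boundary :: "nat \<Rightarrow> (nat \<Rightarrow> real) set" where
  "cube_boundary q = {z \<in> topspace (cube q). \<exists>i<q. z i = 0 \<or> z i = 1}"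

definition based_maps :: "nat \<Rightarrow> 'a topology \<Rightarrow> 'a \<Rightarrow> ((nat \<Rightarrow> real) \<Rightarrow> 'a) set" where
  "based_maps q X x = {g. continuous_map (cube q) X g \<and> (\<forall>z\<in>cube_boundary q. g z = x)}"

definition based_homotopy ::
    "nat \<Rightarrow> 'a topology \<Rightarrow> 'a \<Rightarrow> (((nat \<Rightarrow> real) \<Rightarrow> 'a) \<times> ((nat \<Rightarrow> real) \<Rightarrow> 'a)) set" where
  "based_homotopy q X x = {(g, g').
     g \<in> based_maps q X x \<and> g' \<in> based_maps q X x \<and>
     homotopic_with (\<lambda>h. \<forall>z\<in>cube_boundary q. h z = x) (cube q) X g g'}"

text \<open>For \<open>q = 0\<close> the cube is a point with empty boundary, and \<open>htpy_group 0 X x\<close> is the set of path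
  components.\<close>

definition htpy_group :: "nat \<Rightarrow> 'a topology \<Rightarrow> 'a \<Rightarrow> ((nat \<Rightarrow> real) \<Rightarrow> 'a) set set" where
  "htpy_group q X x = based_maps q X x // based_homotopy q X x"

definition htpy_group_map ::
    "nat \<Rightarrow> 'b topology \<Rightarrow> 'b \<Rightarrow> ('a \<Rightarrow> 'b) \<Rightarrow> ((nat \<Rightarrow> real) \<Rightarrow> 'a) set \<Rightarrow> ((nat \<Rightarrow> real) \<Rightarrow> 'b) set" where
  "htpy_group_map q Y y f C = (\<Union>g\<in>C. based_homotopy q Y y `` {f \<circ> g})"

text \<open>The induced maps preserve the group structure for \<open>q \<ge> 1\<close>, so isomorphism amounts to
  bijectivity. The last conjunct is the part of bijectivity on path components that is not seen
  when there is no base point.\<close>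

definition weak_homotopy_equivalence :: "'a topology \<Rightarrow> 'b topology \<Rightarrow> ('a \<Rightarrow> 'b) \<Rightarrow> bool" where
  "weak_homotopy_equivalence X Y f \<longleftrightarrow>
     continuous_map X Y f \<and>
     (\<forall>q. \<forall>x\<in>topspace X.
        bij_betw (htpy_group_map q Y (f x) f) (htpy_group q X x) (htpy_group q Y (f x))) \<and>
     (topspace X = {} \<longrightarrow> topspace Y = {})"

text \<open>The space of paths in \<open>B\<close>, with the compact-open topology.\<close>

definition path_space :: "'b topology \<Rightarrow> (real \<Rightarrow> 'b) topology" where
  "path_space B = topology_generated_by
     {{\<gamma>. pathin B \<gamma> \<and> \<gamma> \<in> extensional {0..1} \<and> \<gamma> ` K \<subseteq> U} | K U.
        compact K \<and> K \<subseteq> {0..1} \<and> openin B U}"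

definition homotopy_fibre ::
    "'e topology \<Rightarrow> 'b topology \<Rightarrow> ('e \<Rightarrow> 'b) \<Rightarrow> 'b \<Rightarrow> ('e \<times> (real \<Rightarrow> 'b)) topology" where
  "homotopy_fibre E B p b =
     subtopology (prod_topology E (path_space B)) {(e, \<gamma>). \<gamma> 0 = p e \<and> \<gamma> 1 = b}"

text \<open>The long exact sequence of the homotopy fibre becomes a long exact sequence for fibre, total
  space and base exactly when the comparison map below is a weak homotopy equivalence.\<close>

definition quasifibration :: "'e topology \<Rightarrow> 'b topology \<Rightarrow> ('e \<Rightarrow> 'b) \<Rightarrow> bool" where
  "quasifibration E B p \<longleftrightarrow>
     continuous_map E B p \<and>
     (\<forall>b\<in>topspace B.
        weak_homotopy_equivalence
          (subtopology E {e. p e = b})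
          (homotopy_fibre E B p b)
          (\<lambda>e. (e, \<lambda>t\<in>{0..1}. b)))"

section \<open>Lie groupoids and their fibrations\<close>

text \<open>The data of a Lie groupoid; \<open>gcomp G \<alpha> \<beta>\<close> is \<open>\<alpha> \<circ> \<beta>\<close>, meaningful if \<open>gsrc G \<alpha> = gtgt G \<beta>\<close>.\<close>

record ('o, 'm) groupoid =
  gobj :: "'o mfd"
  gmor :: "'m mfd"
  gsrc :: "'m \<Rightarrow> 'o"
  gtgt :: "'m \<Rightarrow> 'o"
  gunit :: "'o \<Rightarrow> 'm"
  ginv :: "'m \<Rightarrow> 'm"
  gcomp :: "'m \<Rightarrow> 'm \<Rightarrow> 'm"

definition gorbit :: "('o, 'm) groupoid \<Rightarrow> 'o \<Rightarrow> 'o set" where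
  "gorbit G x = gtgt G ` {\<alpha> \<in> mspace (gmor G). gsrc G \<alpha> = x}"

definition left_space ::
    "('o, 'm) groupoid \<Rightarrow> 'p mfd \<Rightarrow> ('p \<Rightarrow> 'o) \<Rightarrow> ('m \<times> 'p \<Rightarrow> 'p) \<Rightarrow> bool" where
  "left_space G P \<pi> \<mu> \<longleftrightarrow>
     smooth_map P (gobj G) \<pi> \<and>
     smooth_map (fibre_prod (gmor G) (gsrc G) P \<pi> (gobj G)) P \<mu> \<and>
     (\<forall>\<alpha>\<in>mspace (gmor G). \<forall>x\<in>mspace P. \<pi> x = gsrc G \<alpha> \<longrightarrow> \<pi> (\<mu> (\<alpha>, x)) = gtgt G \<alpha>) \<and>
     (\<forall>x\<in>mspace P. \<mu> (gunit G (\<pi> x), x) = x) \<and>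
     (\<forall>\<alpha>\<in>mspace (gmor G). \<forall>\<beta>\<in>mspace (gmor G). \<forall>x\<in>mspace P.
        \<pi> x = gsrc G \<beta> \<and> gtgt G \<beta> = gsrc G \<alpha> \<longrightarrow> \<mu> (\<alpha>, \<mu> (\<beta>, x)) = \<mu> (gcomp G \<alpha> \<beta>, x))"

text \<open>
  Fibrations are defined for homomorphisms \<open>f = (f0, f1) : K \<rightarrow> G\<close> of Lie groupoids. Being a
  homomorphism of Lie groupoids is presupposed and not repeated as a conjunct, so that the negation
  of these predicates does refer to the fibration conditions.

  The condition that the morphism space of \<open>K\<close> is the fibered product of the morphisms of \<open>G\<close> and
  the objects of \<open>K\<close>, with \<open>f1\<close> and the source map as the two projections, says that
  \<open>\<alpha> \<mapsto> (f1 \<alpha>, source of \<alpha>)\<close> identifies the two manifolds.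
\<close>

definition a_fibration ::
    "('p, 'k) groupoid \<Rightarrow> ('o, 'm) groupoid \<Rightarrow> ('p \<Rightarrow> 'o) \<Rightarrow> ('k \<Rightarrow> 'm) \<Rightarrow> bool" where
  "a_fibration K G f0 f1 \<longleftrightarrow>
     submersion (gobj K) (gobj G) f0 \<and>
     hurewicz_fibration (mtop (gobj K)) (mtop (gobj G)) f0 \<and>
     (\<exists>\<mu>. left_space G (gobj K) f0 \<mu> \<and>
        diffeomorphism (gmor K) (fibre_prod (gmor G) (gsrc G) (gobj K) f0 (gobj G))
          (\<lambda>\<alpha>. (f1 \<alpha>, gsrc K \<alpha>)) \<and>
        (\<forall>\<alpha>\<in>mspace (gmor K). gtgt K \<alpha> = \<mu> (f1 \<alpha>, gsrc K \<alpha>)))"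

definition b_fibration ::
    "('p, 'k) groupoid \<Rightarrow> ('o, 'm) groupoid \<Rightarrow> ('p \<Rightarrow> 'o) \<Rightarrow> ('k \<Rightarrow> 'm) \<Rightarrow> bool" where
  "b_fibration K G f0 f1 \<longleftrightarrow>
     submersion (gobj K) (gobj G) f0 \<and>
     hurewicz_fibration (mtop (gobj K)) (mtop (gobj G)) f0 \<and>
     submersion (gmor K) (fibre_prod (gmor G) (gsrc G) (gobj K) f0 (gobj G))
       (\<lambda>\<alpha>. (f1 \<alpha>, gsrc K \<alpha>)) \<and>
     (\<lambda>\<alpha>. (f1 \<alpha>, gsrc K \<alpha>)) ` mspace (gmor K) =
       mspace (fibre_prod (gmor G) (gsrc G) (gobj K) f0 (gobj G))"

section \<open>Configuration Lie groupoids\<close>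

text \<open>Tuples are indexed from \<open>0\<close>: the coordinates \<open>x\<^sub>1, \<dots>, x\<^sub>n\<close> are the values at \<open>0, \<dots>, n - 1\<close>.\<close>

definition PB_obj :: "nat \<Rightarrow> ('o, 'm) groupoid \<Rightarrow> (nat \<Rightarrow> 'o) mfd" where
  "PB_obj n G = sub_mfd (n * mdim (gobj G)) (power_mfd n (gobj G))
     {x. \<forall>i<n. \<forall>j<n. i \<noteq> j \<longrightarrow> gorbit G (x i) \<noteq> gorbit G (x j)}"

definition first_coords :: "nat \<Rightarrow> (nat \<Rightarrow> 'o) \<Rightarrow> nat \<Rightarrow> 'o" where
  "first_coords k x = restrict x {..<k}"

definition coordwise :: "nat \<Rightarrow> ('a \<Rightarrow> 'b) \<Rightarrow> (nat \<Rightarrow> 'a) \<Rightarrow> nat \<Rightarrow> 'b" where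
  "coordwise n f x = (\<lambda>i\<in>{..<n}. f (x i))"

subsection \<open>Type (b)\<close>

definition PBb :: "nat \<Rightarrow> ('o, 'm) groupoid \<Rightarrow> (nat \<Rightarrow> 'o, nat \<Rightarrow> 'm) groupoid" where
  "PBb n G = \<lparr>
     gobj = PB_obj n G,
     gmor = sub_mfd (n * mdim (gmor G)) (power_mfd n (gmor G))
              {\<alpha>. coordwise n (gsrc G) \<alpha> \<in> mspace (PB_obj n G) \<and>
                  coordwise n (gtgt G) \<alpha> \<in> mspace (PB_obj n G)},
     gsrc = coordwise n (gsrc G),
     gtgt = coordwise n (gtgt G),
     gunit = coordwise n (gunit G),
     ginv = coordwise n (ginv G),
     gcomp = (\<lambda>\<alpha> \<beta>. \<lambda>i\<in>{..<n}. gcomp G (\<alpha> i) (\<beta> i))\<rparr>"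

subsection \<open>Type (a)\<close>

text \<open>A morphism of the \<open>n\<close>-th groupoid is an iterated pair, starting with a morphism of \<open>G\<close> and
  adding one tuple at each further stage. The datatype houses these iterated pairs for all \<open>n\<close>.\<close>

datatype ('o, 'm) amor =
    Base (base: 'm)
  | Ext (lower: "('o, 'm) amor") (config: "nat \<Rightarrow> 'o")

fun PBa :: "nat \<Rightarrow> ('o, 'm) groupoid \<Rightarrow> (nat \<Rightarrow> 'o, ('o, 'm) amor) groupoid" where
  "PBa (Suc 0) G = \<lparr>
     gobj = PB_obj 1 G,
     gmor = transport_mfd (Base ` mspace (gmor G)) base (gmor G),
     gsrc = (\<lambda>e. \<lambda>i\<in>{..<1}. gsrc G (base e)),
     gtgt = (\<lambda>e. \<lambda>i\<in>{..<1}. gtgt G (base e)),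
     gunit = (\<lambda>x. Base (gunit G (x 0))),
     ginv = (\<lambda>e. Base (ginv G (base e))),
     gcomp = (\<lambda>e e'. Base (gcomp G (base e) (base e')))\<rparr>"
| "PBa (Suc (Suc k)) G = (let
     P = PBa (Suc k) G;
     X = PB_obj (Suc (Suc k)) G;
     R = fibre_prod (gmor P) (gsrc P) X (first_coords (Suc k)) (gobj P);
     tgt = (\<lambda>e. (gtgt P (lower e))(Suc k := config e (Suc k)))
   in \<lparr>
     gobj = X,
     gmor = transport_mfd ((\<lambda>(\<alpha>, x). Ext \<alpha> x) ` mspace R) (\<lambda>e. (lower e, config e)) R,
     gsrc = config,
     gtgt = tgt,
     gunit = (\<lambda>x. Ext (gunit P (first_coords (Suc k) x)) x),
     ginv = (\<lambda>e. Ext (ginv P (lower e)) (tgt e)),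
     gcomp = (\<lambda>e e'. Ext (gcomp P (lower e) (lower e')) (config e'))\<rparr>)"

section \<open>Global quotient orbifolds\<close>

text \<open>\<^locale>\<open>faithful_action\<close> is the library's notion of an effective action.\<close>

definition global_quotient ::
    "'a mfd \<Rightarrow> ('g, 'z) monoid_scheme \<Rightarrow> ('g \<Rightarrow> 'a \<Rightarrow> 'a) \<Rightarrow> bool" where
  "global_quotient M H \<phi> \<longleftrightarrow>
     smooth_manifold M \<and> connected_space (mtop M) \<and>
     group H \<and> finite (carrier H) \<and> faithful_action H (mspace M) \<phi> \<and>
     (\<forall>h\<in>carrier H. smooth_map M M (\<phi> h))"

definition singular_points ::
    "'a mfd \<Rightarrow> ('g, 'z) monoid_scheme \<Rightarrow> ('g \<Rightarrow> 'a \<Rightarrow> 'a) \<Rightarrow> 'a set set" where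
  "singular_points M H \<phi> =
     {orbit H \<phi> x | x. x \<in> mspace M \<and> stabilizer H \<phi> x \<noteq> {\<one>\<^bsub>H\<^esub>}}"

definition translation_groupoid ::
    "'a mfd \<Rightarrow> ('g, 'z) monoid_scheme \<Rightarrow> ('g \<Rightarrow> 'a \<Rightarrow> 'a) \<Rightarrow> ('a, 'g \<times> 'a) groupoid" where
  "translation_groupoid M H \<phi> = \<lparr>
     gobj = M,
     gmor = prod_mfd (discrete_mfd (carrier H)) M,
     gsrc = snd,
     gtgt = (\<lambda>(h, x). \<phi> h x),
     gunit = (\<lambda>x. (\<one>\<^bsub>H\<^esub>, x)),
     ginv = (\<lambda>(h, x). (inv\<^bsub>H\<^esub> h, \<phi> h x)),
     gcomp = (\<lambda>(h', y) (h, x). (h' \<otimes>\<^bsub>H\<^esub> h, x))\<rparr>"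

end

theory Submission
  imports Defs "HOL-Homology.Brouwer_Degree"
begin

text \<open>
  Let \<open>p\<close> be a fixed point of some \<open>h\<close> that is not the identity near \<open>p\<close>, let \<open>x'\<close> be a point close to \<open>p\<close>
  with \<open>h x' \<noteq> x'\<close>, and let \<open>b\<close>, \<open>b'\<close> be configurations that agree except for their first points \<open>p\<close>
  and \<open>x'\<close>. The fibre over \<open>b'\<close> has at least two punctures near \<open>p\<close>, where the fibre over \<open>b\<close> has only
  one. If the projection were a quasifibration, a sphere in the fibre over \<open>b'\<close> around the puncture
  \<open>x'\<close> alone would come from a sphere \<open>\<tau>\<close> in the fibre over \<open>b\<close>, by surjectivity at \<open>b\<close>. Pushed radially
  away from the orbit of \<open>p\<close>, \<open>\<tau>\<close> avoids all orbits on the way from \<open>p\<close> to \<open>x'\<close>, so by injectivity at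
  \<open>b'\<close> both spheres are homotopic in the fibre over \<open>b'\<close>. Collapsing the complement of a ball around \<open>p\<close>
  and inverting in a sphere about \<open>h x'\<close> turns the first sphere into a round sphere about the image of
  \<open>x'\<close> in punctured Euclidean space and makes the second one null-homotopic, contradicting the
  theory of the degree. Working with these two maps only, and not with the abstract homotopy types of
  the fibres, is essential: if \<open>M\<close> has infinite topology, the two fibres can be homotopy equivalent.

  A Hurewicz fibration is a quasifibration, because the fibre is homotopy equivalent to the homotopy
  fibre.
\<close>

section \<open>Path spaces\<close>

text \<open>The puncture \<open>h x'\<close> is what makes the degree usable. With \<open>x'\<close>
  as the only puncture in the ball, collapsing the complement of the ball would give a sphere minus
  one point, which is contractible; a sphere minus two points is a punctured Euclidean space. That
  \<open>h\<close> fixes \<open>p\<close> puts both punctures into one ball and lets them merge at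
  \<open>p\<close>, so that pushing away from the orbit of \<open>p\<close> clears both. The
  recurrent obstacle is the base point. It travels whenever a map is carried from one fibre to
  another or along a homotopy to the identity. Maps on cubes therefore get a collar that records the
  path of the base point, and two free homotopies with the same boundary track are compared through
  it. The push needed to clear the orbits is small and fixes the base point. The push across the
  whole ball, which kills the second sphere, moves it, so essentiality is proved against all
  homotopies that collapse the boundary of the cube at each time, not only against based ones. The
  spheres have dimension \<open>q = mdim M - 1\<close>; dimension at least 2 makes \<open>q\<close>
  positive, which the description of the sphere as a quotient of the cube requires.\<close>

abbreviation unit_interval :: "real topology" where
  "unit_interval \<equiv> top_of_set {0..1}"

lemma continuous_map_compose':
  "continuous_map Y Z g \<Longrightarrow> continuous_map X Y f \<Longrightarrow> continuous_map X Z (\<lambda>x. g (f x))"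
  using continuous_map_compose[of X Y f Z g] by (simp add: o_def)

lemma continuous_map_fst' [continuous_intros]:
  "continuous_map X (prod_topology Y Z) f \<Longrightarrow> continuous_map X Y (\<lambda>x. fst (f x))"
  by (rule continuous_map_compose'[OF continuous_map_fst])

lemma continuous_map_snd' [continuous_intros]:
  "continuous_map X (prod_topology Y Z) f \<Longrightarrow> continuous_map X Z (\<lambda>x. snd (f x))"
  by (rule continuous_map_compose'[OF continuous_map_snd])

lemma continuous_map_into_unit_interval:
  "continuous_map X euclideanreal f \<Longrightarrow> (\<And>x. x \<in> topspace X \<Longrightarrow> f x \<in> {0..1})
    \<Longrightarrow> continuous_map X unit_interval f"
  by (auto simp: continuous_map_in_subtopology)

lemma continuous_map_from_unit_interval:
  "continuous_map X unit_interval f \<Longrightarrow> continuous_map X euclideanreal f"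
  by (auto simp: continuous_map_in_subtopology)

lemma topspace_path_space:
  "topspace (path_space B) = {\<gamma>. pathin B \<gamma> \<and> \<gamma> \<in> extensional {0..1}}"
proof
  show "topspace (path_space B) \<subseteq> {\<gamma>. pathin B \<gamma> \<and> \<gamma> \<in> extensional {0..1}}"
    by (auto simp: path_space_def)
  \<comment> \<open>For \<open>K = {}\<close> the subbasic set imposes no condition and is the whole
    path space.\<close>
  have "{\<gamma>. pathin B \<gamma> \<and> \<gamma> \<in> extensional {0..1}}
      = {\<gamma>. pathin B \<gamma> \<and> \<gamma> \<in> extensional {0..1} \<and> \<gamma> ` {} \<subseteq> {}}" by simp
  then show "{\<gamma>. pathin B \<gamma> \<and> \<gamma> \<in> extensional {0..1}} \<subseteq> topspace (path_space B)"
    unfolding path_space_def topology_generated_by_topspace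
    by (intro Union_upper CollectI exI[of _ "{}"] conjI) auto
qed

lemma openin_path_space:
  assumes "compact K" "K \<subseteq> {0..1}" "openin B U"
  shows "openin (path_space B) {\<gamma>. pathin B \<gamma> \<and> \<gamma> \<in> extensional {0..1} \<and> \<gamma> ` K \<subseteq> U}"
  unfolding path_space_def using assms by (intro topology_generated_by_Basis) blast

text \<open>Currying, one half of the exponential law. Compactness of \<open>K\<close> allows the
  tube lemma around \<open>{x} \<times> K\<close>, which makes preimages of subbasic sets
  open.\<close>

lemma continuous_map_into_path_space:
  assumes f: "continuous_map (prod_topology X unit_interval) B (\<lambda>z. f (fst z) (snd z))"
  shows "continuous_map X (path_space B) (\<lambda>x. \<lambda>t\<in>{0..1}. f x t)"
proof -
  have path: "pathin B (\<lambda>t\<in>{0..1}. f x t)" if "x \<in> topspace X" for x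
  proof -
    have "continuous_map unit_interval B (\<lambda>t. f (fst (x, t)) (snd (x, t)))"
      by (rule continuous_map_compose'[OF f]) (use that in \<open>auto intro!: continuous_intros\<close>)
    then show ?thesis unfolding pathin_def
      by (rule continuous_map_eq) auto
  qed
  show ?thesis
    unfolding path_space_def
  proof (rule continuous_on_generated_topo)
    fix V assume "V \<in> {{\<gamma>. pathin B \<gamma> \<and> \<gamma> \<in> extensional {0..1} \<and> \<gamma> ` K \<subseteq> U} | K U.
        compact K \<and> K \<subseteq> {0..1} \<and> openin B U}"
    then obtain K U where V: "V = {\<gamma>. pathin B \<gamma> \<and> \<gamma> \<in> extensional {0..1} \<and> \<gamma> ` K \<subseteq> U}"
      and K: "compact K" "K \<subseteq> {0..1}" and U: "openin B U" by blast
    let ?W = "{z \<in> topspace (prod_topology X unit_interval). f (fst z) (snd z) \<in> U}"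
    have W: "openin (prod_topology X unit_interval) ?W"
      by (rule openin_continuous_map_preimage[OF f U])
    have eq: "(\<lambda>x. \<lambda>t\<in>{0..1}. f x t) -` V \<inter> topspace X = {x \<in> topspace X. \<forall>t\<in>K. f x t \<in> U}"
      using path K by (auto simp: V image_subset_iff subset_iff)
    have cK: "compactin unit_interval K"
      using K by (simp add: compactin_subtopology)
    show "openin X ((\<lambda>x. \<lambda>t\<in>{0..1}. f x t) -` V \<inter> topspace X)"
      unfolding eq
    proof (subst openin_subopen, intro ballI)
      fix x assume x: "x \<in> {x \<in> topspace X. \<forall>t\<in>K. f x t \<in> U}"
      then have "{x} \<times> K \<subseteq> ?W" using K by auto
      then obtain A C where A: "openin X A" "x \<in> A" "K \<subseteq> C" "A \<times> C \<subseteq> ?W"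
        using tube_lemma_right[OF W cK, of x] x by auto
      then show "\<exists>T. openin X T \<and> x \<in> T \<and> T \<subseteq> {x \<in> topspace X. \<forall>t\<in>K. f x t \<in> U}"
        using openin_subset[OF A(1)] A(4) A(3) by (intro exI[of _ A]) (auto simp: subset_iff)
    qed
  next
    show "(\<lambda>x. \<lambda>t\<in>{0..1}. f x t) ` topspace X \<subseteq> \<Union> {{\<gamma>. pathin B \<gamma> \<and> \<gamma> \<in> extensional {0..1}
        \<and> \<gamma> ` K \<subseteq> U} | K U. compact K \<and> K \<subseteq> {0..1} \<and> openin B U}"
      using path topspace_path_space[of B] unfolding path_space_def topology_generated_by_topspace
      by auto
  qed
qed

text \<open>Evaluation, the other half of the exponential law. It rests on local compactness of the
  interval: \<open>t\<close> has a compact neighbourhood that \<open>\<gamma>\<close> maps into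
  \<open>U\<close>.\<close>

lemma continuous_map_path_eval:
  "continuous_map (prod_topology (path_space B) unit_interval) B (\<lambda>z. fst z (snd z))"
  unfolding continuous_map_def
proof (intro conjI allI impI)
  show "(\<lambda>z. fst z (snd z)) \<in> topspace (prod_topology (path_space B) unit_interval) \<rightarrow> topspace B"
    by (auto simp: topspace_path_space pathin_def continuous_map_def Pi_iff)
  fix U assume U: "openin B U"
  let ?W = "{z \<in> topspace (prod_topology (path_space B) unit_interval). fst z (snd z) \<in> U}"
  show "openin (prod_topology (path_space B) unit_interval) ?W"
  proof (subst openin_subopen, intro ballI)
    fix z assume "z \<in> ?W"
    then obtain \<gamma> t where z: "z = (\<gamma>, t)" and g: "pathin B \<gamma>" "\<gamma> \<in> extensional {0..1}"
      and t: "t \<in> {0..1}" "\<gamma> t \<in> U"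
      by (auto simp: topspace_path_space)
    have "openin unit_interval {s \<in> {0..1}. \<gamma> s \<in> U}"
      using openin_continuous_map_preimage[of unit_interval B \<gamma> U] g U by (simp add: pathin_def)
    then obtain e where e: "e > 0" "\<And>s. s \<in> {0..1} \<Longrightarrow> dist s t < e \<Longrightarrow> \<gamma> s \<in> U"
      using t unfolding openin_euclidean_subtopology_iff by auto
    define K where "K = cball t (e/2) \<inter> {0..1}"
    have K: "compact K" "K \<subseteq> {0..1}" unfolding K_def by (auto intro: compact_Int)
    have gK: "\<gamma> ` K \<subseteq> U" using e by (auto simp: K_def dist_commute)
    let ?N = "{\<gamma>. pathin B \<gamma> \<and> \<gamma> \<in> extensional {0..1} \<and> \<gamma> ` K \<subseteq> U}"
    have "openin (prod_topology (path_space B) unit_interval) (?N \<times> ({0..1} \<inter> ball t (e/2)))"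
      using openin_path_space[OF K U] by (auto simp: openin_prod_Times_iff openin_open)
    moreover have "z \<in> ?N \<times> ({0..1} \<inter> ball t (e/2))"
      using g gK t e z by auto
    moreover have "?N \<times> ({0..1} \<inter> ball t (e/2)) \<subseteq> ?W"
      by (auto simp: topspace_path_space K_def image_subset_iff)
    ultimately show "\<exists>T. openin (prod_topology (path_space B) unit_interval) T \<and> z \<in> T \<and> T \<subseteq> ?W"
      by blast
  qed
qed

lemma continuous_map_path_eval':
  assumes "continuous_map X (path_space B) f" "continuous_map X unit_interval u"
  shows "continuous_map X B (\<lambda>x. f x (u x))"
  using continuous_map_compose'[OF continuous_map_path_eval, where f = "\<lambda>x. (f x, u x)"] assms
  by (simp add: continuous_map_paired)

lemma topspace_homotopy_fibre:
  "topspace (homotopy_fibre E B p b) = {(e, \<gamma>). e \<in> topspace E \<and> pathin B \<gamma>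
     \<and> \<gamma> \<in> extensional {0..1} \<and> \<gamma> 0 = p e \<and> \<gamma> 1 = b}"
  by (auto simp: homotopy_fibre_def topspace_path_space)

lemma continuous_map_into_homotopy_fibre:
  assumes "continuous_map X E e"
    and "continuous_map (prod_topology X unit_interval) B (\<lambda>z. \<gamma> (fst z) (snd z))"
    and "\<And>x. x \<in> topspace X \<Longrightarrow> \<gamma> x 0 = p (e x) \<and> \<gamma> x 1 = b"
  shows "continuous_map X (homotopy_fibre E B p b) (\<lambda>x. (e x, \<lambda>t\<in>{0..1}. \<gamma> x t))"
  unfolding homotopy_fibre_def
  by (intro continuous_map_into_subtopology continuous_map_pairedI
      continuous_map_into_path_space assms) (use assms in auto)

lemma continuous_map_homotopy_fibre_fst:
  "continuous_map (homotopy_fibre E B p b) E fst"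
  unfolding homotopy_fibre_def by (rule continuous_map_subtopology_fst)

lemma continuous_map_homotopy_fibre_snd:
  "continuous_map (homotopy_fibre E B p b) (path_space B) snd"
  unfolding homotopy_fibre_def by (rule continuous_map_subtopology_snd)

section \<open>Cubes and based homotopies\<close>

text \<open>Time comes first, the order that \<open>homotopic_with\<close> uses.\<close>

abbreviation cylinder :: "nat \<Rightarrow> (real \<times> (nat \<Rightarrow> real)) topology" where
  "cylinder q \<equiv> prod_topology unit_interval (cube q)"

lemma topspace_cube: "topspace (cube q) = (\<Pi>\<^sub>E i\<in>{..<q}. {0..1})"
  by (simp add: cube_def)

lemma cube_boundary_subset: "z \<in> cube_boundary q \<Longrightarrow> z \<in> topspace (cube q)"
  by (simp add: cube_boundary_def)

lemma cube_coord: "z \<in> topspace (cube q) \<Longrightarrow> i < q \<Longrightarrow> 0 \<le> z i \<and> z i \<le> 1"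
  by (auto simp: topspace_cube PiE_iff)

lemma continuous_map_cube_coord:
  assumes "continuous_map X (cube q) f" "i < q"
  shows "continuous_map X euclideanreal (\<lambda>x. f x i)"
proof -
  have "continuous_map X unit_interval (\<lambda>x. f x i)"
    using assms unfolding cube_def by (auto simp: continuous_map_componentwise)
  then show ?thesis by (rule continuous_map_from_unit_interval)
qed

lemma continuous_map_into_cube:
  assumes "\<And>i. i < q \<Longrightarrow> continuous_map X euclideanreal (\<lambda>x. f x i)"
    and "\<And>x. x \<in> topspace X \<Longrightarrow> f x \<in> topspace (cube q)"
  shows "continuous_map X (cube q) f"
  unfolding cube_def continuous_map_componentwise
proof (intro conjI ballI)
  show "f ` topspace X \<subseteq> extensional {..<q}"
    using assms(2) by (fastforce simp: topspace_cube PiE_iff)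
  show "continuous_map X unit_interval (\<lambda>x. f x i)" if "i \<in> {..<q}" for i
    using that assms(1) cube_coord[OF assms(2)] by (intro continuous_map_into_unit_interval) auto
qed

text \<open>\<open>cube_expand\<close> stretches the middle third of the cube onto the whole cube and sends the remaining
  collar to the boundary; \<open>cube_collar\<close> is \<open>0\<close> exactly on the middle third and \<open>1\<close> on the boundary.\<close>

definition cube_expand :: "nat \<Rightarrow> real \<Rightarrow> (nat \<Rightarrow> real) \<Rightarrow> nat \<Rightarrow> real" where
  "cube_expand q v z = (\<lambda>i\<in>{..<q}. max 0 (min 1 (z i + v * (2 * z i - 1))))"

definition cube_collar :: "nat \<Rightarrow> (nat \<Rightarrow> real) \<Rightarrow> real" where
  "cube_collar q z = 1 - (\<Prod>i<q. min 1 (min (3 * z i) (3 * (1 - z i))))"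

lemma cube_expand_in_cube: "cube_expand q v z \<in> topspace (cube q)"
  by (auto simp: cube_expand_def topspace_cube)

lemma cube_expand_0: "z \<in> topspace (cube q) \<Longrightarrow> cube_expand q 0 z = z"
proof (rule ext)
  fix i assume z: "z \<in> topspace (cube q)"
  show "cube_expand q 0 z i = z i"
    using cube_coord[OF z, of i] z
    by (cases "i < q") (auto simp: cube_expand_def topspace_cube PiE_iff extensional_def)
qed

text \<open>A coordinate equal to 0 or 1 is moved outwards, and the clipping brings it back.\<close>

lemma cube_expand_boundary:
  assumes "z \<in> cube_boundary q" "v \<ge> 0"
  shows "cube_expand q v z \<in> cube_boundary q"
  using assms cube_expand_in_cube[of q v z]
  by (fastforce simp: cube_boundary_def cube_expand_def min_def max_def)

lemma cube_collar_bounds: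
  assumes "z \<in> topspace (cube q)"
  shows "0 \<le> cube_collar q z" "cube_collar q z \<le> 1"
proof -
  have "0 \<le> (\<Prod>i<q. min 1 (min (3 * z i) (3 * (1 - z i))))"
    using cube_coord[OF assms] by (intro prod_nonneg) auto
  moreover have "(\<Prod>i<q. min 1 (min (3 * z i) (3 * (1 - z i)))) \<le> 1"
    using cube_coord[OF assms] by (intro prod_le_1) auto
  ultimately show "0 \<le> cube_collar q z" "cube_collar q z \<le> 1"
    by (auto simp: cube_collar_def)
qed

lemma cube_collar_boundary:
  assumes "z \<in> cube_boundary q" shows "cube_collar q z = 1"
proof -
  obtain i where i: "i < q" "z i = 0 \<or> z i = 1"
    using assms by (auto simp: cube_boundary_def)
  then have "min 1 (min (3 * z i) (3 * (1 - z i))) = 0" by auto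
  then have "(\<Prod>i<q. min 1 (min (3 * z i) (3 * (1 - z i)))) = 0"
    using i by (intro prod_zero) auto
  then show ?thesis by (simp add: cube_collar_def)
qed

text \<open>With parameter 1 a coordinate \<open>c\<close> becomes \<open>3 * c - 1\<close>,
  clipped, which is 0 for \<open>c \<le> 1/3\<close> and 1 for \<open>c \<ge> 2/3\<close>. A nonzero
  collar value means that some coordinate lies in one of these ranges.\<close>

lemma cube_collar_expand:
  assumes "z \<in> topspace (cube q)" "cube_collar q z \<noteq> 0"
  shows "cube_expand q 1 z \<in> cube_boundary q"
proof -
  have "\<exists>i<q. min 1 (min (3 * z i) (3 * (1 - z i))) \<noteq> 1"
  proof (rule ccontr)
    assume "\<not> ?thesis"
    then have "(\<Prod>i<q. min 1 (min (3 * z i) (3 * (1 - z i)))) = 1"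
      by (intro prod.neutral) auto
    then show False using assms by (simp add: cube_collar_def)
  qed
  then obtain i where "i < q" "3 * z i < 1 \<or> 3 * (1 - z i) < 1" by (auto simp: min_def split: if_splits)
  then have "i < q \<and> (cube_expand q 1 z i = 0 \<or> cube_expand q 1 z i = 1)"
    by (auto simp: cube_expand_def)
  then show ?thesis
    using cube_expand_in_cube[of q 1 z] by (auto simp: cube_boundary_def)
qed

lemma continuous_map_cube_expand:
  assumes "continuous_map X (cube q) f" "continuous_map X euclideanreal v"
  shows "continuous_map X (cube q) (\<lambda>x. cube_expand q (v x) (f x))"
proof (rule continuous_map_into_cube)
  fix i assume "i < q"
  then show "continuous_map X euclideanreal (\<lambda>x. cube_expand q (v x) (f x) i)"
    using continuous_map_cube_coord[OF assms(1)] assms(2)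
    by (auto simp: cube_expand_def intro!: continuous_intros)
qed (rule cube_expand_in_cube)

lemma continuous_map_cube_collar:
  assumes "continuous_map X (cube q) f"
  shows "continuous_map X unit_interval (\<lambda>x. cube_collar q (f x))"
proof (rule continuous_map_into_unit_interval)
  show "continuous_map X euclideanreal (\<lambda>x. cube_collar q (f x))"
    unfolding cube_collar_def
    using continuous_map_cube_coord[OF assms] by (auto intro!: continuous_intros)
  show "cube_collar q (f x) \<in> {0..1}" if "x \<in> topspace X" for x
    using cube_collar_bounds[of "f x" q] continuous_map_funspace[OF assms] that by auto
qed

section \<open>Based homotopy as an equivalence relation\<close>

lemma based_homotopyI:
  assumes "continuous_map (cylinder q) X h"
    and "\<And>u z. u \<in> {0..1} \<Longrightarrow> z \<in> cube_boundary q \<Longrightarrow> h (u, z) = x"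
    and "\<And>z. z \<in> topspace (cube q) \<Longrightarrow> h (0, z) = g z"
    and "\<And>z. z \<in> topspace (cube q) \<Longrightarrow> h (1, z) = g' z"
  shows "(g, g') \<in> based_homotopy q X x"
proof -
  have hom: "homotopic_with (\<lambda>h. \<forall>z\<in>cube_boundary q. h z = x) (cube q) X g g'"
    by (subst homotopic_with) (use assms in \<open>auto simp: cube_boundary_subset intro!: exI[of _ h]\<close>)
  then show ?thesis
    using homotopic_with_imp_continuous_maps[OF hom] homotopic_with_imp_property[OF hom]
    by (auto simp: based_homotopy_def based_maps_def)
qed

lemma based_homotopyE:
  assumes "(g, g') \<in> based_homotopy q X x"
  obtains h where "continuous_map (cylinder q) X h"
    and "\<And>u z. u \<in> {0..1} \<Longrightarrow> z \<in> cube_boundary q \<Longrightarrow> h (u, z) = x"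
    and "\<And>z. h (0, z) = g z" and "\<And>z. h (1, z) = g' z"
  using assms unfolding based_homotopy_def homotopic_with_def by blast

lemma based_homotopy_maps:
  assumes "(g, g') \<in> based_homotopy q X x"
  shows "g \<in> based_maps q X x" "g' \<in> based_maps q X x"
  using assms by (auto simp: based_homotopy_def)

lemma based_homotopy_refl: "g \<in> based_maps q X x \<Longrightarrow> (g, g) \<in> based_homotopy q X x"
  by (auto simp: based_homotopy_def based_maps_def)

lemma based_homotopy_sym: "(g, g') \<in> based_homotopy q X x \<Longrightarrow> (g', g) \<in> based_homotopy q X x"
  by (auto simp: based_homotopy_def intro: homotopic_with_symD)

lemma based_homotopy_trans:
  "(g, g') \<in> based_homotopy q X x \<Longrightarrow> (g', g'') \<in> based_homotopy q X x
    \<Longrightarrow> (g, g'') \<in> based_homotopy q X x"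
  by (auto simp: based_homotopy_def intro: homotopic_with_trans)

text \<open>Maps are functions on all of \<open>nat \<Rightarrow> real\<close> and may differ off
  the cube, so agreement on the cube is recorded as a homotopy instead of an equation.\<close>

lemma based_homotopy_eq:
  assumes "g \<in> based_maps q X x" "\<And>z. z \<in> topspace (cube q) \<Longrightarrow> g z = g' z"
  shows "(g, g') \<in> based_homotopy q X x"
  using assms
  by (intro based_homotopyI[where h = "\<lambda>p. g (snd p)"] continuous_map_compose'[OF _ continuous_map_snd])
    (auto simp: based_maps_def)

lemma based_homotopy_compose:
  assumes "(g, g') \<in> based_homotopy q X x" "continuous_map X Y f"
  shows "(\<lambda>z. f (g z), \<lambda>z. f (g' z)) \<in> based_homotopy q Y (f x)"
proof -
  obtain h where "continuous_map (cylinder q) X h"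
    "\<And>u z. u \<in> {0..1} \<Longrightarrow> z \<in> cube_boundary q \<Longrightarrow> h (u, z) = x"
    "\<And>z. h (0, z) = g z" "\<And>z. h (1, z) = g' z"
    using based_homotopyE[OF assms(1)] by metis
  then show ?thesis
    by (intro based_homotopyI[where h = "\<lambda>p. f (h p)"] continuous_map_compose'[OF assms(2)]) auto
qed

lemma equiv_based_homotopy: "equiv (based_maps q X x) (based_homotopy q X x)"
proof (rule equivI)
  show "based_homotopy q X x \<subseteq> based_maps q X x \<times> based_maps q X x"
    by (auto dest: based_homotopy_maps)
  show "refl_on (based_maps q X x) (based_homotopy q X x)"
    by (rule refl_onI) (rule based_homotopy_refl)
  show "sym (based_homotopy q X x)"
    by (rule symI) (rule based_homotopy_sym)
  show "trans (based_homotopy q X x)"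
    by (rule transI) (rule based_homotopy_trans)
qed

section \<open>Change of base point along a path\<close>

lemma continuous_map_homotopy_slices:
  assumes "continuous_map (prod_topology unit_interval Z) X h"
    and "continuous_map W unit_interval a" "continuous_map W Z b"
  shows "continuous_map W X (\<lambda>w. h (a w, b w))"
  by (rule continuous_map_compose'[OF assms(1)]) (intro continuous_map_pairedI assms(2,3))

text \<open>The homotopy varies the expansion parameter between 0 and 1; the boundary stays on the
  boundary, so the base point does not move.\<close>

lemma based_homotopy_expand:
  assumes "g \<in> based_maps q X x"
  shows "(\<lambda>z. g (cube_expand q 1 z), g) \<in> based_homotopy q X x"
proof (rule based_homotopy_sym, rule based_homotopyI[where h = "\<lambda>p. g (cube_expand q (fst p) (snd p))"])
  show "continuous_map (cylinder q) X
     (\<lambda>p. g (cube_expand q (fst p) (snd p)))"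
  proof (rule continuous_map_compose'[where g = g])
    show "continuous_map (cube q) X g" using assms by (simp add: based_maps_def)
  qed (intro continuous_map_cube_expand continuous_map_snd
      continuous_map_from_unit_interval[OF continuous_map_fst])
qed (use assms cube_expand_boundary in \<open>auto simp: based_maps_def cube_expand_0\<close>)

text \<open>Attaching the path traced by the boundary as a collar makes a free homotopy based.\<close>

lemma based_homotopy_collar:
  assumes A: "continuous_map (cylinder q) X A"
    and d: "\<And>u z. u \<in> {0..1} \<Longrightarrow> z \<in> cube_boundary q \<Longrightarrow> A (u, z) = d u"
  shows "(\<lambda>z. A (cube_collar q z, cube_expand q 1 z), \<lambda>z. A (1, z)) \<in> based_homotopy q X (d 1)"
proof (rule based_homotopy_trans)
  \<comment> \<open>Raising the time to at least \<open>fst p\<close> shortens the path in the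
    collar until only its end \<open>d 1\<close> is left. On the boundary the collar value is 1, so
    the value there is \<open>d 1\<close> throughout.\<close>
  let ?h = "\<lambda>p. A (max (fst p) (cube_collar q (snd p)), cube_expand q 1 (snd p))"
  show "(\<lambda>z. A (cube_collar q z, cube_expand q 1 z), \<lambda>z. A (1, cube_expand q 1 z))
      \<in> based_homotopy q X (d 1)"
  proof (rule based_homotopyI[where h = ?h])
    have coll: "continuous_map (cylinder q) unit_interval
        (\<lambda>p. cube_collar q (snd p))"
      by (rule continuous_map_cube_collar[OF continuous_map_snd])
    have "continuous_map (cylinder q) unit_interval
        (\<lambda>p. max (fst p) (cube_collar q (snd p)))"
      using cube_collar_bounds
      by (intro continuous_map_into_unit_interval continuous_map_real_max
          continuous_map_from_unit_interval[OF continuous_map_fst]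
          continuous_map_from_unit_interval[OF coll]) (auto simp: le_max_iff_disj)
    then show "continuous_map (cylinder q) X ?h"
      by (intro continuous_map_homotopy_slices[OF A] continuous_map_cube_expand continuous_map_snd) auto
  qed (auto simp: d cube_collar_boundary cube_expand_boundary cube_collar_bounds max_absorb1
      max_absorb2)
  have "(\<lambda>z. A (1, z)) \<in> based_maps q X (d 1)"
    unfolding based_maps_def
    using d[of 1] continuous_map_homotopy_slices[OF A, of "cube q" "\<lambda>_. 1" "\<lambda>z. z"] by auto
  then show "(\<lambda>z. A (1, cube_expand q 1 z), \<lambda>z. A (1, z)) \<in> based_homotopy q X (d 1)"
    by (rule based_homotopy_expand)
qed

text \<open>Pasting along two closed sets: where the collar function vanishes, and where the
  expansion lies on the boundary. They cover \<open>W\<close>; on their overlap the first branch is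
  \<open>d 0\<close> and \<open>c w\<close> is 0. The maps \<open>a\<close>, \<open>b\<close>,
  \<open>c\<close> are left general because the collar is attached both to a homotopy and to a
  single map.\<close>

lemma continuous_map_attach_collar:
  assumes K: "continuous_map (prod_topology Z (cube q)) X K"
    and d: "continuous_map unit_interval X d"
    and eq: "\<And>u z. u \<in> topspace Z \<Longrightarrow> z \<in> cube_boundary q \<Longrightarrow> K (u, z) = d 0"
    and a: "continuous_map W Z a" and b: "continuous_map W (cube q) b"
    and c: "continuous_map W unit_interval c"
    and c0: "\<And>w. w \<in> topspace W \<Longrightarrow> cube_collar q (b w) = 0 \<Longrightarrow> c w = 0"
  shows "continuous_map W X (\<lambda>w. if cube_collar q (b w) = 0 then K (a w, cube_expand q 1 (b w))
           else d (c w))"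
proof -
  let ?F = "{w \<in> topspace W. cube_collar q (b w) = 0}"
  let ?G = "{w \<in> topspace W. cube_expand q 1 (b w) \<in> cube_boundary q}"
  have bW: "b w \<in> topspace (cube q)" if "w \<in> topspace W" for w
    using continuous_map_funspace[OF b] that by auto
  have aW: "a w \<in> topspace Z" if "w \<in> topspace W" for w
    using continuous_map_funspace[OF a] that by auto
  have "continuous_map W euclideanreal (\<lambda>w. cube_collar q (b w))"
    by (intro continuous_map_from_unit_interval continuous_map_cube_collar b)
  from closedin_continuous_map_preimage[OF this, of "{0}"]
  have F: "closedin W ?F" by simp
  have bd: "continuous_map W (cube q) (\<lambda>w. cube_expand q 1 (b w))"
    by (intro continuous_map_cube_expand b) simp
  have "?G = (\<Union>i<q. {w \<in> topspace W. cube_expand q 1 (b w) i \<in> {0, 1}})"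
    using cube_expand_in_cube by (auto simp: cube_boundary_def)
  moreover have "closedin W {w \<in> topspace W. cube_expand q 1 (b w) i \<in> {0, 1}}" if "i < q" for i
    by (rule closedin_continuous_map_preimage[OF continuous_map_cube_coord[OF bd that]]) auto
  ultimately have G: "closedin W ?G"
    by (auto intro!: closedin_Union)
  have cov: "w \<in> ?F \<or> w \<in> ?G" if "w \<in> topspace W" for w
    using cube_collar_expand[OF bW[OF that]] that by auto
  let ?T = "\<lambda>i. if i then ?F else ?G"
  let ?f = "\<lambda>i w. if i then K (a w, cube_expand q 1 (b w)) else d (c w)"
  show ?thesis
  proof (rule pasting_lemma_closed[where I = "{True, False}" and T = ?T and f = ?f])
    show "continuous_map (subtopology W (?T i)) X (?f i)" if "i \<in> {True, False}" for i
      using continuous_map_compose'[OF K continuous_map_pairedI[OF a bd]]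
        continuous_map_compose'[OF d c] continuous_map_from_subtopology
      by (cases i) auto
    show "?f i x = ?f j x" if "i \<in> {True, False}" "j \<in> {True, False}"
      "x \<in> topspace W \<inter> ?T i \<inter> ?T j" for i j x
      using that eq aW c0 by (cases i; cases j) auto
    show "\<exists>j. j \<in> {True, False} \<and> x \<in> ?T j \<and>
        (if cube_collar q (b x) = 0 then K (a x, cube_expand q 1 (b x)) else d (c x)) = ?f j x"
      if "x \<in> topspace W" for x
      using that cov[OF that] by (cases "cube_collar q (b x) = 0") auto
  qed (use F G in auto)
qed

text \<open>Change of base point along \<open>d\<close> is well defined on classes: by
  \<open>based_homotopy_collar\<close> each final map is the initial map with the collar
  \<open>d\<close> attached, and a based homotopy of the initial maps extends by the same
  collar.\<close>

lemma based_homotopy_transport: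
  assumes A: "continuous_map (cylinder q) X A"
    and A': "continuous_map (cylinder q) X A'"
    and d: "continuous_map unit_interval X d"
    and Ad: "\<And>u z. u \<in> {0..1} \<Longrightarrow> z \<in> cube_boundary q \<Longrightarrow> A (u, z) = d u"
    and A'd: "\<And>u z. u \<in> {0..1} \<Longrightarrow> z \<in> cube_boundary q \<Longrightarrow> A' (u, z) = d u"
    and K: "(\<lambda>z. A (0, z), \<lambda>z. A' (0, z)) \<in> based_homotopy q X (d 0)"
  shows "(\<lambda>z. A (1, z), \<lambda>z. A' (1, z)) \<in> based_homotopy q X (d 1)"
proof -
  obtain k where k: "continuous_map (cylinder q) X k"
    "\<And>u z. u \<in> {0..1} \<Longrightarrow> z \<in> cube_boundary q \<Longrightarrow> k (u, z) = d 0"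
    "\<And>z. k (0, z) = A (0, z)" "\<And>z. k (1, z) = A' (0, z)"
    using based_homotopyE[OF K] by metis
  let ?h = "\<lambda>p. if cube_collar q (snd p) = 0 then k (fst p, cube_expand q 1 (snd p))
      else d (cube_collar q (snd p))"
  have hcont: "continuous_map (cylinder q) X ?h"
    by (rule continuous_map_attach_collar[OF k(1) d _ continuous_map_fst continuous_map_snd
        continuous_map_cube_collar[OF continuous_map_snd]]) (auto simp: k(2))
  \<comment> \<open>Where the collar is positive the expansion lies on the boundary, so
    \<open>A\<close> and \<open>A'\<close> both reduce to the common track \<open>d\<close>
    there.\<close>
  have Ae: "A (cube_collar q z, cube_expand q 1 z) = ?h (0, z)" if "z \<in> topspace (cube q)" for z
    using that Ad cube_collar_expand cube_collar_bounds by (auto simp: k)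
  have A'e: "A' (cube_collar q z, cube_expand q 1 z) = ?h (1, z)" if "z \<in> topspace (cube q)" for z
    using that A'd cube_collar_expand cube_collar_bounds by (auto simp: k)
  have "(\<lambda>z. A (cube_collar q z, cube_expand q 1 z), \<lambda>z. A' (cube_collar q z, cube_expand q 1 z))
      \<in> based_homotopy q X (d 1)"
    by (rule based_homotopyI[OF hcont]) (auto simp: Ae A'e cube_collar_boundary)
  then show ?thesis
    using based_homotopy_collar[OF A Ad] based_homotopy_collar[OF A' A'd]
    by (meson based_homotopy_trans based_homotopy_sym)
qed

section \<open>Weak homotopy equivalences\<close>

lemma htpy_group_map_class:
  assumes f: "continuous_map X Y f" and g: "g \<in> based_maps q X x"
  shows "htpy_group_map q Y (f x) f (based_homotopy q X x `` {g}) = based_homotopy q Y (f x) `` {f \<circ> g}"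
proof -
  have "based_homotopy q Y (f x) `` {f \<circ> g'} = based_homotopy q Y (f x) `` {f \<circ> g}"
    if "(g, g') \<in> based_homotopy q X x" for g'
    by (rule sym, rule equiv_class_eq[OF equiv_based_homotopy])
      (use based_homotopy_compose[OF that f] in \<open>simp add: o_def\<close>)
  moreover have "(g, g) \<in> based_homotopy q X x" by (rule based_homotopy_refl[OF g])
  ultimately show ?thesis
    unfolding htpy_group_map_def by blast
qed

text \<open>Turns bijectivity on classes into injectivity and surjectivity on representatives, the
  form in which weak equivalences are both proved and exploited below.\<close>

lemma bij_htpy_group_map_iff:
  assumes f: "continuous_map X Y f"
  shows "bij_betw (htpy_group_map q Y (f x) f) (htpy_group q X x) (htpy_group q Y (f x)) \<longleftrightarrow>
    (\<forall>g\<in>based_maps q X x. \<forall>g'\<in>based_maps q X x.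
       (f \<circ> g, f \<circ> g') \<in> based_homotopy q Y (f x) \<longrightarrow> (g, g') \<in> based_homotopy q X x) \<and>
    (\<forall>k\<in>based_maps q Y (f x). \<exists>g\<in>based_maps q X x. (f \<circ> g, k) \<in> based_homotopy q Y (f x))"
    (is "_ \<longleftrightarrow> ?inj \<and> ?surj")
proof -
  let ?F = "htpy_group_map q Y (f x) f"
  let ?cX = "\<lambda>g. based_homotopy q X x `` {g}" and ?cY = "\<lambda>g. based_homotopy q Y (f x) `` {g}"
  have fg: "f \<circ> g \<in> based_maps q Y (f x)" if "g \<in> based_maps q X x" for g
    using that f by (auto simp: based_maps_def intro: continuous_map_compose)
  have eX: "?cX g = ?cX g' \<longleftrightarrow> (g, g') \<in> based_homotopy q X x"
    if "g \<in> based_maps q X x" "g' \<in> based_maps q X x" for g g'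
    using that by (intro eq_equiv_class_iff[OF equiv_based_homotopy])
  have eY: "?cY g = ?cY g' \<longleftrightarrow> (g, g') \<in> based_homotopy q Y (f x)"
    if "g \<in> based_maps q Y (f x)" "g' \<in> based_maps q Y (f x)" for g g'
    using that by (intro eq_equiv_class_iff[OF equiv_based_homotopy])
  have hX: "htpy_group q X x = ?cX ` based_maps q X x" "htpy_group q Y (f x) = ?cY ` based_maps q Y (f x)"
    by (auto simp: htpy_group_def quotient_def)
  have Fc: "?F (?cX g) = ?cY (f \<circ> g)" if "g \<in> based_maps q X x" for g
    using that by (rule htpy_group_map_class[OF f])
  have "inj_on ?F (htpy_group q X x) \<longleftrightarrow> ?inj"
  proof -
    have "inj_on ?F (htpy_group q X x) \<longleftrightarrow>
        (\<forall>g\<in>based_maps q X x. \<forall>g'\<in>based_maps q X x. ?F (?cX g) = ?F (?cX g') \<longrightarrow> ?cX g = ?cX g')"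
      unfolding hX inj_on_def by (simp only: ball_simps)
    also have "\<dots> \<longleftrightarrow> ?inj"
      by (intro ball_cong refl) (simp only: Fc eX eY fg)
    finally show ?thesis .
  qed
  moreover have "?F ` htpy_group q X x = htpy_group q Y (f x) \<longleftrightarrow> ?surj"
  proof -
    have 1: "?F ` htpy_group q X x = (\<lambda>g. ?cY (f \<circ> g)) ` based_maps q X x"
      unfolding hX image_image by (intro image_cong refl Fc)
    have 2: "(\<lambda>g. ?cY (f \<circ> g)) ` based_maps q X x \<subseteq> htpy_group q Y (f x)"
      using fg by (auto simp: hX)
    have 3: "htpy_group q Y (f x) \<subseteq> (\<lambda>g. ?cY (f \<circ> g)) ` based_maps q X x \<longleftrightarrow> ?surj"
    proof -
      have "?cY k \<in> (\<lambda>g. ?cY (f \<circ> g)) ` based_maps q X x \<longleftrightarrow>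
          (\<exists>g\<in>based_maps q X x. (f \<circ> g, k) \<in> based_homotopy q Y (f x))"
        if "k \<in> based_maps q Y (f x)" for k
      proof -
        have "?cY k \<in> (\<lambda>g. ?cY (f \<circ> g)) ` based_maps q X x \<longleftrightarrow>
          (\<exists>g\<in>based_maps q X x. ?cY (f \<circ> g) = ?cY k)" by auto
        then show ?thesis using eY[OF fg that] by simp
      qed
      then show ?thesis unfolding hX by (simp add: image_subset_iff)
    qed
    show ?thesis unfolding 1 set_eq_subset using 2 3 by (simp only: simp_thms)
  qed
  ultimately show ?thesis
    by (simp add: bij_betw_def)
qed

text \<open>A self-map homotopic to the identity is bijective on homotopy classes although it moves
  the base point. For injectivity, \<open>\<Phi>\<close> run backwards carries a homotopy of the
  images back along the reversed track of \<open>x\<close>; for surjectivity, that reversed track is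
  attached to \<open>k\<close> as a collar.\<close>

lemma
  assumes \<Phi>: "continuous_map (prod_topology unit_interval X) X \<Phi>"
    and \<Phi>0: "\<And>x. x \<in> topspace X \<Longrightarrow> \<Phi> (0, x) = x" and x: "x \<in> topspace X"
  shows homotopic_id_injective: "g \<in> based_maps q X x \<Longrightarrow> g' \<in> based_maps q X x \<Longrightarrow>
      (\<lambda>z. \<Phi> (1, g z), \<lambda>z. \<Phi> (1, g' z)) \<in> based_homotopy q X (\<Phi> (1, x)) \<Longrightarrow>
      (g, g') \<in> based_homotopy q X x"
    and homotopic_id_surjective: "k \<in> based_maps q X (\<Phi> (1, x)) \<Longrightarrow>
      \<exists>g\<in>based_maps q X x. (\<lambda>z. \<Phi> (1, g z), k) \<in> based_homotopy q X (\<Phi> (1, x))"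
proof -
  let ?d = "\<lambda>u. \<Phi> (1 - u, x)"
  have I1: "continuous_map Z unit_interval (\<lambda>p. 1 - f p)" if "continuous_map Z unit_interval f" for Z f
    using that by (auto simp: continuous_map_in_subtopology Pi_iff intro!: continuous_intros)
  have d: "continuous_map unit_interval X ?d"
    by (intro continuous_map_homotopy_slices[OF \<Phi>] I1) (use x in auto)
  have cont: "continuous_map (cylinder q) X (\<lambda>p. \<Phi> (1 - fst p, g (snd p)))"
    if "continuous_map (cube q) X g" for g
    by (intro continuous_map_homotopy_slices[OF \<Phi>] I1 continuous_map_fst
        continuous_map_compose'[OF that] continuous_map_snd)
  have inX: "g z \<in> topspace X" if "continuous_map (cube q) X g" "z \<in> topspace (cube q)" for g z
    using continuous_map_funspace[OF that(1)] that(2) by auto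
  {
    assume g: "g \<in> based_maps q X x" and g': "g' \<in> based_maps q X x"
      and K: "(\<lambda>z. \<Phi> (1, g z), \<lambda>z. \<Phi> (1, g' z)) \<in> based_homotopy q X (\<Phi> (1, x))"
    then have c: "continuous_map (cube q) X g" "continuous_map (cube q) X g'"
      by (auto simp: based_maps_def)
    have h: "(\<lambda>z. \<Phi> (1 - fst (1::real, z), g (snd (1::real, z))),
        \<lambda>z. \<Phi> (1 - fst (1::real, z), g' (snd (1::real, z)))) \<in> based_homotopy q X (?d 1)"
      by (rule based_homotopy_transport[OF cont[OF c(1)] cont[OF c(2)] d])
        (use g g' K in \<open>auto simp: based_maps_def\<close>)
    have 1: "(\<lambda>z. \<Phi> (0, g z), g) \<in> based_homotopy q X x"
      by (rule based_homotopy_sym, rule based_homotopy_eq[OF g]) (use inX[OF c(1)] \<Phi>0 in auto)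
    have 2: "(\<lambda>z. \<Phi> (0, g' z), g') \<in> based_homotopy q X x"
      by (rule based_homotopy_sym, rule based_homotopy_eq[OF g']) (use inX[OF c(2)] \<Phi>0 in auto)
    have "(\<lambda>z. \<Phi> (0, g z), \<lambda>z. \<Phi> (0, g' z)) \<in> based_homotopy q X x"
      using h x \<Phi>0 by simp
    then show "(g, g') \<in> based_homotopy q X x"
      by (rule based_homotopy_trans[OF based_homotopy_trans[OF based_homotopy_sym[OF 1]] 2])
  }
  {
    assume k: "k \<in> based_maps q X (\<Phi> (1, x))"
    then have ck: "continuous_map (cube q) X k" by (simp add: based_maps_def)
    \<comment> \<open>At time \<open>u\<close> the collar follows the reversed track of
      \<open>x\<close> up to parameter \<open>u\<close>; at time 1 the boundary has arrived at
      \<open>x\<close>, which gives the preimage \<open>g\<close>.\<close>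
    let ?A = "\<lambda>p. if cube_collar q (snd p) = 0 then k (cube_expand q 1 (snd p))
      else ?d (fst p * cube_collar q (snd p))"
    have mult: "continuous_map (cylinder q) unit_interval
        (\<lambda>p. fst p * cube_collar q (snd p))"
      using cube_collar_bounds
      by (intro continuous_map_into_unit_interval continuous_map_real_mult
          continuous_map_from_unit_interval[OF continuous_map_fst]
          continuous_map_from_unit_interval[OF continuous_map_cube_collar[OF continuous_map_snd]])
        (auto intro: mult_le_one)
    have k2: "continuous_map (cylinder q) X (\<lambda>p. k (snd p))"
      by (intro continuous_map_compose'[OF ck] continuous_map_snd)
    have A: "continuous_map (cylinder q) X ?A"
      using continuous_map_attach_collar[OF k2 d _ continuous_map_fst continuous_map_snd mult] k
      by (simp add: based_maps_def cong: if_cong)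
    define g where "g = (\<lambda>z. ?A (1::real, z))"
    have cg: "continuous_map (cube q) X g"
      unfolding g_def by (rule continuous_map_homotopy_slices[OF A]) auto
    have g: "g \<in> based_maps q X x"
      using cg x \<Phi>0 by (auto simp: based_maps_def g_def cube_collar_boundary)
    \<comment> \<open>Two free homotopies that start at \<open>g\<close> and move the boundary along
      the track of \<open>x\<close>: one removes the collar again and ends at the expanded
      \<open>k\<close>, the other ends at \<open>\<Phi> (1, g z)\<close>. Transport compares their
      ends.\<close>
    let ?B = "\<lambda>p. ?A (1 - fst p, snd p)" and ?C = "\<lambda>p. \<Phi> (fst p, g (snd p))"
    have B: "continuous_map (cylinder q) X ?B"
      by (intro continuous_map_homotopy_slices[OF A] I1 continuous_map_fst continuous_map_snd)
    have C: "continuous_map (cylinder q) X ?C"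
      by (intro continuous_map_homotopy_slices[OF \<Phi>] continuous_map_fst
        continuous_map_compose'[OF cg] continuous_map_snd)
    have dx: "continuous_map unit_interval X (\<lambda>u. \<Phi> (u, x))"
      by (intro continuous_map_homotopy_slices[OF \<Phi>]) (use x in auto)
    have "(\<lambda>z. ?C (1, z), \<lambda>z. ?B (1, z)) \<in> based_homotopy q X (\<Phi> (1, x))"
    proof (rule based_homotopy_transport[OF C B dx])
      have "(\<lambda>z. ?C (0, z), g) \<in> based_homotopy q X x"
        by (rule based_homotopy_sym, rule based_homotopy_eq[OF g]) (use inX[OF cg] \<Phi>0 in auto)
      then show "(\<lambda>z. ?C (0, z), \<lambda>z. ?B (0, z)) \<in> based_homotopy q X (\<Phi> (0, x))"
        using x \<Phi>0 by (simp add: g_def cong: if_cong)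
    qed (use g in \<open>auto simp: based_maps_def cube_collar_boundary\<close>)
    moreover have "(\<lambda>z. k (cube_expand q 1 z), k) \<in> based_homotopy q X (\<Phi> (1, x))"
      by (rule based_homotopy_expand[OF k])
    moreover have "(\<lambda>z. ?B (1, z), \<lambda>z. k (cube_expand q 1 z)) \<in> based_homotopy q X (\<Phi> (1, x))"
    proof (rule based_homotopy_sym, rule based_homotopy_eq)
      show "(\<lambda>z. k (cube_expand q 1 z)) \<in> based_maps q X (\<Phi> (1, x))"
        using based_homotopy_maps[OF based_homotopy_expand[OF k]] by blast
      show "k (cube_expand q 1 z) = ?B (1, z)" if "z \<in> topspace (cube q)" for z
        using cube_collar_expand[OF that] k by (auto simp: based_maps_def)
    qed
    ultimately show "\<exists>g\<in>based_maps q X x. (\<lambda>z. \<Phi> (1, g z), k) \<in> based_homotopy q X (\<Phi> (1, x))"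
      using g by (intro bexI[of _ g]) (auto intro: based_homotopy_trans)
  }
qed

text \<open>Injectivity of \<open>f\<close> follows by applying \<open>r\<close>. For surjectivity
  \<open>g\<close> is chosen so that \<open>\<Phi> (1, g z)\<close> represents
  \<open>r (k z)\<close>; applying \<open>f\<close> gives a homotopy between the images of
  \<open>f \<circ> g\<close> and \<open>k\<close> under \<open>f \<circ> r\<close>, and
  \<open>f \<circ> r\<close> is injective on classes because \<open>\<Psi>\<close> joins it to the
  identity.\<close>

lemma homotopy_equivalence_imp_weak:
  assumes f: "continuous_map X Y f" and r: "continuous_map Y X r"
    and \<Phi>: "continuous_map (prod_topology unit_interval X) X \<Phi>"
      "\<And>x. x \<in> topspace X \<Longrightarrow> \<Phi> (0, x) = x \<and> \<Phi> (1, x) = r (f x)"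
    and \<Psi>: "continuous_map (prod_topology unit_interval Y) Y \<Psi>"
      "\<And>y. y \<in> topspace Y \<Longrightarrow> \<Psi> (0, y) = y \<and> \<Psi> (1, y) = f (r y)"
  shows "weak_homotopy_equivalence X Y f"
  unfolding weak_homotopy_equivalence_def bij_htpy_group_map_iff[OF f]
proof (intro conjI allI ballI impI)
  show "topspace Y = {}" if "topspace X = {}"
    using continuous_map_funspace[OF r] that by (auto simp only: Pi_iff empty_iff)
next
  fix q x g g'
  assume x: "x \<in> topspace X" and g: "g \<in> based_maps q X x" and g': "g' \<in> based_maps q X x"
    and h: "(f \<circ> g, f \<circ> g') \<in> based_homotopy q Y (f x)"
  have e: "(\<lambda>z. \<Phi> (1, k z), \<lambda>z. r (f (k z))) \<in> based_homotopy q X (\<Phi> (1, x))"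
    if "k \<in> based_maps q X x" for k
  proof (rule based_homotopy_eq)
    have c: "continuous_map (cube q) X k" using that by (auto simp: based_maps_def)
    show "(\<lambda>z. \<Phi> (1, k z)) \<in> based_maps q X (\<Phi> (1, x))"
      using continuous_map_homotopy_slices[OF \<Phi>(1), of "cube q" "\<lambda>_. 1" k] c that
      by (auto simp: based_maps_def)
    show "\<Phi> (1, k z) = r (f (k z))" if "z \<in> topspace (cube q)" for z
      using continuous_map_funspace[OF c] that \<Phi>(2) by auto
  qed
  have "(\<lambda>z. r (f (g z)), \<lambda>z. r (f (g' z))) \<in> based_homotopy q X (\<Phi> (1, x))"
    using based_homotopy_compose[OF h r] x \<Phi>(2) by simp
  then have "(\<lambda>z. \<Phi> (1, g z), \<lambda>z. \<Phi> (1, g' z)) \<in> based_homotopy q X (\<Phi> (1, x))"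
    using e[OF g] e[OF g'] by (meson based_homotopy_trans based_homotopy_sym)
  then show "(g, g') \<in> based_homotopy q X x"
    by (rule homotopic_id_injective[OF \<Phi>(1) _ x g g', rotated]) (use \<Phi>(2) in auto)
next
  fix q x k
  assume x: "x \<in> topspace X" and k: "k \<in> based_maps q Y (f x)"
  then have fx: "f x \<in> topspace Y" using continuous_map_funspace[OF f] by auto
  have rfx: "\<Phi> (1, x) = r (f x)" using x \<Phi>(2) by auto
  have ck: "continuous_map (cube q) Y k" using k by (auto simp: based_maps_def)
  have "(\<lambda>z. r (k z)) \<in> based_maps q X (\<Phi> (1, x))"
    using k r rfx by (auto simp: based_maps_def intro: continuous_map_compose')
  then obtain g where g: "g \<in> based_maps q X x"
    and gh: "(\<lambda>z. \<Phi> (1, g z), \<lambda>z. r (k z)) \<in> based_homotopy q X (\<Phi> (1, x))"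
    using homotopic_id_surjective[OF \<Phi>(1) _ x] \<Phi>(2) by blast
  have cg: "continuous_map (cube q) X g" using g by (auto simp: based_maps_def)
  have fg: "f \<circ> g \<in> based_maps q Y (f x)"
    using g f by (auto simp: based_maps_def intro: continuous_map_compose)
  have "(\<lambda>z. f (\<Phi> (1, g z)), \<lambda>z. f (r (k z))) \<in> based_homotopy q Y (f (r (f x)))"
    using based_homotopy_compose[OF gh f] rfx by simp
  moreover have "(\<lambda>z. f (\<Phi> (1, g z)), \<lambda>z. \<Psi> (1, f (g z))) \<in> based_homotopy q Y (f (r (f x)))"
  proof (rule based_homotopy_eq)
    show "(\<lambda>z. f (\<Phi> (1, g z))) \<in> based_maps q Y (f (r (f x)))"
      using based_homotopy_maps(1)[OF based_homotopy_compose[OF gh f]] rfx by simp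
    show "f (\<Phi> (1, g z)) = \<Psi> (1, f (g z))" if "z \<in> topspace (cube q)" for z
    proof -
      have "g z \<in> topspace X" using continuous_map_funspace[OF cg] that by auto
      moreover from this have "f (g z) \<in> topspace Y" using continuous_map_funspace[OF f] by auto
      ultimately show ?thesis using \<Phi>(2) \<Psi>(2) by auto
    qed
  qed
  moreover have "(\<lambda>z. f (r (k z)), \<lambda>z. \<Psi> (1, k z)) \<in> based_homotopy q Y (f (r (f x)))"
  proof (rule based_homotopy_eq)
    show "(\<lambda>z. f (r (k z))) \<in> based_maps q Y (f (r (f x)))"
      using based_homotopy_maps(2)[OF based_homotopy_compose[OF gh f]] rfx by simp
    show "f (r (k z)) = \<Psi> (1, k z)" if "z \<in> topspace (cube q)" for z
      using \<Psi>(2)[OF funcset_mem[OF continuous_map_funspace[OF ck] that]] by simp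
  qed
  ultimately have "(\<lambda>z. \<Psi> (1, (f \<circ> g) z), \<lambda>z. \<Psi> (1, k z)) \<in> based_homotopy q Y (f (r (f x)))"
    by (simp add: o_def) (meson based_homotopy_trans based_homotopy_sym)
  then have "(\<lambda>z. \<Psi> (1, (f \<circ> g) z), \<lambda>z. \<Psi> (1, k z)) \<in> based_homotopy q Y (\<Psi> (1, f x))"
    using \<Psi>(2)[OF fx] by simp
  then have "(f \<circ> g, k) \<in> based_homotopy q Y (f x)"
    by (rule homotopic_id_injective[OF \<Psi>(1) _ fx fg k, rotated]) (use \<Psi>(2) in auto)
  then show "\<exists>g\<in>based_maps q X x. (f \<circ> g, k) \<in> based_homotopy q Y (f x)"
    using g by blast
qed (rule f)

section \<open>Hurewicz fibrations are quasifibrations\<close>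

lemma hurewicz_fibration_imp_quasifibration:
  assumes hf: "hurewicz_fibration E B p"
  shows "quasifibration E B p"
proof -
  have p: "continuous_map E B p" using hf by (simp add: hurewicz_fibration_def)
  \<comment> \<open>The test space of the universal lifting problem. The lift \<open>k\<close> of
    evaluation moves \<open>e\<close> along a lift of \<open>\<gamma>\<close>, and its value at time
    1 is the homotopy inverse.\<close>
  define Z where "Z = subtopology (prod_topology E (path_space B)) {(e, \<gamma>). \<gamma> 0 = p e}"
  have Zfst: "continuous_map Z E fst" and Zsnd: "continuous_map Z (path_space B) snd"
    unfolding Z_def by (rule continuous_map_subtopology_fst continuous_map_subtopology_snd)+
  have "continuous_map (prod_topology Z unit_interval) B (\<lambda>w. snd (fst w) (snd w))"
    by (rule continuous_map_path_eval'[OF continuous_map_compose'[OF Zsnd continuous_map_fst]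
          continuous_map_snd])
  then obtain k where k: "continuous_map (prod_topology Z unit_interval) E k"
    and k0: "\<And>z. z \<in> topspace Z \<Longrightarrow> k (z, 0) = fst z"
    and kp: "\<And>z t. z \<in> topspace Z \<Longrightarrow> t \<in> {0..1} \<Longrightarrow> p (k (z, t)) = snd z t"
    using hf Zfst unfolding hurewicz_fibration_def
    apply (elim conjE)
    apply (drule spec[of _ Z], drule spec[of _ fst], drule spec[of _ "\<lambda>w. snd (fst w) (snd w)"])
    by (auto simp: Z_def)
  have kcont: "continuous_map W E (\<lambda>w. k (a w, t w))"
    if "continuous_map W Z a" "continuous_map W unit_interval t" for W a t
    by (rule continuous_map_compose'[OF k]) (intro continuous_map_pairedI that)
  show ?thesis
    unfolding quasifibration_def
  proof (intro conjI p ballI)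
    fix b assume b: "b \<in> topspace B"
    let ?F = "subtopology E {e. p e = b}" and ?H = "homotopy_fibre E B p b"
    let ?c = "\<lambda>t\<in>{0..1::real}. b"
    let ?f = "\<lambda>e. (e, ?c)"
    have Ff: "continuous_map ?F E (\<lambda>e. e)" by (simp add: continuous_map_from_subtopology)
    have Fp: "p e = b" if "e \<in> topspace ?F" for e using that by auto
    have f: "continuous_map ?F ?H ?f"
    proof (rule continuous_map_into_homotopy_fibre[OF Ff])
      show "continuous_map (prod_topology ?F unit_interval) B (\<lambda>_. b)"
        using b by simp
      show "b = p x \<and> b = b" if "x \<in> topspace ?F" for x
        using Fp[OF that] by blast
    qed
    have HZ: "continuous_map ?H Z (\<lambda>y. y)"
      unfolding Z_def homotopy_fibre_def
      by (intro continuous_map_into_subtopology continuous_map_from_subtopology) auto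
    have FZ: "continuous_map ?F Z ?f"
      using continuous_map_compose'[OF HZ f] .
    have Hmem: "y \<in> topspace Z \<and> snd y 1 = b \<and> snd y \<in> extensional {0..1} \<and> snd y 0 = p (fst y)"
      if "y \<in> topspace ?H" for y
      using that continuous_map_funspace[OF HZ] by (auto simp: topspace_homotopy_fibre)
    have one: "continuous_map W unit_interval (\<lambda>_. 1)" for W :: "'c topology"
      by (simp)
    define r where "r = (\<lambda>y. k (y, 1::real))"
    have r: "continuous_map ?H ?F r"
      unfolding r_def
      using continuous_map_into_subtopology[OF kcont[OF HZ one]] Hmem kp by auto
    \<comment> \<open>The lift of a constant path stays in the fibre and joins a point to its image
      under the composite.\<close>
    define \<Phi> where "\<Phi> = (\<lambda>w. k (?f (snd w), fst w))"
    have cF: "continuous_map (prod_topology unit_interval ?F) ?F \<Phi>"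
      unfolding \<Phi>_def
    proof (rule continuous_map_into_subtopology[OF kcont[OF continuous_map_compose'[OF FZ
          continuous_map_snd] continuous_map_fst]], intro funcsetI CollectI)
      fix w assume "w \<in> topspace (prod_topology unit_interval ?F)"
      then have "?f (snd w) \<in> topspace Z" "fst w \<in> {0..1}"
        using continuous_map_funspace[OF FZ] by auto
      then show "p (k (?f (snd w), fst w)) = b" using kp by auto
    qed
    have F01: "\<Phi> (0, x) = x \<and> \<Phi> (1, x) = r (?f x)" if "x \<in> topspace ?F" for x
      using k0[OF funcset_mem[OF continuous_map_funspace[OF FZ] that]] by (simp add: \<Phi>_def r_def)
    \<comment> \<open>While the point moves along the lift up to time \<open>s\<close>, the path
      becomes \<open>\<gamma> (max s t)\<close>: it starts below the moved point, still ends at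
      \<open>b\<close>, and is constant for \<open>s = 1\<close>.\<close>
    define \<Psi> where "\<Psi> = (\<lambda>w. (k (snd w, fst w), \<lambda>t\<in>{0..1::real}. snd (snd w) (max (fst w) t)))"
    have cH: "continuous_map (prod_topology unit_interval ?H) ?H \<Psi>"
      unfolding \<Psi>_def
    proof (rule continuous_map_into_homotopy_fibre)
      show "continuous_map (prod_topology unit_interval ?H) E (\<lambda>w. k (snd w, fst w))"
        by (rule kcont[OF continuous_map_compose'[OF HZ continuous_map_snd] continuous_map_fst])
      have mx: "continuous_map (prod_topology (prod_topology unit_interval ?H) unit_interval)
          unit_interval (\<lambda>z. max (fst (fst z)) (snd z))"
        by (intro continuous_map_into_unit_interval continuous_map_real_max
            continuous_map_from_unit_interval[OF continuous_map_snd]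
            continuous_map_from_unit_interval[OF continuous_map_fst'[OF continuous_map_fst]]) auto
      show "continuous_map (prod_topology (prod_topology unit_interval ?H) unit_interval) B
        (\<lambda>z. snd (snd (fst z)) (max (fst (fst z)) (snd z)))"
        by (rule continuous_map_path_eval'[OF continuous_map_compose'[OF continuous_map_homotopy_fibre_snd
              continuous_map_snd'[OF continuous_map_fst]] mx])
      fix w assume "w \<in> topspace (prod_topology unit_interval ?H)"
      then show "snd (snd w) (max (fst w) 0) = p (k (snd w, fst w)) \<and> snd (snd w) (max (fst w) 1) = b"
        using Hmem[of "snd w"] kp[of "snd w" "fst w"] by (auto simp: max_absorb1 max_absorb2)
    qed
    have H01: "\<Psi> (0, y) = y \<and> \<Psi> (1, y) = ?f (r y)" if "y \<in> topspace ?H" for y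
    proof
      have "(\<lambda>t\<in>{0..1::real}. snd y (max 0 t)) = snd y"
        using Hmem[OF that] by (intro ext) (auto simp: extensional_def max_absorb2)
      then show "\<Psi> (0, y) = y"
        using Hmem[OF that] k0[of y] by (simp add: \<Psi>_def)
      have "(\<lambda>t\<in>{0..1::real}. snd y (max 1 t)) = ?c"
        using Hmem[OF that] by (intro ext) (auto simp: max_absorb1)
      then show "\<Psi> (1, y) = ?f (r y)"
        by (simp add: \<Psi>_def r_def)
    qed
    show "weak_homotopy_equivalence ?F ?H ?f"
      by (rule homotopy_equivalence_imp_weak[OF f r cF F01 cH H01])
  qed
qed

lemma quasifibration_surjective:
  assumes "quasifibration E B p" "e \<in> topspace E" "p e \<in> topspace B"
    and "k \<in> based_maps q (homotopy_fibre E B p (p e)) (e, \<lambda>t\<in>{0..1}. p e)"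
  obtains g where "g \<in> based_maps q (subtopology E {e'. p e' = p e}) e"
    and "(\<lambda>z. (g z, \<lambda>t\<in>{0..1}. p e), k)
        \<in> based_homotopy q (homotopy_fibre E B p (p e)) (e, \<lambda>t\<in>{0..1}. p e)"
proof -
  let ?f = "\<lambda>e'. (e', \<lambda>t\<in>{0..1::real}. p e)"
  have w: "weak_homotopy_equivalence (subtopology E {e'. p e' = p e}) (homotopy_fibre E B p (p e)) ?f"
    using assms unfolding quasifibration_def by blast
  then have "continuous_map (subtopology E {e'. p e' = p e}) (homotopy_fibre E B p (p e)) ?f"
    by (simp add: weak_homotopy_equivalence_def)
  note f = this
  have "e \<in> topspace (subtopology E {e'. p e' = p e})" using assms(2) by simp
  then have "bij_betw (htpy_group_map q (homotopy_fibre E B p (p e)) (?f e) ?f)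
      (htpy_group q (subtopology E {e'. p e' = p e}) e) (htpy_group q (homotopy_fibre E B p (p e)) (?f e))"
    using w unfolding weak_homotopy_equivalence_def by blast
  then have "\<forall>k\<in>based_maps q (homotopy_fibre E B p (p e)) (?f e).
      \<exists>g\<in>based_maps q (subtopology E {e'. p e' = p e}) e.
        (?f \<circ> g, k) \<in> based_homotopy q (homotopy_fibre E B p (p e)) (?f e)"
    unfolding bij_htpy_group_map_iff[OF f] by (rule conjunct2)
  then show thesis using assms(4) that unfolding o_def by blast
qed

lemma quasifibration_injective:
  assumes "quasifibration E B p" "e \<in> topspace E" "p e \<in> topspace B"
    and "g \<in> based_maps q (subtopology E {e'. p e' = p e}) e"
    and "g' \<in> based_maps q (subtopology E {e'. p e' = p e}) e"
    and "(\<lambda>z. (g z, \<lambda>t\<in>{0..1}. p e), \<lambda>z. (g' z, \<lambda>t\<in>{0..1}. p e))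
        \<in> based_homotopy q (homotopy_fibre E B p (p e)) (e, \<lambda>t\<in>{0..1}. p e)"
  shows "(g, g') \<in> based_homotopy q (subtopology E {e'. p e' = p e}) e"
proof -
  let ?f = "\<lambda>e'. (e', \<lambda>t\<in>{0..1::real}. p e)"
  have w: "weak_homotopy_equivalence (subtopology E {e'. p e' = p e}) (homotopy_fibre E B p (p e)) ?f"
    using assms unfolding quasifibration_def by blast
  then have "continuous_map (subtopology E {e'. p e' = p e}) (homotopy_fibre E B p (p e)) ?f"
    by (simp add: weak_homotopy_equivalence_def)
  note f = this
  have "e \<in> topspace (subtopology E {e'. p e' = p e})" using assms(2) by simp
  then have "bij_betw (htpy_group_map q (homotopy_fibre E B p (p e)) (?f e) ?f)
      (htpy_group q (subtopology E {e'. p e' = p e}) e) (htpy_group q (homotopy_fibre E B p (p e)) (?f e))"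
    using w unfolding weak_homotopy_equivalence_def by blast
  then have "\<forall>g\<in>based_maps q (subtopology E {e'. p e' = p e}) e.
      \<forall>g'\<in>based_maps q (subtopology E {e'. p e' = p e}) e.
        (?f \<circ> g, ?f \<circ> g') \<in> based_homotopy q (homotopy_fibre E B p (p e)) (?f e) \<longrightarrow>
        (g, g') \<in> based_homotopy q (subtopology E {e'. p e' = p e}) e"
    unfolding bij_htpy_group_map_iff[OF f] by (rule conjunct1)
  then show ?thesis using assms(4-6) unfolding o_def by blast
qed

section \<open>The sphere as a quotient of the cube\<close>

lemma nsphere_iff: "x \<in> topspace (nsphere q) \<longleftrightarrow> (\<Sum>i\<le>q. (x i)\<^sup>2) = 1 \<and> (\<forall>i>q. x i = 0)"
  by (auto simp: nsphere)

lemma continuous_map_into_nsphere: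
  assumes "\<And>i. i \<le> q \<Longrightarrow> continuous_map X euclideanreal (\<lambda>x. f x i)"
    and "\<And>x. x \<in> topspace X \<Longrightarrow> f x \<in> topspace (nsphere q)"
  shows "continuous_map X (nsphere q) f"
  unfolding nsphere
proof (intro continuous_map_into_subtopology)
  show "continuous_map X (powertop_real UNIV) f"
    unfolding continuous_map_componentwise_UNIV
  proof
    fix i show "continuous_map X euclideanreal (\<lambda>x. f x i)"
    proof (cases "i \<le> q")
      case False
      then have "0 = f x i" if "x \<in> topspace X" for x
        using assms(2)[OF that] by (simp add: nsphere_iff)
      then show ?thesis
        by (rule continuous_map_eq[where f = "\<lambda>_. 0", rotated]) (assumption, rule continuous_map_const[THEN iffD2], simp)
    qed (use assms(1) in auto)
  qed
qed (use assms(2) in \<open>auto simp: nsphere_iff\<close>)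

text \<open>Inverse stereographic projection of \<open>(2 z - 1) / g\<close>, where \<open>g\<close> vanishes exactly on the boundary
  of the cube; clearing denominators makes the extension to the boundary continuous.\<close>

definition cube_bump :: "nat \<Rightarrow> (nat \<Rightarrow> real) \<Rightarrow> real" where
  "cube_bump q z = (\<Prod>i<q. z i * (1 - z i))"

definition cube_radius2 :: "nat \<Rightarrow> (nat \<Rightarrow> real) \<Rightarrow> real" where
  "cube_radius2 q z = (\<Sum>i<q. (2 * z i - 1)\<^sup>2)"

definition cube_sphere :: "nat \<Rightarrow> (nat \<Rightarrow> real) \<Rightarrow> nat \<Rightarrow> real" where
  "cube_sphere q z i =
     (if i < q then 2 * cube_bump q z * (2 * z i - 1) / (cube_radius2 q z + (cube_bump q z)\<^sup>2)
      else if i = q then (cube_radius2 q z - (cube_bump q z)\<^sup>2) / (cube_radius2 q z + (cube_bump q z)\<^sup>2)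
      else 0)"

definition north_pole :: "nat \<Rightarrow> nat \<Rightarrow> real" where
  "north_pole q i = (if i = q then 1 else 0)"

lemma cube_bump_nonneg: "z \<in> topspace (cube q) \<Longrightarrow> cube_bump q z \<ge> 0"
  unfolding cube_bump_def using cube_coord by (intro prod_nonneg) fastforce

lemma cube_radius2_nonneg: "cube_radius2 q z \<ge> 0"
  unfolding cube_radius2_def by (intro sum_nonneg) auto

lemma cube_bump_zero_iff:
  assumes "z \<in> topspace (cube q)"
  shows "cube_bump q z = 0 \<longleftrightarrow> z \<in> cube_boundary q"
  using assms by (auto simp: cube_bump_def cube_boundary_def)

lemma cube_radius2_boundary:
  assumes "z \<in> cube_boundary q" shows "cube_radius2 q z \<ge> 1"
proof -
  obtain i where i: "i < q" "z i = 0 \<or> z i = 1" using assms by (auto simp: cube_boundary_def)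
  have "(2 * z i - 1)\<^sup>2 \<le> cube_radius2 q z"
    unfolding cube_radius2_def using i(1) by (intro member_le_sum) auto
  moreover have "(2 * z i - 1)\<^sup>2 = 1" using i(2) by auto
  ultimately show ?thesis by simp
qed

lemma cube_sphere_denominator:
  assumes "z \<in> topspace (cube q)" shows "cube_radius2 q z + (cube_bump q z)\<^sup>2 > 0"
proof (cases "z \<in> cube_boundary q")
  case True
  from cube_radius2_boundary[OF this] have "cube_radius2 q z > 0" by simp
  then show ?thesis by (simp add: add_pos_nonneg)
next
  case False
  then have "(cube_bump q z)\<^sup>2 > 0" using cube_bump_zero_iff[OF assms] by simp
  then show ?thesis by (intro add_nonneg_pos cube_radius2_nonneg)
qed

lemma cube_sphere_in_nsphere:
  assumes "z \<in> topspace (cube q)" shows "cube_sphere q z \<in> topspace (nsphere q)"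
proof -
  let ?g = "cube_bump q z" and ?s = "cube_radius2 q z"
  have D: "?s + ?g\<^sup>2 > 0" by (rule cube_sphere_denominator[OF assms])
  have "(\<Sum>i\<le>q. (cube_sphere q z i)\<^sup>2) = (\<Sum>i<q. (cube_sphere q z i)\<^sup>2) + (cube_sphere q z q)\<^sup>2"
    by (simp add: lessThan_Suc_atMost[symmetric])
  also have "(\<Sum>i<q. (cube_sphere q z i)\<^sup>2) = (\<Sum>i<q. (2 * ?g / (?s + ?g\<^sup>2))\<^sup>2 * (2 * z i - 1)\<^sup>2)"
    by (intro sum.cong refl) (simp add: cube_sphere_def power_mult_distrib power_divide)
  also have "\<dots> = (2 * ?g / (?s + ?g\<^sup>2))\<^sup>2 * ?s"
    by (simp add: sum_distrib_left cube_radius2_def)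
  also have "\<dots> + (cube_sphere q z q)\<^sup>2 = (4 * ?g\<^sup>2 * ?s + (?s - ?g\<^sup>2)\<^sup>2) / (?s + ?g\<^sup>2)\<^sup>2"
    by (simp add: cube_sphere_def power_divide power_mult_distrib add_divide_distrib)
  also have "4 * ?g\<^sup>2 * ?s + (?s - ?g\<^sup>2)\<^sup>2 = (?s + ?g\<^sup>2)\<^sup>2"
    by (simp add: power2_eq_square algebra_simps)
  finally have "(\<Sum>i\<le>q. (cube_sphere q z i)\<^sup>2) = 1" using D by simp
  then show ?thesis by (simp add: nsphere_iff cube_sphere_def)
qed

lemma continuous_map_cube_sphere: "continuous_map (cube q) (nsphere q) (cube_sphere q)"
proof (rule continuous_map_into_nsphere)
  fix i assume "i \<le> q"
  have c: "continuous_map (cube q) euclideanreal (\<lambda>z. z j)" if "j < q" for j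
    by (rule continuous_map_cube_coord) (use that in auto)
  have g: "continuous_map (cube q) euclideanreal (cube_bump q)"
    unfolding cube_bump_def by (intro continuous_intros c) auto
  have s: "continuous_map (cube q) euclideanreal (cube_radius2 q)"
    unfolding cube_radius2_def by (intro continuous_intros c) auto
  have D: "cube_radius2 q z + (cube_bump q z)\<^sup>2 \<noteq> 0" if "z \<in> topspace (cube q)" for z
    using cube_sphere_denominator[OF that] by simp
  consider "i < q" | "i = q" using \<open>i \<le> q\<close> by linarith
  then show "continuous_map (cube q) euclideanreal (\<lambda>z. cube_sphere q z i)"
    by cases (use D in \<open>auto simp: cube_sphere_def intro!: continuous_intros g s c\<close>)
qed (rule cube_sphere_in_nsphere)

lemma cube_sphere_boundary:
  assumes "z \<in> cube_boundary q" shows "cube_sphere q z = north_pole q"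
  using cube_bump_zero_iff[OF cube_boundary_subset[OF assms]] assms cube_radius2_boundary[OF assms]
  by (intro ext) (auto simp: cube_sphere_def north_pole_def)

lemma cube_sphere_surj:
  assumes "q > 0"
  shows "cube_sphere q ` topspace (cube q) = topspace (nsphere q)"
proof
  show "cube_sphere q ` topspace (cube q) \<subseteq> topspace (nsphere q)"
    using cube_sphere_in_nsphere by auto
  show "topspace (nsphere q) \<subseteq> cube_sphere q ` topspace (cube q)"
  proof
    fix y assume y: "y \<in> topspace (nsphere q)"
    then have sq: "(\<Sum>i<q. (y i)\<^sup>2) + (y q)\<^sup>2 = 1" and out: "\<And>i. i > q \<Longrightarrow> y i = 0"
      by (auto simp: nsphere_iff lessThan_Suc_atMost[symmetric])
    show "y \<in> cube_sphere q ` topspace (cube q)"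
    proof (cases "y q = 1")
      case True
      then have "(\<Sum>i<q. (y i)\<^sup>2) = 0" using sq by simp
      then have "\<forall>i<q. y i = 0" by (subst (asm) sum_nonneg_eq_0_iff) auto
      then have "y = north_pole q"
        using True out by (intro ext) (auto simp: north_pole_def linorder_neq_iff)
      \<comment> \<open>Here \<open>q > 0\<close> enters: the pole is reached only from the
        boundary, and the 0-cube has none.\<close>
      moreover have "(\<lambda>i\<in>{..<q}. 0) \<in> cube_boundary q"
        using assms by (auto simp: cube_boundary_def topspace_cube)
      ultimately show ?thesis
        using cube_sphere_boundary cube_boundary_subset by (metis image_eqI)
    next
      case False
      have "(y q)\<^sup>2 \<le> 1" using sq sum_nonneg[of "{..<q}" "\<lambda>i. (y i)\<^sup>2"] by simp
      then have "y q < 1" using False by (simp add: abs_square_le_1)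
      \<comment> \<open>\<open>t\<close> is the stereographic projection of \<open>y\<close>. The
        preimage is sought on the ray \<open>2 * z i - 1 = l * t i\<close>, where the bump equals
        \<open>G l\<close>; the projection is right when \<open>G l = l\<close>, which the
        intermediate value theorem solves. Truncation at 0 keeps \<open>G\<close> between 0 and 1
        even where the ray has left the cube.\<close>
      define t where "t i = y i / (1 - y q)" for i
      define G where "G l = (\<Prod>i<q. max 0 (1 - (l * t i)\<^sup>2) / 4)" for l :: real
      have "continuous_on {0..1} (\<lambda>l. l - G l)"
        unfolding G_def by (intro continuous_intros) auto
      moreover have "0 - G 0 \<le> 0" by (simp add: G_def)
      moreover have "G 1 \<le> 1" unfolding G_def by (intro prod_le_1) (auto, smt (verit) zero_le_power2)
      ultimately obtain l where l: "0 \<le> l" "l \<le> 1" "l - G l = 0"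
        using IVT'[of "\<lambda>l. l - G l" 0 0 1] by auto
      have "l \<noteq> 0"
      proof
        assume "l = 0"
        then have "G 0 = 0" using l by simp
        then show False by (simp add: G_def)
      qed
      then have Gl: "G l = l" "l > 0" using l by auto
      have small: "(l * t i)\<^sup>2 < 1" if "i < q" for i
      proof (rule ccontr)
        assume "\<not> ?thesis"
        then have "G l = 0" unfolding G_def using that by (intro prod_zero bexI[of _ i]) auto
        then show False using Gl by simp
      qed
      define z where "z = (\<lambda>i\<in>{..<q}. (1 + l * t i) / 2)"
      have zi: "2 * z i - 1 = l * t i" if "i < q" for i
        using that by (simp add: z_def add_divide_distrib)
      have z: "z \<in> topspace (cube q)"
        using small by (auto simp: z_def topspace_cube abs_square_less_1 abs_less_iff)
          (smt (verit) abs_square_less_1)+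
      have bump: "cube_bump q z = l"
      proof -
        have "cube_bump q z = G l"
          unfolding cube_bump_def G_def
          by (intro prod.cong refl) (use small in \<open>auto simp: z_def power2_eq_square field_simps max_def
              less_imp_le\<close>)
        then show ?thesis using Gl by simp
      qed
      have tt: "(\<Sum>i<q. (t i)\<^sup>2) = (1 + y q) / (1 - y q)"
      proof -
        have "(\<Sum>i<q. (t i)\<^sup>2) = (\<Sum>i<q. (y i)\<^sup>2) / (1 - y q)\<^sup>2"
          by (simp add: t_def power_divide sum_divide_distrib)
        also have "(\<Sum>i<q. (y i)\<^sup>2) = (1 + y q) * (1 - y q)"
          using sq by (simp add: power2_eq_square algebra_simps)
        finally show ?thesis using \<open>y q < 1\<close> by (simp add: power2_eq_square)
      qed
      have rad: "cube_radius2 q z = l\<^sup>2 * ((1 + y q) / (1 - y q))"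
        unfolding cube_radius2_def tt[symmetric] sum_distrib_left
        by (intro sum.cong refl) (auto simp: z_def power_mult_distrib add_divide_distrib)
      have den: "cube_radius2 q z + (cube_bump q z)\<^sup>2 = 2 * l\<^sup>2 / (1 - y q)"
        unfolding rad bump using \<open>y q < 1\<close> by (simp add: field_simps)
      have "cube_sphere q z i = y i" for i
      proof -
        consider "i < q" | "i = q" | "i > q" by linarith
        then show ?thesis
        proof cases
          case 1
          then have "cube_sphere q z i
              = 2 * cube_bump q z * (2 * z i - 1) / (cube_radius2 q z + (cube_bump q z)\<^sup>2)"
            by (simp add: cube_sphere_def)
          also have "\<dots> = 2 * l * (l * t i) / (2 * l\<^sup>2 / (1 - y q))"
            unfolding den unfolding bump zi[OF 1] ..
          also have "\<dots> = y i"
            using Gl \<open>y q < 1\<close> by (simp add: t_def power2_eq_square)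
          finally show ?thesis .
        next
          case 2
          then have "cube_sphere q z i
              = (cube_radius2 q z - (cube_bump q z)\<^sup>2) / (cube_radius2 q z + (cube_bump q z)\<^sup>2)"
            by (simp add: cube_sphere_def)
          also have "\<dots> = (l\<^sup>2 * ((1 + y q) / (1 - y q)) - l\<^sup>2) / (2 * l\<^sup>2 / (1 - y q))"
            unfolding den unfolding bump rad ..
          also have "\<dots> = y i"
            using Gl \<open>y q < 1\<close> 2 by (simp add: divide_simps) (simp add: algebra_simps)
          finally show ?thesis .
        qed (simp add: cube_sphere_def out)
      qed
      then have "y = cube_sphere q z" by auto
      then show ?thesis using z by blast
    qed
  qed
qed

text \<open>Equal quotients place both points on one ray from the centre of the cube, the one with
  the larger bump at least as far out. Each factor of the bump decreases outwards, so the bumps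
  agree and then the points do.\<close>

lemma cube_sphere_inj_aux:
  assumes z: "z \<in> topspace (cube q)" and z': "z' \<in> topspace (cube q)"
    and eq: "\<And>i. i < q \<Longrightarrow> (2 * z i - 1) / cube_bump q z = (2 * z' i - 1) / cube_bump q z'"
    and pos: "0 < cube_bump q z" and le: "cube_bump q z \<le> cube_bump q z'"
  shows "z = z'"
proof -
  have "z' i * (1 - z' i) \<le> z i * (1 - z i)" if "i < q" for i
  proof -
    have "2 * z' i - 1 = cube_bump q z' / cube_bump q z * (2 * z i - 1)"
      using eq[OF that] pos le by (simp add: field_simps)
    then have "\<bar>2 * z' i - 1\<bar> = cube_bump q z' / cube_bump q z * \<bar>2 * z i - 1\<bar>"
      using pos le by (simp add: abs_mult)
    also have "\<dots> \<ge> 1 * \<bar>2 * z i - 1\<bar>"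
      using pos le by (intro mult_right_mono) auto
    finally have "(2 * z i - 1)\<^sup>2 \<le> (2 * z' i - 1)\<^sup>2" by (simp add: abs_le_square_iff)
    then show ?thesis by (simp add: power2_eq_square algebra_simps)
  qed
  then have "cube_bump q z' \<le> cube_bump q z"
    unfolding cube_bump_def using cube_coord[OF z'] by (intro prod_mono) auto
  then have "cube_bump q z = cube_bump q z'" using le by simp
  then have "z i = z' i" if "i < q" for i using eq[OF that] pos by simp
  then show ?thesis using z z' unfolding topspace_cube by (auto intro: PiE_ext)
qed

text \<open>The last coordinate equals 1 exactly on the boundary; elsewhere stereographic projection
  recovers the quotients to which \<open>cube_sphere_inj_aux\<close> applies.\<close>

lemma cube_sphere_inj:
  assumes z: "z \<in> topspace (cube q)" and z': "z' \<in> topspace (cube q)"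
    and eq: "cube_sphere q z = cube_sphere q z'"
  shows "z = z' \<or> z \<in> cube_boundary q \<and> z' \<in> cube_boundary q"
proof -
  have q: "1 - cube_sphere q x q = 2 * (cube_bump q x)\<^sup>2 / (cube_radius2 q x + (cube_bump q x)\<^sup>2)"
    if "x \<in> topspace (cube q)" for x
    using cube_sphere_denominator[OF that] by (simp add: cube_sphere_def field_simps)
  have b: "x \<in> cube_boundary q \<longleftrightarrow> cube_sphere q x q = 1" if "x \<in> topspace (cube q)" for x
    using q[OF that] cube_bump_zero_iff[OF that] cube_sphere_denominator[OF that] by auto
  show ?thesis
  proof (cases "z \<in> cube_boundary q")
    case True
    then show ?thesis using b[OF z] b[OF z'] eq by simp
  next
    case False
    then have "z' \<notin> cube_boundary q" using b[OF z] b[OF z'] eq by simp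
    then have pos: "cube_bump q z > 0" "cube_bump q z' > 0"
      using False cube_bump_zero_iff[OF z] cube_bump_zero_iff[OF z'] cube_bump_nonneg[OF z]
        cube_bump_nonneg[OF z'] by auto
    have st: "(2 * x i - 1) / cube_bump q x = cube_sphere q x i / (1 - cube_sphere q x q)"
      if "x \<in> topspace (cube q)" "i < q" "cube_bump q x > 0" for x i
      using cube_sphere_denominator[OF that(1)] that(2,3)
      unfolding q[OF that(1)] by (simp add: cube_sphere_def power2_eq_square)
    have e: "(2 * z i - 1) / cube_bump q z = (2 * z' i - 1) / cube_bump q z'" if "i < q" for i
      using st[OF z that pos(1)] st[OF z' that pos(2)] eq by simp
    show ?thesis
      using cube_sphere_inj_aux[OF z z' e pos(1)] cube_sphere_inj_aux[OF z' z e[symmetric] pos(2)]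
      by (cases "cube_bump q z \<le> cube_bump q z'") auto
  qed
qed

lemma compact_space_cube: "compact_space (cube q)"
  unfolding cube_def by (simp add: compact_space_product_topology compact_space_subtopology)

lemma Hausdorff_nsphere: "Hausdorff_space (nsphere q)"
  unfolding nsphere_def by (intro Hausdorff_space_subtopology Hausdorff_Euclidean_space)

text \<open>From a compact space onto a Hausdorff one, the map is closed and hence a quotient map.
  Its only identifications are within the boundary at a fixed time, so it is enough that the
  boundary goes to one point \<open>c u\<close> for each \<open>u\<close>.\<close>

lemma homotopy_descends_to_nsphere:
  assumes q: "q > 0" and h: "continuous_map (cylinder q) Y h"
    and c: "\<And>u z. u \<in> {0..1} \<Longrightarrow> z \<in> cube_boundary q \<Longrightarrow> h (u, z) = c u"
  obtains k where "continuous_map (prod_topology unit_interval (nsphere q)) Y k"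
    and "\<And>u z. u \<in> {0..1} \<Longrightarrow> z \<in> topspace (cube q) \<Longrightarrow> k (u, cube_sphere q z) = h (u, z)"
proof -
  let ?P = "cylinder q" and ?Q = "prod_topology unit_interval (nsphere q)"
  let ?f = "\<lambda>p. (fst p, cube_sphere q (snd p))"
  have f: "continuous_map ?P ?Q ?f"
    by (intro continuous_map_pairedI continuous_map_fst
        continuous_map_compose'[OF continuous_map_cube_sphere] continuous_map_snd)
  have "compact_space ?P"
    by (simp add: compact_space_prod_topology compact_space_cube compact_space_subtopology)
  moreover have "Hausdorff_space ?Q"
    by (simp add: Hausdorff_space_prod_topology Hausdorff_nsphere Hausdorff_space_subtopology)
  ultimately have "closed_map ?P ?Q ?f" 
    using continuous_imp_closed_map_gen[OF _ _ f] Hausdorff_imp_kc_space by blast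
  moreover have "?f ` topspace ?P = topspace ?Q"
  proof -
    have "?f ` ({0..1} \<times> topspace (cube q)) = {0..1} \<times> cube_sphere q ` topspace (cube q)"
      by force
    then show ?thesis using cube_sphere_surj[OF q] by simp
  qed
  ultimately have quo: "quotient_map ?P ?Q ?f"
    using continuous_closed_imp_quotient_map[OF f] by blast
  have inv: "h x = h y" if "x \<in> topspace ?P" "y \<in> topspace ?P" "?f x = ?f y" for x y
  proof -
    have "snd x = snd y \<or> snd x \<in> cube_boundary q \<and> snd y \<in> cube_boundary q"
      using cube_sphere_inj[of "snd x" q "snd y"] that by auto
    then show ?thesis
    proof
      assume "snd x = snd y"
      then show ?thesis using that(3) by (metis Pair_inject prod.collapse)
    next
      assume b: "snd x \<in> cube_boundary q \<and> snd y \<in> cube_boundary q"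
      have "h (fst x, snd x) = c (fst x)" "h (fst y, snd y) = c (fst y)"
        using b that by (auto intro!: c)
      then show ?thesis using that(3) by simp
    qed
  qed
  show thesis
  proof (rule quotient_map_lift_exists[OF quo h inv])
    fix k assume k: "continuous_map ?Q Y k" "\<And>x. x \<in> topspace ?P \<Longrightarrow> k (?f x) = h x"
    show thesis
    proof (rule that[OF k(1)])
      show "k (u, cube_sphere q z) = h (u, z)" if "u \<in> {0..1}" "z \<in> topspace (cube q)" for u z
        using k(2)[of "(u, z)"] that by simp
    qed
  qed
qed

section \<open>Punctured Euclidean space\<close>

abbreviation punctured_space :: "nat \<Rightarrow> (nat \<Rightarrow> real) topology" where
  "punctured_space d \<equiv> subtopology (Euclidean_space d) (- {\<lambda>_. 0})"

lemma continuous_map_Euclidean_space: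
  "continuous_map X (Euclidean_space d) f \<longleftrightarrow>
     (\<forall>i<d. continuous_map X euclideanreal (\<lambda>x. f x i)) \<and> (\<forall>x\<in>topspace X. \<forall>i\<ge>d. f x i = 0)"
proof
  assume f: "continuous_map X (Euclidean_space d) f"
  then show "(\<forall>i<d. continuous_map X euclideanreal (\<lambda>x. f x i)) \<and> (\<forall>x\<in>topspace X. \<forall>i\<ge>d. f x i = 0)"
    unfolding Euclidean_space_def continuous_map_in_subtopology continuous_map_componentwise_UNIV
    by auto
next
  assume f: "(\<forall>i<d. continuous_map X euclideanreal (\<lambda>x. f x i)) \<and> (\<forall>x\<in>topspace X. \<forall>i\<ge>d. f x i = 0)"
  then have "continuous_map X (Euclidean_space d) (\<lambda>x i. if i < d then f x i else 0)"
    by (simp add: continuous_map_componentwise_Euclidean_space)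
  then show "continuous_map X (Euclidean_space d) f"
    by (rule continuous_map_eq) (use f in auto)
qed

lemma L2_set_pos:
  assumes "x \<in> topspace (Euclidean_space d)" "x \<noteq> (\<lambda>_. 0)"
  shows "L2_set x {..<d} > 0"
proof -
  have "L2_set x {..<d} \<noteq> 0"
    using assms by (auto simp: L2_set_eq_0_iff topspace_Euclidean_space fun_eq_iff)
      (metis lessThan_iff not_less)
  then show ?thesis using L2_set_nonneg[of x "{..<d}"] by linarith
qed

lemma continuous_map_L2_set:
  assumes "continuous_map X (Euclidean_space d) f"
  shows "continuous_map X euclideanreal (\<lambda>x. L2_set (f x) {..<d})"
  using assms unfolding L2_set_def continuous_map_Euclidean_space
  by (intro continuous_intros) auto

lemma L2_set_scale: "L2_set (\<lambda>i. r * x i) A = \<bar>r\<bar> * L2_set x A"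
  by (simp add: L2_set_def power_mult_distrib real_sqrt_mult flip: sum_distrib_left)

lemma nsphere_L2_set:
  "x \<in> topspace (nsphere q) \<longleftrightarrow> x \<in> topspace (Euclidean_space (Suc q)) \<and> L2_set x {..<Suc q} = 1"
  by (auto simp: nsphere_iff L2_set_def topspace_Euclidean_space lessThan_Suc_atMost)

text \<open>After descent to the sphere and radial normalization the homotopy would contract the
  identity, whose degree is 1.\<close>

lemma cube_sphere_essential:
  assumes q: "q > 0" and r: "r > 0"
    and h: "continuous_map (cylinder q) (punctured_space (Suc q)) h"
    and c: "\<And>u z. u \<in> {0..1} \<Longrightarrow> z \<in> cube_boundary q \<Longrightarrow> h (u, z) = c u"
    and h0: "\<And>z. z \<in> topspace (cube q) \<Longrightarrow> h (0, z) = (\<lambda>i. r * cube_sphere q z i)"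
    and h1: "\<And>z. z \<in> topspace (cube q) \<Longrightarrow> h (1, z) = w"
  shows False
proof -
  obtain k where k: "continuous_map (prod_topology unit_interval (nsphere q)) (punctured_space (Suc q)) k"
    and kh: "\<And>u z. u \<in> {0..1} \<Longrightarrow> z \<in> topspace (cube q) \<Longrightarrow> k (u, cube_sphere q z) = h (u, z)"
    using homotopy_descends_to_nsphere[OF q h c] by blast
  let ?n = "\<lambda>x. L2_set x {..<Suc q}"
  let ?N = "\<lambda>x i. x i / ?n x"
  have N: "continuous_map (punctured_space (Suc q)) (nsphere q) ?N"
  proof (rule continuous_map_into_nsphere)
    have id: "continuous_map (punctured_space (Suc q)) (Euclidean_space (Suc q)) (\<lambda>x. x)"
      by (simp add: continuous_map_from_subtopology)
    show "continuous_map (punctured_space (Suc q)) euclideanreal (\<lambda>x. ?N x i)" if "i \<le> q" for i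
    proof (rule continuous_map_real_divide)
      show "continuous_map (punctured_space (Suc q)) euclideanreal (\<lambda>x. x i)"
        using id that unfolding continuous_map_Euclidean_space by auto
      show "continuous_map (punctured_space (Suc q)) euclideanreal ?n"
        by (rule continuous_map_L2_set[OF id])
    qed (use L2_set_pos in fastforce)
    show "?N x \<in> topspace (nsphere q)" if "x \<in> topspace (punctured_space (Suc q))" for x
    proof -
      have p: "?n x > 0" using that by (intro L2_set_pos) auto
      have "?n (\<lambda>i. inverse (?n x) * x i) = 1" unfolding L2_set_scale using p by simp
      then have "?n (?N x) = 1" by (simp add: divide_inverse mult.commute)
      then show ?thesis using that by (auto simp: nsphere_L2_set topspace_Euclidean_space)
    qed
  qed
  have "homotopic_with (\<lambda>_. True) (nsphere q) (nsphere q) id (\<lambda>_. ?N w)"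
  proof (subst homotopic_with, simp, intro exI conjI ballI)
    show "continuous_map (prod_topology unit_interval (nsphere q)) (nsphere q) (\<lambda>p. ?N (k p))"
      by (rule continuous_map_compose'[OF N k])
    fix x assume x: "x \<in> topspace (nsphere q)"
    then obtain z where z: "z \<in> topspace (cube q)" "x = cube_sphere q z"
      using cube_sphere_surj[OF q] by blast
    have k0: "k (0, x) = (\<lambda>i. r * x i)" using kh[of 0 z] h0 z by simp
    have "?n x = 1" using x by (simp add: nsphere_L2_set)
    then have "?n (k (0, x)) = r" unfolding k0 L2_set_scale using r by simp
    then show "?N (k (0, x)) = id x" unfolding k0 using r by auto
    show "?N (k (1, x)) = ?N w" using kh[of 1 z] h1 z by simp
  qed auto
  then have "Brouwer_degree2 q id = 0" by (rule Brouwer_degree2_nullhomotopic)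
  then show False by simp
qed

text \<open>For \<open>w = 0\<close> this is the identity, because \<open>x / 0 = 0\<close>.\<close>

definition reflect :: "nat \<Rightarrow> (nat \<Rightarrow> real) \<Rightarrow> (nat \<Rightarrow> real) \<Rightarrow> nat \<Rightarrow> real" where
  "reflect d w x i = x i - 2 * (\<Sum>j<d. x j * w j) / (\<Sum>j<d. (w j)\<^sup>2) * w i"

lemma reflect_inner:
  "(\<Sum>j<d. reflect d w x j * w j) = - (\<Sum>j<d. x j * w j)"
proof (cases "(\<Sum>j<d. (w j)\<^sup>2) = 0")
  case True
  then have "\<forall>j<d. w j = 0" by (subst (asm) sum_nonneg_eq_0_iff) auto
  then show ?thesis by simp
next
  case False
  have "(\<Sum>j<d. reflect d w x j * w j)
      = (\<Sum>j<d. x j * w j) - 2 * (\<Sum>j<d. x j * w j) / (\<Sum>j<d. (w j)\<^sup>2) * (\<Sum>j<d. (w j)\<^sup>2)"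
    by (simp add: reflect_def left_diff_distrib sum_subtractf sum_distrib_left power2_eq_square mult.assoc)
  then show ?thesis using False by simp
qed

lemma reflect_involution: "reflect d w (reflect d w x) = x"
  by (rule ext) (simp add: reflect_def[of d w "reflect d w x"] reflect_inner, simp add: reflect_def)

lemma reflect_sum_squares: "(\<Sum>j<d. (reflect d w x j)\<^sup>2) = (\<Sum>j<d. (x j)\<^sup>2)"
proof -
  define a where "a = 2 * (\<Sum>j<d. x j * w j) / (\<Sum>j<d. (w j)\<^sup>2)"
  have r: "reflect d w x j = x j - a * w j" for j by (simp add: reflect_def a_def)
  have "(\<Sum>j<d. (reflect d w x j)\<^sup>2) = (\<Sum>j<d. reflect d w x j * x j - a * (reflect d w x j * w j))"
    by (intro sum.cong refl) (simp add: r power2_eq_square algebra_simps)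
  also have "\<dots> = (\<Sum>j<d. reflect d w x j * x j) - a * (\<Sum>j<d. reflect d w x j * w j)"
    by (simp add: sum_subtractf sum_distrib_left)
  also have "(\<Sum>j<d. reflect d w x j * x j) = (\<Sum>j<d. (x j)\<^sup>2 - a * (x j * w j))"
    by (intro sum.cong refl) (simp add: r power2_eq_square algebra_simps)
  also have "\<dots> = (\<Sum>j<d. (x j)\<^sup>2) - a * (\<Sum>j<d. x j * w j)"
    by (simp add: sum_subtractf sum_distrib_left)
  finally show ?thesis unfolding reflect_inner by simp
qed

lemma reflect_scale: "reflect d w (\<lambda>i. r * x i) = (\<lambda>i. r * reflect d w x i)"
proof -
  have "(\<Sum>j<d. r * x j * w j) = r * (\<Sum>j<d. x j * w j)"
    by (simp add: sum_distrib_left mult.assoc)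
  then show ?thesis by (simp add: reflect_def fun_eq_iff algebra_simps)
qed

text \<open>For vectors of equal norm twice the inner product of \<open>a\<close> with
  \<open>a - b\<close> is the square norm of \<open>a - b\<close>, so exactly \<open>a - b\<close>
  is subtracted.\<close>

lemma reflect_diff:
  assumes "(\<Sum>j<d. (a j)\<^sup>2) = (\<Sum>j<d. (b j)\<^sup>2)" "a \<in> topspace (Euclidean_space d)"
    "b \<in> topspace (Euclidean_space d)"
  shows "reflect d (\<lambda>i. a i - b i) a = b"
proof -
  let ?w = "\<lambda>i. a i - b i"
  have 2: "(\<Sum>j<d. (?w j)\<^sup>2) = 2 * (\<Sum>j<d. a j * ?w j)"
  proof -
    have "(\<Sum>j<d. (?w j)\<^sup>2) = (\<Sum>j<d. 2 * (a j * ?w j) + ((b j)\<^sup>2 - (a j)\<^sup>2))"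
      by (intro sum.cong refl) (simp add: power2_eq_square algebra_simps)
    also have "\<dots> = 2 * (\<Sum>j<d. a j * ?w j)"
      using assms(1) by (simp add: sum.distrib sum_subtractf sum_distrib_left)
    finally show ?thesis .
  qed
  show ?thesis
  proof (cases "(\<Sum>j<d. (?w j)\<^sup>2) = 0")
    case True
    then have "\<forall>j<d. ?w j = 0" by (subst (asm) sum_nonneg_eq_0_iff) auto
    then have "a j = b j" for j
      using assms(2,3) by (cases "j < d") (auto simp: topspace_Euclidean_space)
    then show ?thesis by (simp add: reflect_def fun_eq_iff)
  next
    case False
    then show ?thesis unfolding reflect_def 2 by (simp add: fun_eq_iff)
  qed
qed

lemma continuous_map_reflect:
  assumes "w \<in> topspace (Euclidean_space d)"
  shows "continuous_map (Euclidean_space d) (Euclidean_space d) (reflect d w)"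
proof -
  have c: "continuous_map (Euclidean_space d) euclideanreal (\<lambda>x. x i)" if "i < d" for i
    using continuous_map_Euclidean_space[of "Euclidean_space d" d "\<lambda>x. x"] that by simp
  show ?thesis
    unfolding continuous_map_Euclidean_space
  proof (intro conjI allI impI ballI)
    fix i assume "i < d"
    then show "continuous_map (Euclidean_space d) euclideanreal (\<lambda>x. reflect d w x i)"
      unfolding reflect_def divide_inverse
      by (intro continuous_intros c) auto
  qed (use assms in \<open>auto simp: reflect_def topspace_Euclidean_space\<close>)
qed

text \<open>A reflection carries the north pole to the prescribed \<open>n0\<close>; applied once
  more to a contraction it leads back to \<open>cube_sphere_essential\<close>. The free choice of
  \<open>n0\<close> later puts the base point of the separating sphere where it is out of reach of
  the orbits.\<close>

lemma essential_cube_map_exists: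
  assumes q: "q > 0" and n0: "n0 \<in> topspace (nsphere q)"
  obtains \<omega> where "continuous_map (cube q) (nsphere q) \<omega>"
    and "\<And>z. z \<in> cube_boundary q \<Longrightarrow> \<omega> z = n0"
    and "\<And>r w. r > 0 \<Longrightarrow> \<not> homotopic_with (\<lambda>f. \<exists>c. \<forall>z\<in>cube_boundary q. f z = c) (cube q)
      (punctured_space (Suc q)) (\<lambda>z i. r * \<omega> z i) (\<lambda>z. w)"
proof -
  let ?w = "\<lambda>i. north_pole q i - n0 i"
  let ?R = "reflect (Suc q) ?w"
  have np: "north_pole q \<in> topspace (nsphere q)"
    by (simp add: nsphere_iff north_pole_def if_distrib[where f = "\<lambda>x. x\<^sup>2"] cong: if_cong)
  have E: "n0 \<in> topspace (Euclidean_space (Suc q))" "north_pole q \<in> topspace (Euclidean_space (Suc q))"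
    using n0 np by (auto simp: nsphere_L2_set)
  have "?w \<in> topspace (Euclidean_space (Suc q))" using E by (auto simp: topspace_Euclidean_space)
  note R = continuous_map_reflect[OF this]
  have RN: "?R n = n0" if "n = north_pole q" for n
    unfolding that using n0 np E by (intro reflect_diff) (auto simp: nsphere_iff lessThan_Suc_atMost)
  have sub: "continuous_map (nsphere q) (Euclidean_space (Suc q)) (\<lambda>x. x)"
    unfolding nsphere_def by (simp add: continuous_map_from_subtopology)
  have RS: "continuous_map (nsphere q) (nsphere q) ?R"
  proof (rule continuous_map_into_nsphere)
    show "continuous_map (nsphere q) euclideanreal (\<lambda>x. ?R x i)" if "i \<le> q" for i
      using continuous_map_compose'[OF R sub] that unfolding continuous_map_Euclidean_space by auto
    show "?R x \<in> topspace (nsphere q)" if x: "x \<in> topspace (nsphere q)" for x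
    proof -
      have "?R x \<in> topspace (Euclidean_space (Suc q))"
        using continuous_map_funspace[OF R] x by (auto simp: nsphere_L2_set)
      then show ?thesis
        using x reflect_sum_squares[of "Suc q" ?w x] by (simp add: nsphere_L2_set L2_set_def)
    qed
  qed
  show thesis
  proof (rule that)
    show "continuous_map (cube q) (nsphere q) (\<lambda>z. ?R (cube_sphere q z))"
      by (rule continuous_map_compose'[OF RS continuous_map_cube_sphere])
    show "?R (cube_sphere q z) = n0" if "z \<in> cube_boundary q" for z
      by (rule RN[OF cube_sphere_boundary[OF that]])
    fix r w
    assume r: "(r::real) > 0"
    show "\<not> homotopic_with (\<lambda>f. \<exists>c. \<forall>z\<in>cube_boundary q. f z = c) (cube q)
      (punctured_space (Suc q)) (\<lambda>z i. r * ?R (cube_sphere q z) i) (\<lambda>z. w)"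
    proof
      assume "homotopic_with (\<lambda>f. \<exists>c. \<forall>z\<in>cube_boundary q. f z = c) (cube q)
        (punctured_space (Suc q)) (\<lambda>z i. r * ?R (cube_sphere q z) i) (\<lambda>z. w)"
      then obtain h
        where h: "continuous_map (cylinder q) (punctured_space (Suc q)) h"
          and h0: "\<And>z. h (0, z) = (\<lambda>i. r * ?R (cube_sphere q z) i)"
          and h1: "\<And>z. h (1, z) = w"
          and "\<forall>u\<in>{0..1}. \<exists>c. \<forall>z\<in>cube_boundary q. h (u, z) = c"
        unfolding homotopic_with_def by blast
      then obtain c where c: "\<And>u z. u \<in> {0..1} \<Longrightarrow> z \<in> cube_boundary q \<Longrightarrow> h (u, z) = c u"
        by metis
    have R0: "?R (\<lambda>_. 0) = (\<lambda>_. 0)" by (simp add: reflect_def fun_eq_iff)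
    have Rne: "?R x \<noteq> (\<lambda>_. 0)" if "x \<noteq> (\<lambda>_. 0)" for x
      using that reflect_involution[of "Suc q" ?w x] R0 by metis
    have RP: "continuous_map (punctured_space (Suc q)) (punctured_space (Suc q)) ?R"
      by (intro continuous_map_into_subtopology continuous_map_from_subtopology R) (use Rne in auto)
    show False
    proof (rule cube_sphere_essential[OF q r continuous_map_compose'[OF RP h]])
      show "?R (h (u, z)) = ?R (c u)" if "u \<in> {0..1}" "z \<in> cube_boundary q" for u z
        using c[OF that] by simp
      show "?R (h (0, z)) = (\<lambda>i. r * cube_sphere q z i)" if "z \<in> topspace (cube q)" for z
        unfolding h0 reflect_scale reflect_involution ..
      show "?R (h (1, z)) = ?R w" if "z \<in> topspace (cube q)" for z
        using h1 by simp
    qed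
  qed
  qed
qed

section \<open>Coordinate balls\<close>

abbreviation enorm :: "nat \<Rightarrow> (nat \<Rightarrow> real) \<Rightarrow> real" where
  "enorm d v \<equiv> L2_set v {..<d}"

abbreviation vspace :: "nat \<Rightarrow> (nat \<Rightarrow> real) set" where
  "vspace d \<equiv> topspace (Euclidean_space d)"

definition vdisc :: "nat \<Rightarrow> (nat \<Rightarrow> real) set" where
  "vdisc d = {v \<in> vspace d. enorm d v \<le> 1}"

definition vball :: "nat \<Rightarrow> real \<Rightarrow> (nat \<Rightarrow> real) set" where
  "vball d r = {v \<in> vspace d. enorm d v < r}"

lemma enorm_triangle: "enorm d (\<lambda>i. x i + y i) \<le> enorm d x + enorm d y"
  by (rule L2_set_triangle_ineq)

lemma enorm_uminus: "enorm d (\<lambda>i. - x i) = enorm d x"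
  by (simp add: L2_set_def)

lemma enorm_triangle_diff: "enorm d x \<le> enorm d (\<lambda>i. x i - y i) + enorm d y"
  using enorm_triangle[where d = d and x = "\<lambda>i. x i - y i" and y = y] by simp

lemma enorm_diff_le: "enorm d (\<lambda>i. x i - y i) \<le> enorm d x + enorm d y"
  using enorm_triangle[where d = d and x = x and y = "\<lambda>i. - y i"] by (simp add: enorm_uminus)

lemma enorm_zero [simp]: "enorm d (\<lambda>_. 0) = 0"
  by (simp add: L2_set_def)

lemma enorm_pos: "x \<in> vspace d \<Longrightarrow> x \<noteq> (\<lambda>_. 0) \<Longrightarrow> enorm d x > 0"
  by (rule L2_set_pos)

lemma vspace_ops [simp]:
  "x \<in> vspace d \<Longrightarrow> y \<in> vspace d \<Longrightarrow> (\<lambda>i. x i + y i) \<in> vspace d"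
  "x \<in> vspace d \<Longrightarrow> y \<in> vspace d \<Longrightarrow> (\<lambda>i. x i - y i) \<in> vspace d"
  "x \<in> vspace d \<Longrightarrow> (\<lambda>i. x i * r) \<in> vspace d"
  "x \<in> vspace d \<Longrightarrow> (\<lambda>i. r * x i) \<in> vspace d"
  "(\<lambda>i. 0) \<in> vspace d"
  by (auto simp: topspace_Euclidean_space)

lemma continuous_map_coord:
  "continuous_map X (Euclidean_space d) f \<Longrightarrow> continuous_map X euclideanreal (\<lambda>x. f x i)"
proof (cases "i < d")
  case False
  assume f: "continuous_map X (Euclidean_space d) f"
  then have "0 = f x i" if "x \<in> topspace X" for x
    using False that by (simp add: continuous_map_Euclidean_space)
  then show ?thesis
    by (rule continuous_map_eq[where f = "\<lambda>_. 0", rotated]) (assumption, rule continuous_map_const[THEN iffD2], simp)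
qed (simp add: continuous_map_Euclidean_space)

lemma continuous_map_vscale:
  assumes "continuous_map X (Euclidean_space d) f" "continuous_map X euclideanreal r"
  shows "continuous_map X (Euclidean_space d) (\<lambda>x i. f x i * r x)"
  using assms(1) continuous_map_real_mult[OF continuous_map_coord[OF assms(1)] assms(2)]
  by (simp add: continuous_map_Euclidean_space)

lemma continuous_map_vtranslate:
  assumes "continuous_map X (Euclidean_space d) f" "c \<in> vspace d"
  shows "continuous_map X (Euclidean_space d) (\<lambda>x i. c i + f x i)"
  using continuous_map_add[OF _ continuous_map_coord[OF assms(1)], of "\<lambda>_. c _"] assms
  by (auto simp: continuous_map_Euclidean_space topspace_Euclidean_space intro!: continuous_map_add)

lemma continuous_map_vsubtract:
  assumes "continuous_map X (Euclidean_space d) f" "c \<in> vspace d"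
  shows "continuous_map X (Euclidean_space d) (\<lambda>x i. f x i - c i)"
  using continuous_map_vtranslate[OF assms(1), of "\<lambda>i. - c i"] assms(2)
  by (simp add: topspace_Euclidean_space)

text \<open>Closed in the full power of the reals and contained in a product of intervals, which is
  compact by the Tychonoff theorem.\<close>

lemma compactin_vdisc: "compactin (Euclidean_space d) (vdisc d)"
proof -
  let ?K = "PiE UNIV (\<lambda>_::nat. {-1..1::real})"
  have K: "compactin (powertop_real UNIV) ?K"
    by (simp add: compactin_PiE)
  have "continuous_map (Euclidean_space d) euclideanreal (enorm d)"
    by (rule continuous_map_L2_set) simp
  from closedin_continuous_map_preimage[OF this, of "{..1}"]
  have cl: "closedin (Euclidean_space d) (vdisc d)"
    by (simp add: vdisc_def)
  then have "closedin (powertop_real UNIV) (vdisc d)"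
    unfolding Euclidean_space_def using closedin_Euclidean_space[of d]
    by (metis Euclidean_space_def closedin_trans_full topspace_Euclidean_space)
  moreover have "vdisc d \<subseteq> ?K"
  proof
    fix v assume v: "v \<in> vdisc d"
    have "\<bar>v i\<bar> \<le> 1" for i
    proof (cases "i < d")
      case True
      then have "\<bar>v i\<bar> \<le> enorm d (\<lambda>i. \<bar>v i\<bar>)" by (intro member_le_L2_set) auto
      also have "\<dots> = enorm d v" by (simp add: L2_set_def)
      finally show ?thesis using v by (simp add: vdisc_def)
    next
      case False
      then show ?thesis using v by (simp add: vdisc_def topspace_Euclidean_space)
    qed
    then have "v i \<in> {-1..1}" for i using abs_le_iff[of "v i" 1] by simp
    then show "v \<in> ?K" by blast
  qed
  ultimately have "compactin (powertop_real UNIV) (vdisc d)"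
    by (rule closed_compactin[OF K, rotated])
  then show ?thesis
    unfolding Euclidean_space_def compactin_subtopology
    by (auto simp: vdisc_def topspace_Euclidean_space)
qed

lemma open_contains_vball:
  assumes V: "openin (Euclidean_space d) V" and c: "c \<in> V"
  obtains r where "r > 0" "\<And>x. x \<in> vspace d \<Longrightarrow> enorm d (\<lambda>i. x i - c i) < r \<Longrightarrow> x \<in> V"
proof -
  obtain W where W: "openin (powertop_real UNIV) W" "V = W \<inter> {x. \<forall>i\<ge>d. x i = 0}"
    using V unfolding Euclidean_space_def openin_subtopology by blast
  have "c \<in> W" using W(2) c by simp
  then obtain X where X: "\<And>i. open (X i)" "c \<in> PiE UNIV X" "PiE UNIV X \<subseteq> W"
    using product_topology_open_contains_basis[OF W(1)] by (metis open_openin)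
  have "\<exists>r>0. ball (c i) r \<subseteq> X i" for i
    using X by (auto intro!: open_contains_ball[THEN iffD1, rule_format])
  then obtain r where r: "\<And>i. r i > 0" "\<And>i. ball (c i) (r i) \<subseteq> X i" by metis
  \<comment> \<open>The entry 1 keeps the minimum meaningful for \<open>d = 0\<close>.\<close>
  define R where "R = Min (insert 1 (r ` {..<d}))"
  have R: "R > 0" "\<And>i. i < d \<Longrightarrow> R \<le> r i" using r(1) by (auto simp: R_def)
  show thesis
  proof (rule that[OF R(1)])
    fix x assume x: "x \<in> vspace d" "enorm d (\<lambda>i. x i - c i) < R"
    have cv: "c \<in> vspace d" using openin_subset[OF V] c by auto
    have "x i \<in> X i" for i
    proof (cases "i < d")
      case True
      then have "\<bar>x i - c i\<bar> \<le> enorm d (\<lambda>i. \<bar>x i - c i\<bar>)" by (intro member_le_L2_set) auto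
      also have "\<dots> = enorm d (\<lambda>i. x i - c i)" by (simp add: L2_set_def)
      finally have "x i \<in> ball (c i) (r i)" using x R(2)[OF True] by (simp add: dist_real_def)
      then show ?thesis using r by blast
    next
      case False
      then have "x i = c i" using x cv by (simp add: topspace_Euclidean_space)
      then show ?thesis using X(2) by (simp add: PiE_iff)
    qed
    then have "x \<in> W" using X(3) by auto
    then show "x \<in> V" using W x by (simp add: topspace_Euclidean_space)
  qed
qed

definition coordinate_ball :: "'a topology \<Rightarrow> nat \<Rightarrow> ((nat \<Rightarrow> real) \<Rightarrow> 'a) \<Rightarrow> bool" where
  "coordinate_ball T d e \<longleftrightarrow> continuous_map (subtopology (Euclidean_space d) (vdisc d)) T e \<and>
     inj_on e (vdisc d) \<and> (\<forall>r\<le>1. openin T (e ` vball d r))"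

lemma coordinate_ball_continuous:
  "coordinate_ball T d e \<Longrightarrow> continuous_map (subtopology (Euclidean_space d) (vdisc d)) T e"
  by (simp add: coordinate_ball_def)

lemma vdisc_vspace: "v \<in> vdisc d \<Longrightarrow> v \<in> vspace d"
  by (simp add: vdisc_def)

lemma vball_subset: "r \<le> 1 \<Longrightarrow> vball d r \<subseteq> vdisc d"
  by (auto simp: vball_def vdisc_def)

lemma zero_in_vdisc [simp]: "(\<lambda>_. 0) \<in> vdisc d"
  by (simp add: vdisc_def)

lemma coordinate_ball_exists:
  assumes chart: "is_chart T d (U, \<psi>)" and m: "m \<in> U" "openin T W" "m \<in> W"
  obtains e where "coordinate_ball T d e" "e (\<lambda>_. 0) = m" "e ` vdisc d \<subseteq> W"
proof -
  let ?E = "Euclidean_space d"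
  have U: "openin T U" and V: "openin ?E (\<psi> ` U)"
    and hm: "homeomorphic_map (subtopology T U) (subtopology ?E (\<psi> ` U)) \<psi>"
    using chart by (auto simp: is_chart_def)
  obtain g where g: "homeomorphic_maps (subtopology T U) (subtopology ?E (\<psi> ` U)) \<psi> g"
    using hm by (auto simp: homeomorphic_map_maps)
  have UT: "topspace (subtopology T U) = U" "topspace (subtopology ?E (\<psi> ` U)) = \<psi> ` U"
    using openin_subset[OF U] openin_subset[OF V] by auto
  have g\<psi>: "g (\<psi> x) = x" if "x \<in> U" for x
    using g that UT by (simp add: homeomorphic_maps_def)
  have gc: "continuous_map (subtopology ?E (\<psi> ` U)) (subtopology T U) g"
    and hg: "homeomorphic_map (subtopology ?E (\<psi> ` U)) (subtopology T U) g"
    using g by (auto simp: homeomorphic_maps_def homeomorphic_maps_sym homeomorphic_map_maps)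
  have "openin (subtopology T U) (U \<inter> W)" using m(2) by (metis openin_subtopology_Int2)
  then have "openin (subtopology ?E (\<psi> ` U)) (\<psi> ` (U \<inter> W))"
    using hm homeomorphic_imp_open_map open_map_def by blast
  then have "openin ?E (\<psi> ` (U \<inter> W))" by (rule openin_trans_full[OF _ V])
  then obtain r where r: "r > 0"
    "\<And>x. x \<in> vspace d \<Longrightarrow> enorm d (\<lambda>i. x i - \<psi> m i) < r \<Longrightarrow> x \<in> \<psi> ` (U \<inter> W)"
    using open_contains_vball[of d "\<psi> ` (U \<inter> W)" "\<psi> m"] m by blast
  \<comment> \<open>Half the radius, so that the closed ball still fits into the open one.\<close>
  define s where "s = r / 2"
  have s: "s > 0" "s < r" using r(1) by (auto simp: s_def)
  have \<psi>m: "\<psi> m \<in> vspace d" using openin_subset[OF V] m by auto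
  let ?a = "\<lambda>v i. \<psi> m i + v i * s"
  have av: "?a v \<in> vspace d" if "v \<in> vspace d" for v
    using that \<psi>m by (simp add: topspace_Euclidean_space)
  have an: "enorm d (\<lambda>i. ?a v i - \<psi> m i) = enorm d v * s" for v
    using L2_set_scale[of s v "{..<d}"] s by (simp add: mult.commute)
  have aW: "?a v \<in> \<psi> ` (U \<inter> W)" if "v \<in> vdisc d" for v
  proof (rule r(2))
    show "?a v \<in> vspace d" using that av by (simp add: vdisc_def)
    have "enorm d v * s \<le> 1 * s" using that s by (intro mult_right_mono) (auto simp: vdisc_def)
    then show "enorm d (\<lambda>i. ?a v i - \<psi> m i) < r" unfolding an using s by linarith
  qed
  define e where "e v = g (?a v)" for v
  have "\<psi> (g x) = x" if "x \<in> \<psi> ` U" for x using that g\<psi> by auto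
  then have \<psi>e: "\<psi> (e v) = ?a v" if "v \<in> vdisc d" for v
    using aW[OF that] by (auto simp: e_def)
  have ac: "continuous_map (subtopology ?E (vdisc d)) ?E ?a"
    by (intro continuous_map_vtranslate continuous_map_vscale \<psi>m)
      (auto simp: continuous_map_from_subtopology)
  have "continuous_map (subtopology ?E (vdisc d)) (subtopology ?E (\<psi> ` U)) ?a"
    using aW by (intro continuous_map_into_subtopology ac) auto
  from continuous_map_compose'[OF gc this]
  have ec: "continuous_map (subtopology ?E (vdisc d)) T e"
    unfolding e_def by (rule continuous_map_into_fulltopology)
  have ei: "inj_on e (vdisc d)"
  proof (rule inj_onI)
    fix v v' assume "v \<in> vdisc d" "v' \<in> vdisc d" "e v = e v'"
    then have "?a v = ?a v'" using \<psi>e by metis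
    then show "v = v'" using s by (simp add: fun_eq_iff)
  qed
  have eo: "openin T (e ` vball d \<rho>)" if \<rho>: "\<rho> \<le> 1" for \<rho>
  proof -
    let ?B = "{x \<in> vspace d. enorm d (\<lambda>i. x i - \<psi> m i) < \<rho> * s}"
    have "continuous_map ?E euclideanreal (\<lambda>x. enorm d (\<lambda>i. x i - \<psi> m i))"
      by (intro continuous_map_L2_set continuous_map_vsubtract \<psi>m) simp
    from openin_continuous_map_preimage[OF this, of "{..<\<rho> * s}"]
    have B: "openin ?E ?B" by simp
    have Ba: "?B = ?a ` vball d \<rho>"
    proof (intro equalityI subsetI)
      fix x assume x: "x \<in> ?B"
      let ?v = "\<lambda>i. (x i - \<psi> m i) * (1 / s)"
      have v: "?v \<in> vspace d" using x \<psi>m by (simp add: topspace_Euclidean_space)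
      have "enorm d ?v = enorm d (\<lambda>i. x i - \<psi> m i) / s"
        using L2_set_scale[of "1 / s" "\<lambda>i. x i - \<psi> m i" "{..<d}"] s by (simp add: mult.commute)
      also have "\<dots> < \<rho>" using x s by (simp add: divide_less_eq)
      finally have "?v \<in> vball d \<rho>" using v by (simp add: vball_def)
      moreover have "x = ?a ?v" using s by (simp add: fun_eq_iff)
      ultimately show "x \<in> ?a ` vball d \<rho>" by (intro image_eqI[where x = ?v])
    next
      fix x assume "x \<in> ?a ` vball d \<rho>"
      then show "x \<in> ?B" using av an s by (auto simp: vball_def)
    qed
    have "?B \<subseteq> \<psi> ` U" unfolding Ba using aW vball_subset[OF \<rho>] by blast
    then have "openin (subtopology ?E (\<psi> ` U)) ?B" using B by (simp add: openin_open_subtopology V)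
    then have "openin (subtopology T U) (g ` ?B)"
      using hg homeomorphic_imp_open_map open_map_def by blast
    then have "openin T (g ` ?B)" by (rule openin_trans_full[OF _ U])
    moreover have "g ` ?B = e ` vball d \<rho>" unfolding Ba e_def by (simp add: image_image)
    ultimately show ?thesis by simp
  qed
  show thesis
  proof (rule that)
    show "coordinate_ball T d e" using ec ei eo by (simp add: coordinate_ball_def)
    show "e (\<lambda>_. 0) = m" using g\<psi>[OF m(1)] by (simp add: e_def)
    show "e ` vdisc d \<subseteq> W"
    proof
      fix y assume "y \<in> e ` vdisc d"
      then obtain v where v: "v \<in> vdisc d" "y = g (?a v)" by (auto simp: e_def)
      then show "y \<in> W" using aW[OF v(1)] g\<psi> by auto
    qed
  qed
qed

context
  fixes T :: "'a topology" and d :: nat and e :: "(nat \<Rightarrow> real) \<Rightarrow> 'a"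
  assumes T: "Hausdorff_space T" and e: "coordinate_ball T d e"
begin

lemma coordinate_ball_inj: "v \<in> vdisc d \<Longrightarrow> v' \<in> vdisc d \<Longrightarrow> e v = e v' \<Longrightarrow> v = v'"
  using e by (auto simp: coordinate_ball_def inj_on_def)

lemma coordinate_ball_topspace: "v \<in> vdisc d \<Longrightarrow> e v \<in> topspace T"
  using e by (auto simp: coordinate_ball_def continuous_map_def vdisc_def)

lemma coordinate_ball_inv: "v \<in> vdisc d \<Longrightarrow> inv_into (vdisc d) e (e v) = v"
  using e by (auto simp: coordinate_ball_def)

lemma vdisc_space: "topspace (subtopology (Euclidean_space d) (vdisc d)) = vdisc d"
  by (auto simp: vdisc_def)

lemma closedin_coordinate_ball: "closedin T (e ` vdisc d)"
proof -
  have "compactin (subtopology (Euclidean_space d) (vdisc d)) (vdisc d)"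
    using compactin_vdisc by (simp add: compactin_subtopology)
  then have "compactin T (e ` vdisc d)"
    using image_compactin e unfolding coordinate_ball_def by blast
  then show ?thesis by (rule compactin_imp_closedin[OF T])
qed

text \<open>A continuous bijection from a compact space to a Hausdorff space is a
  homeomorphism.\<close>

lemma continuous_map_coordinate_ball_inv:
  "continuous_map (subtopology T (e ` vdisc d)) (subtopology (Euclidean_space d) (vdisc d))
     (inv_into (vdisc d) e)"
proof -
  let ?X = "subtopology (Euclidean_space d) (vdisc d)" and ?Y = "subtopology T (e ` vdisc d)"
  have c: "continuous_map ?X ?Y e"
    using e unfolding coordinate_ball_def
    by (intro continuous_map_into_subtopology) (auto simp: vdisc_def)
  have "compact_space ?X"
    using compactin_vdisc compact_space_subtopology by blast
  moreover have "kc_space ?Y"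
    by (intro Hausdorff_imp_kc_space Hausdorff_space_subtopology T)
  ultimately have "closed_map ?X ?Y e"
    by (rule continuous_imp_closed_map_gen[OF _ _ c])
  moreover have "e ` topspace ?X = topspace ?Y"
    unfolding vdisc_space using coordinate_ball_topspace by auto
  moreover have "inj_on e (topspace ?X)"
    unfolding vdisc_space using coordinate_ball_inj by (auto intro: inj_onI)
  ultimately have "homeomorphic_map ?X ?Y e"
    using c by (intro bijective_closed_imp_homeomorphic_map)
  then obtain g where g: "homeomorphic_maps ?X ?Y e g" by (auto simp: homeomorphic_map_maps)
  have "continuous_map ?Y ?X g" using g by (simp add: homeomorphic_maps_def)
  then show ?thesis
  proof (rule continuous_map_eq)
    fix y assume "y \<in> topspace ?Y"
    then obtain v where v: "v \<in> vdisc d" "y = e v" by auto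
    then show "g y = inv_into (vdisc d) e y"
      using g coordinate_ball_inv vdisc_space unfolding homeomorphic_maps_def by auto
  qed
qed

lemma coordinate_ball_nhd:
  assumes W: "openin T W" "e (\<lambda>_. 0) \<in> W"
  obtains r where "r > 0" "r \<le> 1" "e ` vball d r \<subseteq> W"
proof -
  have "openin (subtopology (Euclidean_space d) (vdisc d))
      {v \<in> topspace (subtopology (Euclidean_space d) (vdisc d)). e v \<in> W}"
    using e W(1) unfolding coordinate_ball_def by (intro openin_continuous_map_preimage) auto
  then have "openin (subtopology (Euclidean_space d) (vdisc d)) {v \<in> vdisc d. e v \<in> W}"
    unfolding vdisc_space .
  then obtain O' where O: "openin (Euclidean_space d) O'" "{v \<in> vdisc d. e v \<in> W} = O' \<inter> vdisc d"
    unfolding openin_subtopology by blast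
  moreover have "(\<lambda>_. 0) \<in> {v \<in> vdisc d. e v \<in> W}" using W by simp
  ultimately have "(\<lambda>_. 0) \<in> O'" by blast
  then obtain r where r: "r > 0" "\<And>x. x \<in> vspace d \<Longrightarrow> enorm d (\<lambda>i. x i - 0) < r \<Longrightarrow> x \<in> O'"
    using open_contains_vball[OF O(1)] by blast
  have "e ` vball d (min r 1) \<subseteq> W"
  proof
    fix y assume "y \<in> e ` vball d (min r 1)"
    then obtain v where v: "v \<in> vball d (min r 1)" "y = e v" by blast
    then have "v \<in> O'" "v \<in> vdisc d" using r(2)[of v] by (auto simp: vball_def vdisc_def)
    then show "y \<in> W" using O(2) v by blast
  qed
  then show thesis using r(1) by (intro that[of "min r 1"]) auto
qed

text \<open>Collapse of the complement of a ball: the closed ball and the complement of the open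
  ball are closed and meet in the bounding sphere, where \<open>F\<close> is already
  \<open>y0\<close>. The sets \<open>S\<close> and \<open>X\<close> allow a puncture inside the
  ball, at which \<open>F\<close> is not continuous.\<close>

lemma continuous_map_extend_coordinate_ball:
  assumes F: "continuous_map (subtopology (Euclidean_space d) (vdisc d \<inter> S)) Y F"
    and bd: "\<And>v. v \<in> vdisc d \<Longrightarrow> enorm d v = 1 \<Longrightarrow> F v = y0" and y0: "y0 \<in> topspace Y"
    and S: "\<And>v. v \<in> vdisc d \<Longrightarrow> e v \<in> X \<Longrightarrow> v \<in> S"
  shows "continuous_map (subtopology T X) Y
     (\<lambda>y. if y \<in> e ` vdisc d then F (inv_into (vdisc d) e y) else y0)"
proof -
  let ?T = "\<lambda>b. if b then X \<inter> e ` vdisc d else X - e ` vball d 1"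
  let ?f = "\<lambda>b y. if b then F (inv_into (vdisc d) e y) else y0"
  have cl: "closedin (subtopology T X) (topspace (subtopology T X) \<inter> ?T b)" for b
  proof (cases b)
    case True
    have "topspace (subtopology T X) \<inter> (X \<inter> e ` vdisc d) = X \<inter> e ` vdisc d"
      using coordinate_ball_topspace by auto
    then show ?thesis using True closedin_coordinate_ball
      by (simp add: closedin_subtopology_Int_closed)
  next
    case False
    have "openin T (e ` vball d 1)" using e by (simp add: coordinate_ball_def)
    then have "closedin T (topspace T - e ` vball d 1)" by blast
    then have "closedin (subtopology T X) (X \<inter> (topspace T - e ` vball d 1))"
      by (rule closedin_subtopology_Int_closed)
    moreover have "topspace (subtopology T X) \<inter> (X - e ` vball d 1) = X \<inter> (topspace T - e ` vball d 1)"
      by auto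
    ultimately show ?thesis using False by simp
  qed
  show ?thesis
  proof (rule pasting_lemma_closed[where I = "{True, False}" and f = ?f
        and T = "\<lambda>b. topspace (subtopology T X) \<inter> ?T b"])
    show "continuous_map (subtopology (subtopology T X) (topspace (subtopology T X) \<inter> ?T b)) Y (?f b)"
      if "b \<in> {True, False}" for b
    proof (cases b)
      case True
      let ?Z = "subtopology T (X \<inter> e ` vdisc d)"
      have "continuous_map ?Z (subtopology (Euclidean_space d) (vdisc d)) (inv_into (vdisc d) e)"
        by (rule continuous_map_from_subtopology_mono[OF continuous_map_coordinate_ball_inv]) auto
      then have "continuous_map ?Z (Euclidean_space d) (inv_into (vdisc d) e)"
        by (rule continuous_map_into_fulltopology)
      then have "continuous_map ?Z (subtopology (Euclidean_space d) (vdisc d \<inter> S)) (inv_into (vdisc d) e)"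
        by (rule continuous_map_into_subtopology) (auto simp: coordinate_ball_inv S)
      from continuous_map_compose'[OF F this]
      have "continuous_map ?Z Y (\<lambda>y. F (inv_into (vdisc d) e y))" .
      moreover have "subtopology (subtopology T X) (topspace (subtopology T X) \<inter> ?T b) = ?Z"
        using True by (simp add: subtopology_subtopology)
          (metis (no_types) inf.left_idem inf_assoc inf_left_commute subtopology_restrict)
      ultimately show ?thesis using True by simp
    qed (use y0 in simp)
    show "closedin (subtopology T X) (topspace (subtopology T X) \<inter> ?T b)" if "b \<in> {True, False}" for b
      by (rule cl)
    show "?f i x = ?f j x" if "i \<in> {True, False}" "j \<in> {True, False}"
      "x \<in> topspace (subtopology T X) \<inter> (topspace (subtopology T X) \<inter> ?T i)
        \<inter> (topspace (subtopology T X) \<inter> ?T j)" for i j x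
    proof -
      have "F (inv_into (vdisc d) e x) = y0" if xD: "x \<in> e ` vdisc d" "x \<notin> e ` vball d 1" for x
      proof -
        obtain v where v: "v \<in> vdisc d" "x = e v" using xD(1) by blast
        then have "v \<notin> vball d 1" using xD(2) by blast
        then have "enorm d v = 1" using v by (simp add: vdisc_def vball_def)
        then show ?thesis using bd v coordinate_ball_inv by simp
      qed
      then show ?thesis using that by (cases i; cases j) auto
    qed
    show "\<exists>j. j \<in> {True, False} \<and> x \<in> topspace (subtopology T X) \<inter> ?T j \<and>
        (if x \<in> e ` vdisc d then F (inv_into (vdisc d) e x) else y0) = ?f j x"
      if "x \<in> topspace (subtopology T X)" for x
    proof (cases "x \<in> e ` vdisc d")
      case True
      then show ?thesis using that by (intro exI[of _ True]) simp
    next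
      case False
      then have "x \<notin> e ` vball d 1" using vball_subset[of 1 d] by blast
      then show ?thesis using that False by (intro exI[of _ False]) simp
    qed
  qed simp
qed

end

section \<open>Pushing radially off finitely many points\<close>

locale coordinate_balls =
  fixes T :: "'a topology" and d :: nat and A :: "'a set" and e :: "'a \<Rightarrow> (nat \<Rightarrow> real) \<Rightarrow> 'a"
  assumes T: "Hausdorff_space T" and finA: "finite A"
    and ball: "m \<in> A \<Longrightarrow> coordinate_ball T d (e m)"
    and center: "m \<in> A \<Longrightarrow> e m (\<lambda>_. 0) = m"
    and disjoint: "m \<in> A \<Longrightarrow> m' \<in> A \<Longrightarrow> v \<in> vdisc d \<Longrightarrow> v' \<in> vdisc d \<Longrightarrow> e m v = e m' v' \<Longrightarrow> m = m'"
begin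

text \<open>Keeps the direction and raises the norm to at least \<open>w\<close>. At the origin the
  value is 0, since \<open>w / 0 = 0\<close>; continuity is claimed only away from it.\<close>

definition stretch :: "real \<Rightarrow> (nat \<Rightarrow> real) \<Rightarrow> nat \<Rightarrow> real" where
  "stretch w v = (\<lambda>i. v i * max 1 (w / enorm d v))"

definition push :: "real \<Rightarrow> 'a \<Rightarrow> 'a" where
  "push w y = (if \<exists>m\<in>A. y \<in> e m ` vdisc d
     then let m = THE m. m \<in> A \<and> y \<in> e m ` vdisc d in e m (stretch w (inv_into (vdisc d) (e m) y))
     else y)"

lemma enorm_stretch:
  assumes "v \<in> vspace d" "v \<noteq> (\<lambda>_. 0)"
  shows "enorm d (stretch w v) = max (enorm d v) w"
proof -
  have "enorm d (stretch w v) = max 1 (w / enorm d v) * enorm d v"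
    using L2_set_scale[of "max 1 (w / enorm d v)" v "{..<d}"] by (simp add: stretch_def mult.commute)
  also have "\<dots> = max (enorm d v) w"
    using enorm_pos[OF assms] by (simp add: max_def field_simps)
  finally show ?thesis .
qed

lemma stretch_in_vdisc:
  assumes "v \<in> vdisc d" "v \<noteq> (\<lambda>_. 0)" "w \<le> 1"
  shows "stretch w v \<in> vdisc d"
proof -
  have v: "v \<in> vspace d" "enorm d v \<le> 1" using assms(1) by (auto simp: vdisc_def)
  then have "stretch w v \<in> vspace d" by (simp add: stretch_def)
  moreover have "enorm d (stretch w v) \<le> 1"
    unfolding enorm_stretch[OF v(1) assms(2)] using v(2) assms(3) by simp
  ultimately show ?thesis by (simp add: vdisc_def)
qed

lemma stretch_trivial: "w \<le> enorm d v \<Longrightarrow> stretch w v = v"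
proof -
  assume w: "w \<le> enorm d v"
  have "w / enorm d v \<le> 1"
  proof (cases "enorm d v = 0")
    case False
    then have "enorm d v > 0" using L2_set_nonneg[of v "{..<d}"] by linarith
    then show ?thesis using w by simp
  qed simp
  then show ?thesis by (simp add: stretch_def max_absorb1)
qed

lemma push_ball:
  assumes "m \<in> A" "v \<in> vdisc d"
  shows "push w (e m v) = e m (stretch w v)"
proof -
  have "(THE m'. m' \<in> A \<and> e m v \<in> e m' ` vdisc d) = m"
  proof (rule the_equality)
    fix m' assume "m' \<in> A \<and> e m v \<in> e m' ` vdisc d"
    then show "m' = m" using assms disjoint by (metis imageE)
  qed (use assms in auto)
  moreover have "\<exists>m'\<in>A. e m v \<in> e m' ` vdisc d" using assms by blast
  ultimately show ?thesis
    using coordinate_ball_inv[OF T ball] assms by (simp add: push_def)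
qed

lemma push_outside: "(\<And>m. m \<in> A \<Longrightarrow> y \<notin> e m ` vdisc d) \<Longrightarrow> push w y = y"
  by (auto simp: push_def)

lemma coordinate_balls_cases:
  obtains m v where "m \<in> A" "v \<in> vdisc d" "y = e m v" | "\<And>m. m \<in> A \<Longrightarrow> y \<notin> e m ` vdisc d"
  by blast

lemma nonzero_coordinates: "m \<in> A \<Longrightarrow> e m v \<notin> A \<Longrightarrow> v \<noteq> (\<lambda>_. 0)"
  using center by auto

lemma push_zero: "y \<notin> A \<Longrightarrow> push 0 y = y"
proof (cases rule: coordinate_balls_cases[of y])
  case (1 m v)
  then show ?thesis using push_ball[OF 1(1,2), of 0] stretch_trivial[of 0 v] by simp
qed (rule push_outside)

text \<open>The purpose of pushing: whatever lies within radius \<open>w\<close> of the centres is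
  avoided, wherever it moves there.\<close>

lemma push_away:
  assumes y: "y \<notin> A" and w: "w \<le> 1" and m: "m \<in> A" and v: "v \<in> vdisc d" "enorm d v < w"
  shows "push w y \<noteq> e m v"
proof (cases rule: coordinate_balls_cases[of y])
  case (1 m' v')
  have v'0: "v' \<noteq> (\<lambda>_. 0)" using nonzero_coordinates 1 y by blast
  have v's: "v' \<in> vspace d" using 1(2) by (simp add: vdisc_def)
  have d: "stretch w v' \<in> vdisc d" by (rule stretch_in_vdisc[OF 1(2) v'0 w])
  show ?thesis
  proof
    assume "push w y = e m v"
    then have eq: "e m' (stretch w v') = e m v" using push_ball[OF 1(1,2)] 1(3) by simp
    then have "m' = m" using disjoint[OF 1(1) m d v(1)] by blast
    then have "stretch w v' = v" using coordinate_ball_inj[OF T ball[OF m] d v(1)] eq by simp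
    then show False using enorm_stretch[OF v's v'0, of w] v(2) by simp
  qed
next
  case 2
  then show ?thesis using push_outside[of y w] m v by auto
qed

text \<open>Norms never decrease, so no centre is hit, and points move only inside the balls, which
  \<open>S\<close> does not meet.\<close>

lemma push_preserves:
  assumes y: "y \<notin> A" and w: "w \<le> 1" and S: "\<And>m v. m \<in> A \<Longrightarrow> v \<in> vdisc d \<Longrightarrow> e m v \<notin> S"
    and yS: "y \<notin> S"
  shows "push w y \<notin> A \<union> S"
proof (cases rule: coordinate_balls_cases[of y])
  case (1 m v)
  have v0: "v \<noteq> (\<lambda>_. 0)" using nonzero_coordinates 1 y by blast
  have vs: "v \<in> vspace d" using 1(2) by (simp add: vdisc_def)
  have d: "stretch w v \<in> vdisc d" by (rule stretch_in_vdisc[OF 1(2) v0 w])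
  have "e m (stretch w v) \<notin> A"
  proof
    assume a: "e m (stretch w v) \<in> A"
    then have "e m (stretch w v) = e (e m (stretch w v)) (\<lambda>_. 0)" using center by simp
    then have "m = e m (stretch w v)" using disjoint[OF 1(1) a d zero_in_vdisc] by blast
    then have "e m (stretch w v) = e m (\<lambda>_. 0)" using center 1(1) by simp
    then have "stretch w v = (\<lambda>_. 0)" using coordinate_ball_inj[OF T ball[OF 1(1)] d] by simp
    then show False using enorm_stretch[OF vs v0, of w] enorm_pos[OF vs v0] by simp
  qed
  then show ?thesis using push_ball[OF 1(1,2)] 1 S d by simp
next
  case 2
  then show ?thesis using push_outside[of y w] y yS by auto
qed

text \<open>Pasting over the finitely many closed balls (\<open>Some m\<close>) and the complement
  of the open balls (\<open>None\<close>). On a bounding sphere the norm is 1 and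
  \<open>w \<le> 1\<close>, so stretching is trivial there; removing \<open>A\<close> keeps the
  denominators nonzero.\<close>

lemma continuous_map_push:
  "continuous_map (prod_topology unit_interval (subtopology T (- A))) T (\<lambda>z. push (fst z) (snd z))"
proof -
  let ?W = "prod_topology unit_interval (subtopology T (- A))"
  let ?T = "\<lambda>i. case i of None \<Rightarrow> {z \<in> topspace ?W. snd z \<in> topspace T - (\<Union>m\<in>A. e m ` vball d 1)}
      | Some m \<Rightarrow> {z \<in> topspace ?W. snd z \<in> e m ` vdisc d}"
  let ?f = "\<lambda>i z. case i of None \<Rightarrow> snd z
      | Some m \<Rightarrow> e m (stretch (fst z) (inv_into (vdisc d) (e m) (snd z)))"
  have sndT: "continuous_map ?W T snd"
    using continuous_map_into_fulltopology[OF continuous_map_snd] .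
  have e: "z \<in> topspace ?W \<Longrightarrow> snd z = e m v \<Longrightarrow> m \<in> A \<Longrightarrow> v \<noteq> (\<lambda>_. 0)" for z m v
    by (rule nonzero_coordinates) auto
  show ?thesis
  proof (rule pasting_lemma_closed[where I = "insert None (Some ` A)" and f = ?f and T = ?T])
    show "finite (insert None (Some ` A))" using finA by simp
    fix i assume i: "i \<in> insert None (Some ` A)"
    show "closedin ?W (?T i)"
    proof (cases i)
      case None
      have "openin T (\<Union>m\<in>A. e m ` vball d 1)"
        using ball by (intro openin_Union) (auto simp: coordinate_ball_def)
      then have "closedin T (topspace T - (\<Union>m\<in>A. e m ` vball d 1))" by blast
      from closedin_continuous_map_preimage[OF sndT this] show ?thesis using None by simp
    next
      case (Some m)
      then have "closedin T (e m ` vdisc d)"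
        using i closedin_coordinate_ball[OF T ball] by auto
      from closedin_continuous_map_preimage[OF sndT this] show ?thesis using Some by simp
    qed
    show "continuous_map (subtopology ?W (?T i)) T (?f i)"
    proof (cases i)
      case None
      then show ?thesis using continuous_map_from_subtopology[OF sndT] by simp
    next
      case (Some m)
      then have m: "m \<in> A" using i by auto
      let ?Z = "subtopology ?W {z \<in> topspace ?W. snd z \<in> e m ` vdisc d}"
      have inv: "inv_into (vdisc d) (e m) (snd z) \<in> vdisc d \<and> e m (inv_into (vdisc d) (e m) (snd z)) = snd z"
        if "z \<in> topspace ?Z" for z
        using that by (auto simp: inv_into_into f_inv_into_f)
      have nz: "inv_into (vdisc d) (e m) (snd z) \<noteq> (\<lambda>_. 0)" if "z \<in> topspace ?Z" for z
        using inv[OF that] e[of z m] m that by auto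
      have "continuous_map ?Z (subtopology T (e m ` vdisc d)) snd"
        by (intro continuous_map_into_subtopology continuous_map_from_subtopology sndT) auto
      from continuous_map_compose'[OF continuous_map_coordinate_ball_inv[OF T ball[OF m]] this]
      have vc: "continuous_map ?Z (Euclidean_space d) (\<lambda>z. inv_into (vdisc d) (e m) (snd z))"
        by (rule continuous_map_into_fulltopology)
      have "continuous_map ?Z (Euclidean_space d) (\<lambda>z. stretch (fst z) (inv_into (vdisc d) (e m) (snd z)))"
        unfolding stretch_def
      proof (intro continuous_map_vscale vc continuous_map_real_max continuous_map_real_divide
          continuous_map_L2_set)
        show "continuous_map ?Z euclideanreal fst"
          by (intro continuous_map_from_subtopology continuous_map_from_unit_interval[OF continuous_map_fst])
        show "enorm d (inv_into (vdisc d) (e m) (snd z)) \<noteq> 0" if "z \<in> topspace ?Z" for z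
          using enorm_pos[OF vdisc_vspace[OF conjunct1[OF inv[OF that]]] nz[OF that]] by simp
      qed simp
      then have "continuous_map ?Z (subtopology (Euclidean_space d) (vdisc d))
          (\<lambda>z. stretch (fst z) (inv_into (vdisc d) (e m) (snd z)))"
      proof (rule continuous_map_into_subtopology, intro funcsetI)
        fix z assume z: "z \<in> topspace ?Z"
        then have "fst z \<le> 1" by auto
        then show "stretch (fst z) (inv_into (vdisc d) (e m) (snd z)) \<in> vdisc d"
          using inv[OF z] nz[OF z] by (intro stretch_in_vdisc) auto
      qed
      from continuous_map_compose'[OF coordinate_ball_continuous[OF ball[OF m]] this] show ?thesis
        using Some by simp
    qed
  next
    have sm: "?f (Some m) z = ?f None z" if m: "m \<in> A" "z \<in> ?T (Some m)" "z \<in> ?T None" for m z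
    proof -
      obtain v where v: "v \<in> vdisc d" "snd z = e m v" using m(2) by auto
      then have "v \<notin> vball d 1" using m(1,3) by auto
      then have "enorm d v \<ge> 1" using v by (simp add: vball_def vdisc_def)
      moreover have "fst z \<le> 1" using m(2) by auto
      ultimately show ?thesis
        using stretch_trivial[of "fst z" v] coordinate_ball_inv[OF T ball[OF m(1)] v(1)] v(2) by simp
    qed
    have ss: "m = m'" if "m \<in> A" "m' \<in> A" "z \<in> ?T (Some m)" "z \<in> ?T (Some m')" for m m' z
      using that disjoint[OF that(1,2)] by auto
    fix i j z assume i: "i \<in> insert None (Some ` A)" and j: "j \<in> insert None (Some ` A)"
      and z: "z \<in> topspace ?W \<inter> ?T i \<inter> ?T j"
    show "?f i z = ?f j z"
    proof (cases i)
      case None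
      then show ?thesis using j z sm[of _ z] by (cases j) auto
    next
      case (Some m)
      note im = this
      then have m: "m \<in> A" using i by auto
      show ?thesis
      proof (cases j)
        case None
        then show ?thesis using sm[OF m, of z] im z by auto
      next
        case (Some m')
        then have m': "m' \<in> A" using j by auto
        have "z \<in> ?T (Some m)" "z \<in> ?T (Some m')" using z im Some by auto
        then show ?thesis using ss[OF m m'] im Some by auto
      qed
    qed
  next
    fix z assume z: "z \<in> topspace ?W"
    show "\<exists>j. j \<in> insert None (Some ` A) \<and> z \<in> ?T j \<and> push (fst z) (snd z) = ?f j z"
    proof (cases rule: coordinate_balls_cases[of "snd z"])
      case (1 m v)
      then show ?thesis
        using z push_ball[OF 1(1,2), of "fst z"] coordinate_ball_inv[OF T ball[OF 1(1)] 1(2)]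
        by (intro exI[of _ "Some m"]) auto
    next
      case 2
      have "snd z \<notin> e m ` vball d 1" if "m \<in> A" for m
        using 2[OF that] vball_subset[of 1 d] by blast
      then show ?thesis
        using z push_outside[of "snd z" "fst z"] 2 by (intro exI[of _ None]) auto
    qed
  qed
qed

end

section \<open>Inversion in a sphere\<close>

text \<open>\<open>sphere_inversion\<close> turns the ball of radius \<open>3/4\<close> about \<open>a\<close> inside out: it sends the bounding
  sphere to \<open>0\<close> and the centre to infinity, and vanishes outside.\<close>

definition sphere_inversion :: "nat \<Rightarrow> (nat \<Rightarrow> real) \<Rightarrow> (nat \<Rightarrow> real) \<Rightarrow> nat \<Rightarrow> real" where
  "sphere_inversion d a x = (\<lambda>i. (x i - a i) *
     (max 0 (3 / 4 / enorm d (\<lambda>i. x i - a i) - 1) / enorm d (\<lambda>i. x i - a i)))"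

text \<open>A point at distance \<open>s\<close> from \<open>a\<close> goes to norm
  \<open>N = 3 / (4 * s) - 1\<close>, so norm \<open>N\<close> comes from distance
  \<open>3 / (4 * (1 + N))\<close>; the factor is this distance divided by \<open>N\<close>.\<close>

definition sphere_inversion_inv :: "nat \<Rightarrow> (nat \<Rightarrow> real) \<Rightarrow> (nat \<Rightarrow> real) \<Rightarrow> nat \<Rightarrow> real" where
  "sphere_inversion_inv d a w = (\<lambda>i. a i + w i * (3 / 4 / (enorm d w * (1 + enorm d w))))"

context
  fixes d :: nat and a :: "nat \<Rightarrow> real"
  assumes a: "a \<in> vspace d"
begin

lemma sphere_inversion_in_vspace: "x \<in> vspace d \<Longrightarrow> sphere_inversion d a x \<in> vspace d"
  unfolding sphere_inversion_def by (intro vspace_ops a)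

lemma enorm_scale: "enorm d (\<lambda>i. x i * r) = enorm d x * \<bar>r\<bar>"
  using L2_set_scale[of r x "{..<d}"] by (simp add: mult.commute)

lemma sphere_inversion_outside:
  assumes "x \<in> vspace d" "enorm d (\<lambda>i. x i - a i) \<ge> 3 / 4"
  shows "sphere_inversion d a x = (\<lambda>_. 0)"
proof -
  have "3 / 4 / enorm d (\<lambda>i. x i - a i) - 1 \<le> 0" using assms(2) by (simp add: divide_le_eq)
  then show ?thesis by (simp add: sphere_inversion_def max_absorb1)
qed

lemma sphere_inversion_inverse:
  assumes x: "x \<in> vspace d" and ne: "sphere_inversion d a x \<noteq> (\<lambda>_. 0)"
  shows "sphere_inversion_inv d a (sphere_inversion d a x) = x"
proof -
  let ?n = "enorm d (\<lambda>i. x i - a i)"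
  have lt: "?n < 3 / 4" using sphere_inversion_outside[OF x] ne by force
  \<comment> \<open>At the centre the formula yields 0 by default instead of infinity, so a nonzero
    value excludes the centre too.\<close>
  have "(\<lambda>i. x i - a i) \<noteq> (\<lambda>_. 0)"
  proof
    assume "(\<lambda>i. x i - a i) = (\<lambda>_. 0)"
    then have "x i - a i = 0" for i by (rule fun_cong)
    then show False using ne by (simp add: sphere_inversion_def)
  qed
  then have n: "?n > 0" using x a by (intro enorm_pos) auto
  have m: "max 0 (3 / 4 / ?n - 1) = 3 / 4 / ?n - 1"
    using n lt by (intro max_absorb2) (simp add: field_simps)
  have G: "sphere_inversion d a x = (\<lambda>i. (x i - a i) * ((3 / 4 / ?n - 1) / ?n))"
    unfolding sphere_inversion_def m ..
  have pos: "3 / 4 / ?n - 1 > 0" using n lt by (simp add: field_simps)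
  then have N: "enorm d (sphere_inversion d a x) = 3 / 4 / ?n - 1"
    unfolding G enorm_scale using n by simp
  have id: "c / ?n * (3 / 4 / (c * (1 + c))) = 1" if "c > 0" "?n * (1 + c) = 3 / 4" for c
  proof -
    have "c / ?n * (3 / 4 / (c * (1 + c))) = 3 / 4 / (?n * (1 + c))" using that(1) n by simp
    then show ?thesis unfolding that(2) by simp
  qed
  have "(3 / 4 / ?n - 1) / ?n * (3 / 4 / ((3 / 4 / ?n - 1) * (1 + (3 / 4 / ?n - 1)))) = 1"
    by (rule id[OF pos]) (use n in simp)
  then have "(x i - a i) * ((3 / 4 / ?n - 1) / ?n) * (3 / 4 / ((3 / 4 / ?n - 1) * (1 + (3 / 4 / ?n - 1))))
      = x i - a i" for i
    by (simp only: mult.assoc) simp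
  then show ?thesis
    unfolding sphere_inversion_inv_def N unfolding G by (simp add: fun_eq_iff)
qed

lemma enorm_sphere_inversion_inv:
  assumes w: "w \<in> vspace d" "w \<noteq> (\<lambda>_. 0)"
  shows "enorm d (\<lambda>i. sphere_inversion_inv d a w i - a i) = 3 / 4 / (1 + enorm d w)"
proof -
  have N: "enorm d w > 0" by (rule enorm_pos[OF w])
  have "(\<lambda>i. sphere_inversion_inv d a w i - a i) = (\<lambda>i. w i * (3 / 4 / (enorm d w * (1 + enorm d w))))"
    by (simp add: sphere_inversion_inv_def)
  then have "enorm d (\<lambda>i. sphere_inversion_inv d a w i - a i)
      = enorm d w * \<bar>3 / 4 / (enorm d w * (1 + enorm d w))\<bar>"
    by (simp only: enorm_scale)
  then show ?thesis using N by simp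
qed

lemma sphere_inversion_right_inverse:
  assumes w: "w \<in> vspace d" "w \<noteq> (\<lambda>_. 0)"
  shows "sphere_inversion d a (sphere_inversion_inv d a w) = w"
proof -
  have N: "enorm d w > 0" by (rule enorm_pos[OF w])
  let ?N = "enorm d w"
  have m: "max 0 (3 / 4 / (3 / 4 / (1 + ?N)) - 1) = ?N" using N by (simp add: add_divide_distrib)
  have e: "sphere_inversion_inv d a w i - a i = w i * (3 / 4 / (?N * (1 + ?N)))" for i
    by (simp add: sphere_inversion_inv_def)
  have "w i * (3 / 4 / (?N * (1 + ?N))) * (?N / (3 / 4 / (1 + ?N))) = w i" for i
    using N by simp
  then show ?thesis
    unfolding sphere_inversion_def enorm_sphere_inversion_inv[OF w] m unfolding e
    by (simp only:)
qed

lemma sphere_inversion_inv_in_vspace: "w \<in> vspace d \<Longrightarrow> sphere_inversion_inv d a w \<in> vspace d"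
  unfolding sphere_inversion_inv_def by (intro vspace_ops a)

lemma continuous_map_sphere_inversion:
  "continuous_map (subtopology (Euclidean_space d) (- {a})) (Euclidean_space d) (sphere_inversion d a)"
proof -
  let ?X = "subtopology (Euclidean_space d) (- {a})"
  have c: "continuous_map ?X (Euclidean_space d) (\<lambda>x i. x i - a i)"
    by (intro continuous_map_vsubtract a) (simp add: continuous_map_from_subtopology)
  have "enorm d (\<lambda>i. x i - a i) \<noteq> 0" if "x \<in> topspace ?X" for x
  proof -
    have "(\<lambda>i. x i - a i) \<noteq> (\<lambda>_. 0)"
    proof
      assume "(\<lambda>i. x i - a i) = (\<lambda>_. 0)"
      then have "x i - a i = 0" for i by (rule fun_cong)
      then have "x = a" by (simp add: fun_eq_iff)
      then show False using that by simp
    qed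
    then have "enorm d (\<lambda>i. x i - a i) > 0" using that a by (intro enorm_pos) auto
    then show ?thesis by simp
  qed
  then show ?thesis
    unfolding sphere_inversion_def
    by (intro continuous_map_vscale c continuous_map_real_divide continuous_map_real_max
        continuous_map_diff continuous_map_L2_set) auto
qed

lemma continuous_map_sphere_inversion_inv:
  "continuous_map (punctured_space d) (Euclidean_space d) (sphere_inversion_inv d a)"
proof -
  have c: "continuous_map (punctured_space d) (Euclidean_space d) (\<lambda>x. x)"
    by (simp add: continuous_map_from_subtopology)
  have "enorm d w * (1 + enorm d w) \<noteq> 0" if "w \<in> topspace (punctured_space d)" for w
  proof -
    have "enorm d w > 0" using that by (intro enorm_pos) auto
    then show ?thesis by simp
  qed
  then show ?thesis
    unfolding sphere_inversion_inv_def
    by (intro continuous_map_vtranslate a continuous_map_vscale c continuous_map_real_divide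
        continuous_map_real_mult continuous_map_add continuous_map_L2_set) auto
qed

end

section \<open>A sphere that separates colliding orbit points\<close>

lemma Hausdorff_separate_finite:
  assumes T: "Hausdorff_space T" and A: "finite A" "A \<subseteq> topspace T"
  obtains W where "\<And>m. m \<in> A \<Longrightarrow> openin T (W m)" "\<And>m. m \<in> A \<Longrightarrow> m \<in> W m"
    and "\<And>m m'. m \<in> A \<Longrightarrow> m' \<in> A \<Longrightarrow> m \<noteq> m' \<Longrightarrow> W m \<inter> W m' = {}"
proof -
  have "\<exists>U V. openin T U \<and> openin T V \<and> m \<in> U \<and> m' \<in> V \<and> disjnt U V"
    if "m \<in> A" "m' \<in> A" "m \<noteq> m'" for m m'
    using T that A(2) unfolding Hausdorff_space_def by blast
  then obtain U V where UV: "\<And>m m'. m \<in> A \<Longrightarrow> m' \<in> A \<Longrightarrow> m \<noteq> m' \<Longrightarrow>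
      openin T (U m m') \<and> openin T (V m m') \<and> m \<in> U m m' \<and> m' \<in> V m m' \<and> disjnt (U m m') (V m m')"
    by metis
  \<comment> \<open>Each point takes both roles in its pairs: \<open>W m\<close> lies in
    \<open>U m m'\<close> while \<open>W m'\<close> lies in \<open>V m m'\<close>. An empty
    intersection is \<open>UNIV\<close>, whence the intersection with the space and the case split
    below.\<close>
  define W where "W m = topspace T \<inter> (\<Inter>m'\<in>A - {m}. U m m' \<inter> V m' m)" for m
  show thesis
  proof (rule that[of W])
    fix m assume m: "m \<in> A"
    show "openin T (W m)"
    proof (cases "A - {m} = {}")
      case True
      then show ?thesis unfolding W_def by (simp only: INF_empty inf_top_right openin_topspace)
    next
      case False
      then show ?thesis
        unfolding W_def using A(1) m UV
        by (intro openin_Int openin_topspace openin_Inter) auto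
    qed
    show "m \<in> W m" unfolding W_def using A(2) m UV by auto
    fix m' assume "m' \<in> A" "m \<noteq> m'"
    then have "W m \<subseteq> U m m'" "W m' \<subseteq> V m m'" "disjnt (U m m') (V m m')"
      using m UV[of m m'] by (auto simp: W_def)
    then show "W m \<inter> W m' = {}" by (auto simp: disjnt_def)
  qed
qed

text \<open>The part of the group action that the topology uses: finitely many continuous maps whose
  orbits partition the space.\<close>

locale orbit_space =
  fixes T :: "'a topology" and \<phi> :: "'g \<Rightarrow> 'a \<Rightarrow> 'a" and C :: "'g set" and orb :: "'a \<Rightarrow> 'a set"
  assumes T: "Hausdorff_space T" and C: "finite C"
    and \<phi>: "h \<in> C \<Longrightarrow> continuous_map T T (\<phi> h)"
    and orb: "x \<in> topspace T \<Longrightarrow> orb x = (\<lambda>h. \<phi> h x) ` C"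
    and orb_eq: "x \<in> topspace T \<Longrightarrow> y \<in> topspace T \<Longrightarrow> orb x = orb y \<longleftrightarrow> y \<in> orb x"
begin

lemma orb_self: "x \<in> topspace T \<Longrightarrow> x \<in> orb x"
  using orb_eq by blast

lemma orb_finite: "x \<in> topspace T \<Longrightarrow> finite (orb x)"
  using orb C by simp

lemma orb_subset: "x \<in> topspace T \<Longrightarrow> orb x \<subseteq> topspace T"
  using orb \<phi> by (auto simp: continuous_map_def)

text \<open>Since \<open>y0\<close> avoids every orbit along \<open>\<xi>\<close>, it can be the
  base point in all fibres over that path. \<open>P\<close> is the push to radius 1/4, enough to
  clear these orbits and too little to move \<open>y0\<close>. \<open>Bad\<close> will consist of
  the orbits of the other points of the configuration.\<close>

lemma separating_sphere:
  assumes q: "q > 0"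
    and chart: "\<And>x. x \<in> topspace T \<Longrightarrow> \<exists>U \<psi>. x \<in> U \<and> is_chart T (Suc q) (U, \<psi>)"
    and p: "p \<in> topspace T" and k: "k \<in> C" "\<phi> k p = p"
    and moved: "\<And>W. openin T W \<Longrightarrow> p \<in> W \<Longrightarrow> \<exists>x\<in>W. \<phi> k x \<noteq> x"
    and Bad: "finite Bad" "Bad \<inter> orb p = {}"
  obtains \<xi> \<sigma> y0 P where
    "continuous_map unit_interval T \<xi>" "\<xi> 0 = p"
    "\<And>s. s \<in> {0..1} \<Longrightarrow> y0 \<notin> orb (\<xi> s) \<union> Bad"
    "\<And>s. s \<in> {0..1} \<Longrightarrow> orb (\<xi> s) \<inter> Bad = {}"
    "\<sigma> \<in> based_maps q (subtopology T (- (orb (\<xi> 1) \<union> Bad))) y0"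
    "continuous_map (prod_topology unit_interval (subtopology T (- (orb p \<union> Bad))))
       (subtopology T (- (orb p \<union> Bad))) P"
    "\<And>y. y \<notin> orb p \<union> Bad \<Longrightarrow> P (0, y) = y"
    "\<And>s. s \<in> {0..1} \<Longrightarrow> P (s, y0) = y0"
    "\<And>s y. s \<in> {0..1} \<Longrightarrow> y \<notin> orb p \<union> Bad \<Longrightarrow> P (1, y) \<notin> orb (\<xi> s) \<union> Bad"
    "\<And>\<tau>. \<tau> \<in> based_maps q (subtopology T (- (orb p \<union> Bad))) y0 \<Longrightarrow>
       (\<sigma>, \<lambda>z. P (1, \<tau> z)) \<notin> based_homotopy q (subtopology T (- (orb (\<xi> 1) \<union> Bad))) y0"
proof -
  let ?d = "Suc q"
  define A where "A = orb p"
  have A: "finite A" "A \<subseteq> topspace T" "p \<in> A"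
    unfolding A_def by (rule orb_finite[OF p] orb_subset[OF p] orb_self[OF p])+
  obtain W where W: "\<And>m. m \<in> A \<Longrightarrow> openin T (W m)" "\<And>m. m \<in> A \<Longrightarrow> m \<in> W m"
    "\<And>m m'. m \<in> A \<Longrightarrow> m' \<in> A \<Longrightarrow> m \<noteq> m' \<Longrightarrow> W m \<inter> W m' = {}"
    using Hausdorff_separate_finite[OF T A(1,2)] by metis
  have "closedin T (topspace T \<inter> Bad)"
    using T Bad(1) by (intro closedin_Hausdorff_finite) auto
  then have oB: "openin T (topspace T - Bad)"
    using openin_diff[OF openin_topspace[of T]] by (metis Diff_Int2 inf_commute inf_idem)
  have "\<exists>e. coordinate_ball T ?d e \<and> e (\<lambda>_. 0) = m \<and> e ` vdisc ?d \<subseteq> W m \<inter> (topspace T - Bad)"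
    if m: "m \<in> A" for m
  proof -
    obtain U \<psi> where U: "m \<in> U" "is_chart T ?d (U, \<psi>)" using chart A m by blast
    have o: "openin T (W m \<inter> (topspace T - Bad))" by (intro openin_Int W(1)[OF m] oB)
    have i: "m \<in> W m \<inter> (topspace T - Bad)" using W(2)[OF m] m A Bad(2) A_def by auto
    show ?thesis using coordinate_ball_exists[OF U(2,1) o i] by metis
  qed
  then obtain e where e: "\<And>m. m \<in> A \<Longrightarrow> coordinate_ball T ?d (e m)"
    "\<And>m. m \<in> A \<Longrightarrow> e m (\<lambda>_. 0) = m" "\<And>m. m \<in> A \<Longrightarrow> e m ` vdisc ?d \<subseteq> W m \<inter> (topspace T - Bad)"
    by metis
  interpret coordinate_balls T ?d A e
  proof
    fix m m' v v'
    assume a: "m \<in> A" "m' \<in> A" "v \<in> vdisc ?d" "v' \<in> vdisc ?d" "e m v = e m' v'"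
    have "e m v \<in> W m" using e(3)[OF a(1)] a(3) by blast
    moreover have "e m v \<in> W m'" using e(3)[OF a(2)] a(4) unfolding a(5) by blast
    ultimately have "e m v \<in> W m" "e m v \<in> W m'" .
    then show "m = m'" using W(3) a by blast
  qed (use T A e in auto)
  note inj = coordinate_ball_inj[OF T ball] and top = coordinate_ball_topspace[OF T ball]
    and inv = coordinate_ball_inv[OF T ball]
  have notBad: "e m v \<notin> Bad" if "m \<in> A" "v \<in> vdisc ?d" for m v
    using e(3)[OF that(1)] that(2) by auto
  \<comment> \<open>If a point lies in \<open>V\<close>, each of its translates is within radius 1/4
    of the corresponding translate of \<open>p\<close>. This controls all orbits along
    \<open>\<xi>\<close>.\<close>
  define V where "V = {x \<in> topspace T. \<forall>h\<in>C. \<phi> h x \<in> e (\<phi> h p) ` vball ?d (1 / 4)}"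
  have hA: "\<phi> h p \<in> A" if "h \<in> C" for h using that by (simp add: A_def orb[OF p])
  have oV: "openin T V"
  proof -
    have "V = (\<Inter>h\<in>C. {x \<in> topspace T. \<phi> h x \<in> e (\<phi> h p) ` vball ?d (1 / 4)})"
      using k(1) by (auto simp: V_def)
    moreover have "openin T {x \<in> topspace T. \<phi> h x \<in> e (\<phi> h p) ` vball ?d (1 / 4)}" if "h \<in> C" for h
    proof (rule openin_continuous_map_preimage[OF \<phi>[OF that]])
      show "openin T (e (\<phi> h p) ` vball ?d (1 / 4))"
        using ball[OF hA[OF that]] by (simp add: coordinate_ball_def)
    qed
    ultimately show ?thesis using C k(1) by (auto intro!: openin_Inter)
  qed
  have "p \<in> V"
  proof -
    have "\<phi> h p \<in> e (\<phi> h p) ` vball ?d (1 / 4)" if "h \<in> C" for h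
      using center[OF hA[OF that]] by (intro image_eqI[of _ _ "\<lambda>_. 0"]) (auto simp: vball_def)
    then show ?thesis using p by (simp add: V_def)
  qed
  then obtain \<delta>' where \<delta>': "\<delta>' > 0" "\<delta>' \<le> 1" "e p ` vball ?d \<delta>' \<subseteq> V"
    using coordinate_ball_nhd[OF T ball[OF A(3)] oV] center[OF A(3)] by metis
  \<comment> \<open>\<open>C\<close> is not assumed to contain a map acting as the identity, so the
    bound 1/4 on \<open>\<kappa>\<close> is imposed directly.\<close>
  define \<delta> where "\<delta> = min \<delta>' (1 / 4)"
  have "vball ?d \<delta> \<subseteq> vball ?d \<delta>'" by (auto simp: vball_def \<delta>_def)
  then have \<delta>: "\<delta> > 0" "\<delta> \<le> 1" "e p ` vball ?d \<delta> \<subseteq> V"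
    using \<delta>' by (auto simp: \<delta>_def)
  have "openin T (e p ` vball ?d \<delta>)" using ball[OF A(3)] \<delta>(2) by (simp add: coordinate_ball_def)
  moreover have "p \<in> e p ` vball ?d \<delta>"
    using center[OF A(3)] \<delta>(1) by (intro image_eqI[of _ _ "\<lambda>_. 0"]) (auto simp: vball_def)
  ultimately obtain \<kappa> where \<kappa>: "\<kappa> \<in> vball ?d \<delta>" "\<phi> k (e p \<kappa>) \<noteq> e p \<kappa>"
    using moved by blast
  have "e p \<kappa> \<in> V" using \<kappa>(1) \<delta>(3) by blast
  then have VC: "\<phi> h (e p \<kappa>) \<in> e (\<phi> h p) ` vball ?d (1 / 4)" if "h \<in> C" for h
    using that by (simp add: V_def)
  \<comment> \<open>\<open>k\<close> fixes \<open>p\<close>, so the moved point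
    \<open>e p \<kappa>\<close> and its translate lie in the same ball. The coordinates
    \<open>\<alpha>\<close> of the translate become the centre of the inversion.\<close>
  obtain \<alpha> where \<alpha>: "\<alpha> \<in> vball ?d (1 / 4)" "\<phi> k (e p \<kappa>) = e p \<alpha>"
    using VC[OF k(1)] k(2) by auto
  have \<kappa>d: "\<kappa> \<in> vdisc ?d" using \<kappa>(1) \<delta>(2) vball_subset by blast
  have \<kappa>4: "\<kappa> \<in> vball ?d (1 / 4)" using \<kappa>(1) by (auto simp: vball_def \<delta>_def)
  have \<alpha>v: "\<alpha> \<in> vspace ?d" "enorm ?d \<alpha> < 1 / 4" and \<kappa>v: "\<kappa> \<in> vspace ?d" "enorm ?d \<kappa> < 1 / 4"
    using \<alpha> \<kappa>4 by (auto simp: vball_def)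
  define \<xi> where "\<xi> s = e p (\<lambda>i. \<kappa> i * s)" for s :: real
  have \<xi>ball: "(\<lambda>i. \<kappa> i * s) \<in> vball ?d \<delta>" if "s \<in> {0..1}" for s
  proof -
    have "enorm ?d (\<lambda>i. \<kappa> i * s) = enorm ?d \<kappa> * s"
      using L2_set_scale[of s \<kappa> "{..<?d}"] that by (simp add: mult.commute)
    also have "\<dots> \<le> enorm ?d \<kappa>" using that L2_set_nonneg[of \<kappa> "{..<?d}"] by (simp add: mult_left_le)
    finally show ?thesis using \<kappa>(1) by (simp add: vball_def)
  qed
  have \<xi>c: "continuous_map unit_interval T \<xi>"
  proof -
    have "continuous_map unit_interval (Euclidean_space ?d) (\<lambda>s i. \<kappa> i * s)"
      by (intro continuous_map_vscale continuous_map_const[THEN iffD2])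
        (auto simp: \<kappa>v intro: continuous_map_from_unit_interval)
    then have "continuous_map unit_interval (subtopology (Euclidean_space ?d) (vdisc ?d)) (\<lambda>s i. \<kappa> i * s)"
      using \<xi>ball subsetD[OF vball_subset[OF \<delta>(2)]] by (intro continuous_map_into_subtopology) auto
    from continuous_map_compose'[OF coordinate_ball_continuous[OF ball[OF A(3)]] this] show ?thesis
      unfolding \<xi>_def .
  qed
  have \<xi>0: "\<xi> 0 = p" using center[OF A(3)] by (simp add: \<xi>_def)
  have \<xi>1: "\<xi> 1 = e p \<kappa>" by (simp add: \<xi>_def)
  have \<xi>T: "\<xi> s \<in> topspace T" if "s \<in> {0..1}" for s
    using continuous_map_funspace[OF \<xi>c] that by auto
  have S\<xi>: "\<exists>m\<in>A. \<exists>v\<in>vball ?d (1 / 4). y = e m v" if s: "s \<in> {0..1}" "y \<in> orb (\<xi> s)" for s y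
  proof -
    obtain h where h: "h \<in> C" "y = \<phi> h (\<xi> s)" using s(2) orb[OF \<xi>T[OF s(1)]] by auto
    have "\<xi> s \<in> V" using \<xi>ball[OF s(1)] \<delta>(3) by (auto simp: \<xi>_def)
    then have "\<phi> h (\<xi> s) \<in> e (\<phi> h p) ` vball ?d (1 / 4)" using h(1) by (simp add: V_def)
    then show ?thesis using h(2) hA[OF h(1)] by blast
  qed
  have S\<xi>Bad: "orb (\<xi> s) \<inter> Bad = {}" if "s \<in> {0..1}" for s
  proof -
    have "y \<notin> Bad" if y: "y \<in> orb (\<xi> s)" for y
    proof -
      obtain m v where mv: "m \<in> A" "v \<in> vball ?d (1 / 4)" "y = e m v"
        using S\<xi>[OF \<open>s \<in> {0..1}\<close> y] by blast
      have "v \<in> vdisc ?d" using mv(2) vball_subset[of "1 / 4" ?d] by auto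
      then show ?thesis using notBad[OF mv(1)] mv(3) by simp
    qed
    then show ?thesis by blast
  qed
  let ?G = "sphere_inversion ?d \<alpha>" and ?H = "sphere_inversion_inv ?d \<alpha>"
  define Gm where "Gm y = (if y \<in> e p ` vdisc ?d then ?G (inv_into (vdisc ?d) (e p) y) else (\<lambda>_. 0))" for y
  have Gm_e: "Gm (e p v) = ?G v" if "v \<in> vdisc ?d" for v
    using that inv[OF A(3) that] by (simp add: Gm_def)
  \<comment> \<open>The origin of the radius 3/4: as \<open>\<alpha>\<close> has norm below 1/4, the
    inverted ball lies in the unit ball, and the inversion matches the value 0 used for the
    collapse.\<close>
  have Gbd: "?G v = (\<lambda>_. 0)" if "v \<in> vspace ?d" "enorm ?d v \<ge> 1" for v
    using that \<alpha>v enorm_triangle_diff[of v ?d \<alpha>] by (intro sphere_inversion_outside) auto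
  have Gm_cont: "continuous_map (subtopology T (- {e p \<alpha>})) (Euclidean_space ?d) Gm"
    unfolding Gm_def
  proof (rule continuous_map_extend_coordinate_ball[OF T ball[OF A(3)]])
    show "continuous_map (subtopology (Euclidean_space ?d) (vdisc ?d \<inter> - {\<alpha>})) (Euclidean_space ?d) ?G"
      by (rule continuous_map_from_subtopology_mono[OF continuous_map_sphere_inversion[OF \<alpha>v(1)]]) auto
  qed (use Gbd in \<open>auto simp: vdisc_def\<close>)
  have Gm_space: "Gm y \<in> vspace ?d" for y
  proof (cases "y \<in> e p ` vdisc ?d")
    case True
    then show ?thesis using Gm_e sphere_inversion_in_vspace[OF \<alpha>v(1)] vdisc_vspace by auto
  qed (simp add: Gm_def)
  define v0 where "v0 = ?G \<kappa>"
  have \<alpha>\<kappa>: "\<alpha> \<noteq> \<kappa>" using \<kappa>(2) \<alpha>(2) by auto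
  have v0v: "v0 \<in> vspace ?d" unfolding v0_def by (rule sphere_inversion_in_vspace[OF \<alpha>v(1) \<kappa>v(1)])
  \<comment> \<open>\<open>\<kappa>\<close> and \<open>\<alpha>\<close> are distinct and of norm
    below 1/4, so their distance is below 1/2 and \<open>\<kappa>\<close> lies strictly inside the
    inverted ball.\<close>
  have v0n: "v0 \<noteq> (\<lambda>_. 0)"
  proof
    let ?n = "enorm ?d (\<lambda>i. \<kappa> i - \<alpha> i)"
    assume 0: "v0 = (\<lambda>_. 0)"
    have ne: "(\<lambda>i. \<kappa> i - \<alpha> i) \<noteq> (\<lambda>_. 0)"
    proof
      assume "(\<lambda>i. \<kappa> i - \<alpha> i) = (\<lambda>_. 0)"
      then have "\<kappa> i - \<alpha> i = 0" for i by (rule fun_cong)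
      then show False using \<alpha>\<kappa> by (simp add: fun_eq_iff)
    qed
    have n: "?n > 0" "?n < 3 / 4"
      using enorm_pos[OF _ ne] \<kappa>v \<alpha>v enorm_diff_le[of \<kappa> \<alpha> ?d] by auto
    then have "max 0 (3 / 4 / ?n - 1) / ?n > 0" by (simp add: field_simps)
    moreover define c where "c = max 0 (3 / 4 / ?n - 1) / ?n"
    ultimately have "c > 0" by (simp only:)
    then have c: "c \<noteq> 0" by simp
    have "(\<kappa> i - \<alpha> i) * c = 0" for i
      using fun_cong[OF 0, of i] by (simp only: v0_def sphere_inversion_def c_def)
    then have "\<kappa> i - \<alpha> i = 0" for i using c by simp
    then show False using ne by simp
  qed
  have v0p: "enorm ?d v0 > 0" by (rule enorm_pos[OF v0v v0n])
  \<comment> \<open>Nonzero values come only from the part where the inversion is injective.\<close>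
  have Gm_v0: "y = e p \<kappa>" if "Gm y = v0" for y
  proof -
    have yD: "y \<in> e p ` vdisc ?d" using that v0n by (auto simp: Gm_def)
    then obtain v where v: "v \<in> vdisc ?d" "y = e p v" by blast
    then have "?G v = v0" using that Gm_e by simp
    then have "v = \<kappa>"
      using sphere_inversion_inverse[OF \<alpha>v(1) vdisc_vspace[OF v(1)]]
        sphere_inversion_inverse[OF \<alpha>v(1) \<kappa>v(1)] v0n by (simp add: v0_def)
    then show ?thesis using v by simp
  qed
  \<comment> \<open>All but finitely many radii give a sphere about \<open>v0\<close> that avoids the orbit of \<open>\<xi> 1\<close>; radii close to
    the norm of \<open>v0\<close> put the base point far from \<open>p\<close>.\<close>
  have "finite ((\<lambda>y. enorm ?d (\<lambda>i. Gm y i - v0 i)) ` orb (\<xi> 1))" using orb_finite[OF \<xi>T] by simp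
  moreover have "infinite {max 0 (enorm ?d v0 - 1 / 2) <..< enorm ?d v0}"
    using v0p by (intro infinite_Ioo) auto
  ultimately have "\<not> {max 0 (enorm ?d v0 - 1 / 2) <..< enorm ?d v0}
      \<subseteq> (\<lambda>y. enorm ?d (\<lambda>i. Gm y i - v0 i)) ` orb (\<xi> 1)"
    using finite_subset by blast
  then obtain r where r: "r > 0" "r > enorm ?d v0 - 1 / 2" "r < enorm ?d v0"
    and rG: "\<And>y. y \<in> orb (\<xi> 1) \<Longrightarrow> enorm ?d (\<lambda>i. Gm y i - v0 i) \<noteq> r"
    by fastforce
  \<comment> \<open>The direction from \<open>v0\<close> to the origin. The base point of the sphere
    is then its point nearest to 0, and a small norm after the inversion means a large distance from
    \<open>\<alpha>\<close> before it.\<close>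
  define n0 where "n0 i = - (v0 i / enorm ?d v0)" for i
  have n0: "n0 \<in> topspace (nsphere q)"
  proof -
    have n0': "n0 = (\<lambda>i. (- 1 / enorm ?d v0) * v0 i)" by (simp add: n0_def fun_eq_iff)
    have "enorm ?d n0 = 1" unfolding n0' L2_set_scale using v0p by simp
    moreover have "n0 \<in> vspace ?d" unfolding n0' by (rule vspace_ops(4)[OF v0v])
    ultimately show ?thesis by (simp add: nsphere_L2_set)
  qed
  obtain \<omega> where \<omega>c: "continuous_map (cube q) (nsphere q) \<omega>"
    and \<omega>b: "\<And>z. z \<in> cube_boundary q \<Longrightarrow> \<omega> z = n0"
    and \<omega>e: "\<And>r w. r > 0 \<Longrightarrow> \<not> homotopic_with (\<lambda>f. \<exists>c. \<forall>z\<in>cube_boundary q. f z = c) (cube q)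
      (punctured_space ?d) (\<lambda>z i. r * \<omega> z i) (\<lambda>z. w)"
    by (rule essential_cube_map_exists[OF q n0]) (rule that)
  have \<omega>s: "\<omega> z \<in> vspace ?d \<and> enorm ?d (\<omega> z) = 1" if "z \<in> topspace (cube q)" for z
    using continuous_map_funspace[OF \<omega>c] that by (auto simp: nsphere_L2_set)
  let ?w = "\<lambda>z i. v0 i + \<omega> z i * r"
  \<comment> \<open>The radius is smaller than the norm of \<open>v0\<close>, so the sphere misses
    0, the one value at which the inversion has no inverse.\<close>
  have ws: "?w z \<in> vspace ?d" "?w z \<noteq> (\<lambda>_. 0)" if "z \<in> topspace (cube q)" for z
  proof -
    show "?w z \<in> vspace ?d" using v0v \<omega>s[OF that] by (intro vspace_ops) auto
    have rw: "enorm ?d (\<lambda>i. \<omega> z i * r) = r"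
      using L2_set_scale[of r "\<omega> z" "{..<?d}"] \<omega>s[OF that] r(1) by (simp add: mult.commute)
    show "?w z \<noteq> (\<lambda>_. 0)"
    proof
      assume "?w z = (\<lambda>_. 0)"
      then have "v0 i + \<omega> z i * r = 0" for i by (rule fun_cong)
      then have "v0 i = - (\<omega> z i * r)" for i by (simp add: eq_neg_iff_add_eq_0)
      then have "enorm ?d v0 = enorm ?d (\<lambda>i. - (\<omega> z i * r))" by presburger
      then show False using r(3) rw enorm_uminus[of "\<lambda>i. \<omega> z i * r" ?d] by simp
    qed
  qed
  have Hd: "?H w \<in> vdisc ?d" if "w \<in> vspace ?d" "w \<noteq> (\<lambda>_. 0)" for w
  proof -
    have "enorm ?d (\<lambda>i. ?H w i - \<alpha> i) = 3 / 4 / (1 + enorm ?d w)"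
      by (rule enorm_sphere_inversion_inv[OF \<alpha>v(1) that])
    also have "\<dots> \<le> 3 / 4" using L2_set_nonneg[of w "{..<?d}"] by (simp add: divide_le_eq)
    finally have "enorm ?d (?H w) \<le> 1" using enorm_triangle_diff[of "?H w" ?d \<alpha>] \<alpha>v by simp
    then show ?thesis using sphere_inversion_inv_in_vspace[OF \<alpha>v(1) that(1)] by (simp add: vdisc_def)
  qed
  define \<sigma> where "\<sigma> z = e p (?H (?w z))" for z
  define \<eta> where "\<eta> = ?H (\<lambda>i. v0 i * (1 - r / enorm ?d v0))"
  define y0 where "y0 = e p \<eta>"
  have \<sigma>y0: "\<sigma> z = y0" if "z \<in> cube_boundary q" for z
  proof -
    have "?w z = (\<lambda>i. v0 i * (1 - r / enorm ?d v0))"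
      unfolding \<omega>b[OF that] n0_def by (simp add: fun_eq_iff algebra_simps)
    then show ?thesis by (simp add: \<sigma>_def y0_def \<eta>_def)
  qed
  have sc: "1 - r / enorm ?d v0 > 0" using r v0p by simp
  let ?\<eta>w = "\<lambda>i. v0 i * (1 - r / enorm ?d v0)"
  have \<eta>w: "?\<eta>w \<in> vspace ?d" "enorm ?d ?\<eta>w = enorm ?d v0 - r"
  proof -
    show "?\<eta>w \<in> vspace ?d" by (rule vspace_ops(3)[OF v0v])
    have "enorm ?d ?\<eta>w = (1 - r / enorm ?d v0) * enorm ?d v0"
      using L2_set_scale[of "1 - r / enorm ?d v0" v0 "{..<?d}"] sc by (simp add: mult.commute)
    then show "enorm ?d ?\<eta>w = enorm ?d v0 - r" using v0p by (simp add: algebra_simps)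
  qed
  have \<eta>wn: "?\<eta>w \<noteq> (\<lambda>_. 0)"
  proof
    assume "?\<eta>w = (\<lambda>_. 0)"
    then have "enorm ?d ?\<eta>w = 0" by (simp only: enorm_zero)
    then show False using \<eta>w(2) r by simp
  qed
  have \<eta>d: "\<eta> \<in> vdisc ?d" unfolding \<eta>_def by (rule Hd[OF \<eta>w(1) \<eta>wn])
  \<comment> \<open>The lower bound on \<open>r\<close> gives an image of norm below 1/2, hence
    distance above \<open>(3/4) / (3/2) = 1/2\<close> from \<open>\<alpha>\<close>; subtracting the
    norm of \<open>\<alpha>\<close> leaves more than 1/4.\<close>
  have \<eta>n: "enorm ?d \<eta> > 1 / 4"
  proof -
    have "enorm ?d (\<lambda>i. \<eta> i - \<alpha> i) = 3 / 4 / (1 + (enorm ?d v0 - r))"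
      unfolding \<eta>_def enorm_sphere_inversion_inv[OF \<alpha>v(1) \<eta>w(1) \<eta>wn] \<eta>w(2) ..
    also have "\<dots> > 1 / 2" using r by (simp add: field_simps)
    finally show ?thesis using enorm_diff_le[of \<eta> \<alpha> ?d] \<alpha>v by simp
  qed
  have y0S: "y0 \<notin> orb (\<xi> s) \<union> Bad" if s: "s \<in> {0..1}" for s
  proof -
    have "y0 \<notin> orb (\<xi> s)"
    proof
      assume "y0 \<in> orb (\<xi> s)"
      then obtain m v where mv: "m \<in> A" "v \<in> vball ?d (1 / 4)" "y0 = e m v" using S\<xi>[OF s] by blast
      then have vd: "v \<in> vdisc ?d" using vball_subset[of "1 / 4" ?d] by auto
      then have "m = p" using disjoint[OF mv(1) A(3) vd \<eta>d] mv(3) by (simp add: y0_def)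
      then have "v = \<eta>" using inj[OF A(3) vd \<eta>d] mv(3) by (simp add: y0_def)
      then show False using \<eta>n mv(2) by (simp add: vball_def)
    qed
    then show ?thesis using notBad[OF A(3) \<eta>d] by (simp add: y0_def)
  qed
  let ?X = "subtopology T (- (orb (\<xi> 1) \<union> Bad))"
  have Gm\<sigma>: "Gm (\<sigma> z) = ?w z" if "z \<in> topspace (cube q)" for z
    unfolding \<sigma>_def Gm_e[OF Hd[OF ws[OF that]]] by (rule sphere_inversion_right_inverse[OF \<alpha>v(1) ws[OF that]])
  have \<sigma>S: "\<sigma> z \<notin> orb (\<xi> 1) \<union> Bad" if "z \<in> topspace (cube q)" for z
  proof -
    have "enorm ?d (\<lambda>i. Gm (\<sigma> z) i - v0 i) = enorm ?d (\<lambda>i. r * \<omega> z i)"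
      unfolding Gm\<sigma>[OF that] by (simp add: mult.commute)
    also have "\<dots> = r" unfolding L2_set_scale using \<omega>s[OF that] r(1) by simp
    finally have "\<sigma> z \<notin> orb (\<xi> 1)" using rG by blast
    then show ?thesis using notBad[OF A(3) Hd[OF ws[OF that]]] by (simp add: \<sigma>_def)
  qed
  have \<omega>E: "continuous_map (cube q) (Euclidean_space ?d) \<omega>"
    using \<omega>c unfolding nsphere_def by (rule continuous_map_into_fulltopology)
  have wc: "continuous_map (cube q) (punctured_space ?d) ?w"
    using ws by (intro continuous_map_into_subtopology continuous_map_vtranslate continuous_map_vscale
        \<omega>E v0v) auto
  have "continuous_map (cube q) (subtopology (Euclidean_space ?d) (vdisc ?d)) (\<lambda>z. ?H (?w z))"
    using Hd ws by (intro continuous_map_into_subtopology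
        continuous_map_compose'[OF continuous_map_sphere_inversion_inv[OF \<alpha>v(1)] wc]) auto
  from continuous_map_compose'[OF coordinate_ball_continuous[OF ball[OF A(3)]] this]
  have \<sigma>T: "continuous_map (cube q) T \<sigma>" unfolding \<sigma>_def .
  have \<sigma>m: "\<sigma> \<in> based_maps q ?X y0"
    using \<sigma>S \<sigma>y0 by (auto simp: based_maps_def intro!: continuous_map_into_subtopology \<sigma>T)
  have SpA: "orb p \<union> Bad = A \<union> Bad" by (simp add: A_def)
  let ?Y = "subtopology T (- (A \<union> Bad))"
  define P where "P = (\<lambda>(s::real, y). push (s / 4) y)"
  \<comment> \<open>Stated for an arbitrary change of time, since both the push up to radius 1/4 and
    the push from there to radius 1 are instances.\<close>
  have pushc: "continuous_map (prod_topology unit_interval ?Y) ?Y (\<lambda>w. push (f (fst w)) (snd w))"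
    if f: "continuous_map unit_interval unit_interval f" for f
  proof (rule continuous_map_into_subtopology)
    have s: "continuous_map (prod_topology unit_interval ?Y) (subtopology T (- A)) snd"
    proof (rule continuous_map_compose'[OF _ continuous_map_snd, where g = "\<lambda>y. y"])
      have "continuous_map ?Y T (\<lambda>y. y)" by (rule continuous_map_from_subtopology) simp
      then show "continuous_map ?Y (subtopology T (- A)) (\<lambda>y. y)"
        by (rule continuous_map_into_subtopology) auto
    qed
    have f1: "continuous_map (prod_topology unit_interval ?Y) unit_interval (\<lambda>w. f (fst w))"
      by (rule continuous_map_compose'[OF f continuous_map_fst])
    show "continuous_map (prod_topology unit_interval ?Y) T (\<lambda>w. push (f (fst w)) (snd w))"
      using continuous_map_compose'[OF continuous_map_push continuous_map_pairedI[OF f1 s]] by simp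
    have "f (fst w) \<le> 1" if "w \<in> topspace (prod_topology unit_interval ?Y)" for w
      using continuous_map_funspace[OF f] that by fastforce
    then show "(\<lambda>w. push (f (fst w)) (snd w)) \<in> topspace (prod_topology unit_interval ?Y) \<rightarrow> - (A \<union> Bad)"
      using push_preserves[of _ _ Bad] notBad by fastforce
  qed
  have away: "push w y \<notin> orb (\<xi> s) \<union> Bad"
    if s: "s \<in> {0..1}" "w \<in> {1/4..1}" "y \<notin> A \<union> Bad" for s w y
  proof -
    have "push w y \<notin> orb (\<xi> s)"
    proof
      assume "push w y \<in> orb (\<xi> s)"
      then obtain m v where "m \<in> A" "v \<in> vball ?d (1 / 4)" "push w y = e m v" using S\<xi>[OF s(1)] by blast
      then show False
        using push_away[of y w m v] s vball_subset[of "1 / 4" ?d] by (auto simp: vball_def)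
    qed
    then show ?thesis using push_preserves[of y w Bad] notBad s by auto
  qed
  have quarter: "continuous_map unit_interval unit_interval (\<lambda>s. s / 4)"
    by (auto intro!: continuous_map_into_unit_interval continuous_intros)
  have Pc: "continuous_map (prod_topology unit_interval ?Y) ?Y P"
    using pushc[OF quarter] unfolding P_def case_prod_unfold .
  have P0: "P (0, y) = y" if "y \<notin> A \<union> Bad" for y using push_zero[of y] that by (simp add: P_def)
  have Py0: "P (s, y0) = y0" if "s \<in> {0..1}" for s
  proof -
    have "stretch (s / 4) \<eta> = \<eta>" using that \<eta>n by (intro stretch_trivial) auto
    then show ?thesis using push_ball[OF A(3) \<eta>d] by (simp add: P_def y0_def)
  qed
  have final: False
    if \<tau>: "\<tau> \<in> based_maps q ?Y y0" and hom: "(\<sigma>, \<lambda>z. P (1, \<tau> z)) \<in> based_homotopy q ?X y0" for \<tau>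
  proof -
    define Q where "Q y = (\<lambda>i. Gm y i - v0 i)" for y
    \<comment> \<open>The orbit removed from \<open>?X\<close> contains the pole
      \<open>e p \<alpha>\<close> of the inversion and \<open>e p \<kappa>\<close>, the only point
      that goes to \<open>v0\<close>. Hence \<open>Q\<close> is continuous on \<open>?X\<close> and
      never 0.\<close>
    have "e p \<alpha> \<in> orb (\<xi> 1)" using \<alpha>(2) k(1) orb[OF \<xi>T[of 1]] unfolding \<xi>1 by force
    then have XG: "continuous_map ?X (Euclidean_space ?d) Gm"
      by (intro continuous_map_from_subtopology_mono[OF Gm_cont]) auto
    have "e p \<kappa> \<in> orb (\<xi> 1)"
      using orb_self[OF \<xi>T[of 1]] unfolding \<xi>1 by simp
    then have ne: "Q y \<noteq> (\<lambda>_. 0)" if "y \<in> topspace ?X" for y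
    proof -
      have "Gm y \<noteq> v0" using Gm_v0[of y] \<open>e p \<kappa> \<in> orb (\<xi> 1)\<close> that by auto
      then show ?thesis by (auto simp: Q_def fun_eq_iff)
    qed
    have Qc: "continuous_map ?X (punctured_space ?d) Q"
      unfolding Q_def
      using ne by (intro continuous_map_into_subtopology continuous_map_vsubtract[OF XG v0v])
        (auto simp: Q_def)
    \<comment> \<open>A weaker property than being based: the push beyond radius 1/4 moves
      \<open>y0\<close>, so the boundary is only required to go to a single point at each
      time.\<close>
    let ?P = "\<lambda>f::(nat \<Rightarrow> real) \<Rightarrow> nat \<Rightarrow> real. \<exists>c. \<forall>z\<in>cube_boundary q. f z = c"
    have P_cong: "?P f = ?P g" if "\<And>z. z \<in> topspace (cube q) \<Longrightarrow> f z = g z" for f g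
      using that cube_boundary_subset by metis
    have "(\<lambda>z. Q (\<sigma> z), \<lambda>z. Q (P (1, \<tau> z))) \<in> based_homotopy q (punctured_space ?d) (Q y0)"
      by (rule based_homotopy_compose[OF hom Qc])
    then have "homotopic_with (\<lambda>h. \<forall>z\<in>cube_boundary q. h z = Q y0) (cube q) (punctured_space ?d)
        (\<lambda>z. Q (\<sigma> z)) (\<lambda>z. Q (P (1, \<tau> z)))"
      by (simp add: based_homotopy_def)
    then have 1: "homotopic_with ?P (cube q) (punctured_space ?d) (\<lambda>z. Q (\<sigma> z)) (\<lambda>z. Q (P (1, \<tau> z)))"
      by (rule homotopic_with_mono) blast
    have 0: "homotopic_with ?P (cube q) (punctured_space ?d) (\<lambda>z i. r * \<omega> z i) (\<lambda>z. Q (\<sigma> z))"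
    proof (rule homotopic_with_equal)
      show eq: "(\<lambda>i. r * \<omega> z i) = Q (\<sigma> z)" if "z \<in> topspace (cube q)" for z
        unfolding Q_def Gm\<sigma>[OF that] by (simp add: mult.commute)
      show "?P (\<lambda>z. Q (\<sigma> z))" using \<sigma>y0 by auto
      show "?P (\<lambda>z i. r * \<omega> z i)"
        by (intro exI[of _ "Q y0"] ballI) (simp only: eq[OF cube_boundary_subset] \<sigma>y0)
      show "continuous_map (cube q) (punctured_space ?d) (\<lambda>z i. r * \<omega> z i)"
        by (rule continuous_map_eq[where f = "\<lambda>z. Q (\<sigma> z)"])
          (use homotopic_with_imp_continuous_maps[OF 1] eq in auto)
    qed
    have \<tau>c: "continuous_map (cube q) ?Y \<tau>" and \<tau>y0: "\<And>z. z \<in> cube_boundary q \<Longrightarrow> \<tau> z = y0"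
      using \<tau> by (auto simp: based_maps_def)
    have \<tau>Y: "\<tau> z \<notin> A \<union> Bad \<and> \<tau> z \<in> topspace T" if "z \<in> topspace (cube q)" for z
      using continuous_map_funspace[OF \<tau>c] that by auto
    \<comment> \<open>Radii from 1/4, where \<open>P (1, \<tau> z)\<close> stands, up to 1.\<close>
    let ?g = "\<lambda>s::real. (1 + 3 * s) / 4"
    have g: "continuous_map unit_interval unit_interval ?g"
      by (auto intro!: continuous_map_into_unit_interval continuous_intros)
    have pYX: "continuous_map (cylinder q) ?X (\<lambda>w. push (?g (fst w)) (\<tau> (snd w)))"
    proof (rule continuous_map_into_subtopology)
      have "continuous_map (cylinder q) (prod_topology unit_interval ?Y)
          (\<lambda>w. (fst w, \<tau> (snd w)))"
        by (intro continuous_map_pairedI continuous_map_fst continuous_map_compose'[OF \<tau>c continuous_map_snd])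
      from continuous_map_compose'[OF pushc[OF g] this]
      have "continuous_map (cylinder q) ?Y (\<lambda>w. push (?g (fst w)) (\<tau> (snd w)))"
        by simp
      then show "continuous_map (cylinder q) T (\<lambda>w. push (?g (fst w)) (\<tau> (snd w)))"
        by (rule continuous_map_into_fulltopology)
      show "(\<lambda>w. push (?g (fst w)) (\<tau> (snd w))) \<in> topspace (cylinder q)
          \<rightarrow> - (orb (\<xi> 1) \<union> Bad)"
      proof
        fix w assume "w \<in> topspace (cylinder q)"
        then have "?g (fst w) \<in> {1/4..1}" "\<tau> (snd w) \<notin> A \<union> Bad" using \<tau>Y by auto
        then show "push (?g (fst w)) (\<tau> (snd w)) \<in> - (orb (\<xi> 1) \<union> Bad)"
          using away[of 1] by auto
      qed
    qed
    have 2: "homotopic_with ?P (cube q) (punctured_space ?d) (\<lambda>z. Q (P (1, \<tau> z))) (\<lambda>z i. - v0 i)"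
    proof (subst homotopic_with[OF P_cong], assumption, intro exI conjI ballI)
      show "continuous_map (cylinder q) (punctured_space ?d)
          (\<lambda>w. Q (push (?g (fst w)) (\<tau> (snd w))))"
        by (rule continuous_map_compose'[OF Qc pYX])
      fix z assume z: "z \<in> topspace (cube q)"
      show "Q (push (?g (fst (0, z))) (\<tau> (snd (0::real, z)))) = Q (P (1, \<tau> z))"
        by (simp add: P_def)
      \<comment> \<open>At radius 1 nothing is left in the open ball about \<open>p\<close>, so the
        collapse makes the map constant.\<close>
      have "Gm (push 1 (\<tau> z)) = (\<lambda>_. 0)"
      proof (cases "push 1 (\<tau> z) \<in> e p ` vdisc ?d")
        case True
        then obtain v where v: "v \<in> vdisc ?d" "push 1 (\<tau> z) = e p v" by blast
        then have "\<not> enorm ?d v < 1" using push_away[of "\<tau> z" 1 p v] A(3) \<tau>Y[OF z] by auto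
        then show ?thesis using v Gm_e Gbd[OF vdisc_vspace[OF v(1)]] by simp
      qed (simp add: Gm_def)
      then show "Q (push (?g (fst (1, z))) (\<tau> (snd (1::real, z)))) = (\<lambda>i. - v0 i)"
        by (simp add: Q_def)
    qed (use \<tau>y0 in auto)
    show False
      using \<omega>e[OF r(1)] homotopic_with_trans[OF homotopic_with_trans[OF 0 1] 2] by blast
  qed
  show thesis
  proof (rule that[OF \<xi>c \<xi>0 y0S S\<xi>Bad \<sigma>m])
    show "continuous_map (prod_topology unit_interval (subtopology T (- (orb p \<union> Bad))))
       (subtopology T (- (orb p \<union> Bad))) P" unfolding SpA by (rule Pc)
    show "P (0, y) = y" if "y \<notin> orb p \<union> Bad" for y
      using P0 that unfolding SpA by blast
    show "P (s, y0) = y0" if "s \<in> {0..1}" for s by (rule Py0[OF that])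
    show "P (1, y) \<notin> orb (\<xi> s) \<union> Bad" if "s \<in> {0..1}" "y \<notin> orb p \<union> Bad" for s y
      using away[of s "1/4" y] that unfolding SpA by (simp add: P_def)
    show "(\<sigma>, \<lambda>z. P (1, \<tau> z)) \<notin> based_homotopy q (subtopology T (- (orb (\<xi> 1) \<union> Bad))) y0"
      if "\<tau> \<in> based_maps q (subtopology T (- (orb p \<union> Bad))) y0" for \<tau>
      using final[of \<tau>] that unfolding SpA by blast
  qed
qed

end

section \<open>Configurations of points with distinct orbits\<close>

definition config_top :: "'a topology \<Rightarrow> ('a \<Rightarrow> 'a set) \<Rightarrow> nat \<Rightarrow> (nat \<Rightarrow> 'a) topology" where
  "config_top T orb n = subtopology (product_topology (\<lambda>_. T) {..<n})
     {x. \<forall>i<n. \<forall>j<n. i \<noteq> j \<longrightarrow> orb (x i) \<noteq> orb (x j)}"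

lemma topspace_config_top:
  "x \<in> topspace (config_top T orb n) \<longleftrightarrow> x \<in> (\<Pi>\<^sub>E i\<in>{..<n}. topspace T) \<and>
     (\<forall>i<n. \<forall>j<n. i \<noteq> j \<longrightarrow> orb (x i) \<noteq> orb (x j))"
  by (auto simp: config_top_def)

lemma continuous_map_into_config_top:
  assumes "\<And>i. i < n \<Longrightarrow> continuous_map X T (\<lambda>x. f x i)"
    and "\<And>x. x \<in> topspace X \<Longrightarrow> f x \<in> topspace (config_top T orb n)"
  shows "continuous_map X (config_top T orb n) f"
  unfolding config_top_def
proof (rule continuous_map_into_subtopology)
  show "continuous_map X (product_topology (\<lambda>_. T) {..<n}) f"
    unfolding continuous_map_componentwise
    using assms by (auto simp: topspace_config_top PiE_iff)
qed (use assms(2) in \<open>auto simp: topspace_config_top\<close>)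

lemma continuous_map_config_coord:
  "i < n \<Longrightarrow> continuous_map (config_top T orb n) T (\<lambda>x. x i)"
  unfolding config_top_def
  by (intro continuous_map_from_subtopology continuous_map_product_projection) auto

lemma based_homotopy_cong:
  assumes "(g, g') \<in> based_homotopy q X x"
    and "\<And>z. z \<in> topspace (cube q) \<Longrightarrow> g z = k z" "\<And>z. z \<in> topspace (cube q) \<Longrightarrow> g' z = k' z"
  shows "(k, k') \<in> based_homotopy q X x"
proof -
  have "(g, k) \<in> based_homotopy q X x" "(g', k') \<in> based_homotopy q X x"
    using assms based_homotopy_maps[OF assms(1)] by (auto intro: based_homotopy_eq)
  then show ?thesis
    using assms(1) by (meson based_homotopy_trans based_homotopy_sym)
qed

context orbit_space
begin

lemma distinct_orbits_exist:
  assumes "infinite (topspace T)" "p \<in> topspace T"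
  shows "\<exists>b :: nat \<Rightarrow> 'a. b 0 = p \<and> (\<forall>i<n. b i \<in> topspace T) \<and> (\<forall>i<n. \<forall>j<n. i \<noteq> j \<longrightarrow> orb (b i) \<noteq> orb (b j))"
proof (induction n)
  case 0
  show ?case by (intro exI[of _ "\<lambda>_. p"]) auto
next
  case (Suc n)
  then obtain b where b: "b 0 = p" "\<forall>i<n. b i \<in> topspace T"
    "\<forall>i<n. \<forall>j<n. i \<noteq> j \<longrightarrow> orb (b i) \<noteq> orb (b j)" by blast
  show ?case
  proof (cases "n = 0")
    case True
    then show ?thesis using assms(2) by (intro exI[of _ "\<lambda>_. p"]) auto
  next
    case False
    have "finite (\<Union>i<n. orb (b i))" using orb_finite b(2) by auto
    then obtain x where x: "x \<in> topspace T" "x \<notin> (\<Union>i<n. orb (b i))"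
      using assms(1) by (metis finite_subset subsetI)
    then have ne: "orb (b i) \<noteq> orb x" if "i < n" for i
      using orb_self[OF x(1)] that by auto
    show ?thesis
    proof (intro exI[of _ "b(n := x)"] conjI allI impI)
      fix i j assume "i < Suc n" "j < Suc n" "i \<noteq> j"
      then show "orb ((b(n := x)) i) \<noteq> orb ((b(n := x)) j)"
        using b(3) ne by (auto simp: less_Suc_eq dest: sym)
    qed (use b x False in auto)
  qed
qed

text \<open>Fibres over \<open>bs 0\<close> and \<open>bs 1\<close> are compared through homotopy
  fibres: the separating sphere is taken to the one over \<open>bs 0\<close> by adding the path
  back, replaced there by a sphere in the actual fibre, and the resulting homotopy returns to
  \<open>bs 1\<close> by appending the path again.\<close>

lemma configuration_projection_not_quasifibration:
  assumes q: "q > 0" and N: "N > 0"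
    and chart: "\<And>x. x \<in> topspace T \<Longrightarrow> \<exists>U \<psi>. x \<in> U \<and> is_chart T (Suc q) (U, \<psi>)"
    and p: "p \<in> topspace T" and k: "k \<in> C" "\<phi> k p = p"
    and moved: "\<And>W. openin T W \<Longrightarrow> p \<in> W \<Longrightarrow> \<exists>x\<in>W. \<phi> k x \<noteq> x"
  shows "\<not> quasifibration (config_top T orb (Suc N)) (config_top T orb N) (first_coords N)"
proof
  let ?E = "config_top T orb (Suc N)" and ?B = "config_top T orb N" and ?f = "first_coords N"
  assume quasi: "quasifibration ?E ?B ?f"
  \<comment> \<open>In a finite Hausdorff space \<open>p\<close> would be isolated, yet every
    neighbourhood of \<open>p\<close> contains a moved point. Orbits being finite, an infinite space
    has room for configurations.\<close>
  have inf: "infinite (topspace T)"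
  proof
    assume "finite (topspace T)"
    then have "closedin T (topspace T - {p})"
      using T by (intro closedin_Hausdorff_finite) auto
    then have "openin T {p}" using p by (simp add: openin_closedin_eq)
    then show False using moved[of "{p}"] k(2) by simp
  qed
  obtain b where b: "b 0 = p" "\<And>i. i < N \<Longrightarrow> b i \<in> topspace T"
    "\<And>i j. i < N \<Longrightarrow> j < N \<Longrightarrow> i \<noteq> j \<Longrightarrow> orb (b i) \<noteq> orb (b j)"
    using distinct_orbits_exist[OF inf p] by metis
  define Bad where "Bad = (\<Union>j\<in>{0<..<N}. orb (b j))"
  have Bad1: "finite Bad" using orb_finite b(2) by (auto simp: Bad_def)
  have orb_Bad: "y \<in> Bad \<longleftrightarrow> (\<exists>j. 0 < j \<and> j < N \<and> orb (b j) = orb y)" if "y \<in> topspace T" for y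
  proof -
    have "y \<in> orb (b j) \<longleftrightarrow> orb (b j) = orb y" if "j < N" for j
      using orb_eq[OF b(2)[OF that] \<open>y \<in> topspace T\<close>] by blast
    then show ?thesis by (auto simp: Bad_def)
  qed
  have Bad_sat: "orb x \<inter> Bad = {} \<longleftrightarrow> x \<notin> Bad" if x: "x \<in> topspace T" for x
  proof
    show "x \<notin> Bad" if "orb x \<inter> Bad = {}" using orb_self[OF x] that by blast
    assume nx: "x \<notin> Bad"
    have "y \<notin> Bad" if y: "y \<in> orb x" for y
    proof -
      have "y \<in> topspace T" using orb_subset[OF x] y by blast
      moreover have "orb x = orb y" using orb_eq[OF x \<open>y \<in> topspace T\<close>] y by blast
      ultimately show ?thesis using orb_Bad nx x by simp
    qed
    then show "orb x \<inter> Bad = {}" by blast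
  qed
  have "p \<notin> Bad" using orb_Bad[OF p] b(3)[of _ 0] b(1) N by auto
  then have Bad2: "Bad \<inter> orb p = {}" using Bad_sat[OF p] by blast
  let ?Y = "subtopology T (- (orb p \<union> Bad))"
  obtain \<xi> \<sigma> y0 P where \<xi>c: "continuous_map unit_interval T \<xi>" and \<xi>0: "\<xi> 0 = p"
    and y0: "\<And>s. s \<in> {0..1} \<Longrightarrow> y0 \<notin> orb (\<xi> s) \<union> Bad"
    and \<xi>Bad': "\<And>s. s \<in> {0..1} \<Longrightarrow> orb (\<xi> s) \<inter> Bad = {}"
    and \<sigma>: "\<sigma> \<in> based_maps q (subtopology T (- (orb (\<xi> 1) \<union> Bad))) y0"
    and Pc: "continuous_map (prod_topology unit_interval ?Y) ?Y P"
    and P0: "\<And>y. y \<notin> orb p \<union> Bad \<Longrightarrow> P (0, y) = y"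
    and Py0: "\<And>s. s \<in> {0..1} \<Longrightarrow> P (s, y0) = y0"
    and P1: "\<And>s y. s \<in> {0..1} \<Longrightarrow> y \<notin> orb p \<union> Bad \<Longrightarrow> P (1, y) \<notin> orb (\<xi> s) \<union> Bad"
    and sep: "\<And>\<tau>. \<tau> \<in> based_maps q ?Y y0 \<Longrightarrow>
       (\<sigma>, \<lambda>z. P (1, \<tau> z)) \<notin> based_homotopy q (subtopology T (- (orb (\<xi> 1) \<union> Bad))) y0"
    by (rule separating_sphere[OF q chart p k moved Bad1 Bad2]) (assumption+, rule that)
  have \<xi>T: "\<xi> s \<in> topspace T" if "s \<in> {0..1}" for s
    using continuous_map_funspace[OF \<xi>c] that by auto
  have \<xi>Bad: "\<xi> s \<notin> Bad" if "s \<in> {0..1}" for s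
    using \<xi>Bad'[OF that] Bad_sat[OF \<xi>T[OF that]] by blast

  define bs where "bs s = (\<lambda>i\<in>{..<N}. if i = 0 then \<xi> s else b i)" for s
  define pt where "pt s y = (\<lambda>i\<in>{..<Suc N}. if i = 0 then \<xi> s else if i < N then b i else y)" for s y
  have bsB: "bs s \<in> topspace ?B" if s: "s \<in> {0..1}" for s
  proof -
    have "orb (\<xi> s) \<noteq> orb (b j)" if "0 < j" "j < N" for j
      using \<xi>Bad[OF s] orb_Bad[OF \<xi>T[OF s]] that by metis
    moreover from this have "orb (b j) \<noteq> orb (\<xi> s)" if "0 < j" "j < N" for j
      using that by metis
    ultimately show ?thesis
      using \<xi>T[OF s] b(2,3) by (auto simp: topspace_config_top bs_def)
  qed
  have ptN: "pt s y N = y" for s y using N by (simp add: pt_def)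
  have fpt: "?f (pt s y) = bs s" for s y
    by (auto simp: first_coords_def pt_def bs_def restrict_def fun_eq_iff)
  have ptE: "pt s y \<in> topspace ?E" if s: "s \<in> {0..1}" and y: "y \<in> topspace T" "y \<notin> orb (\<xi> s) \<union> Bad" for s y
  proof -
    have 1: "orb (\<xi> s) \<noteq> orb (b j)" if "0 < j" "j < N" for j
      using \<xi>Bad[OF s] orb_Bad[OF \<xi>T[OF s]] that by metis
    have 2: "orb (b j) \<noteq> orb y" if "0 < j" "j < N" for j
      using orb_Bad[OF y(1)] y(2) that by blast
    have 3: "orb (\<xi> s) \<noteq> orb y" using orb_eq[OF \<xi>T[OF s] y(1)] y(2) by blast
    have "orb (pt s y i) \<noteq> orb (pt s y j)" if "i < Suc N" "j < Suc N" "i < j" for i j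
      using that N 1 2 3 b(3) by (auto simp: pt_def less_Suc_eq)
    then have "orb (pt s y i) \<noteq> orb (pt s y j)" if "i < Suc N" "j < Suc N" "i \<noteq> j" for i j
      using that by (cases i j rule: linorder_cases) (auto dest: sym)
    then show ?thesis
      using \<xi>T[OF s] b(2) y(1) by (auto simp: topspace_config_top pt_def)
  qed
  \<comment> \<open>With \<open>ptE\<close> this identifies the fibre over \<open>bs s\<close>,
    through the last coordinate, with the complement of
    \<open>orb (\<xi> s) \<union> Bad\<close>.\<close>
  have fibre: "e = pt s (e N) \<and> e N \<in> topspace T \<and> e N \<notin> orb (\<xi> s) \<union> Bad"
    if e: "e \<in> topspace ?E" "?f e = bs s" and s: "s \<in> {0..1}" for e s
  proof -
    have ei: "e i = (if i = 0 then \<xi> s else b i)" if "i < N" for i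
      using fun_cong[OF e(2), of i] that by (simp add: first_coords_def bs_def)
    have eN: "e N \<in> topspace T" using e(1) by (auto simp: topspace_config_top PiE_iff)
    have ne: "orb (e i) \<noteq> orb (e N)" if "i < N" for i
      using e(1) that unfolding topspace_config_top by (metis less_Suc_eq less_irrefl)
    have "e i = pt s (e N) i" for i
    proof -
      consider "i < N" | "i = N" | "i > N" by linarith
      then show ?thesis
      proof cases
        case 3
        then have "e i = undefined" using e(1) by (auto simp: topspace_config_top PiE_iff extensional_def)
        then show ?thesis using 3 by (simp add: pt_def)
      qed (use ei N in \<open>auto simp: pt_def\<close>)
    qed
    then have "e = pt s (e N)" ..
    moreover have "e N \<notin> orb (\<xi> s)" using ne[OF N] ei[OF N] orb_eq[OF \<xi>T[OF s] eN] by auto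
    moreover have "e N \<notin> Bad"
    proof
      assume "e N \<in> Bad"
      then obtain j where "0 < j" "j < N" "orb (b j) = orb (e N)" using orb_Bad[OF eN] by blast
      then show False using ne[of j] ei[of j] by simp
    qed
    ultimately show ?thesis using eN by blast
  qed
  have \<xi>comp: "continuous_map Z T (\<lambda>x. \<xi> (s x))" if "continuous_map Z unit_interval s" for s and Z :: "'c topology"
    by (rule continuous_map_compose'[OF \<xi>c that])
  have bsc: "continuous_map Z ?B (\<lambda>x. bs (s x))" if s: "continuous_map Z unit_interval s" for s and Z :: "'c topology"
  proof (rule continuous_map_into_config_top)
    show "bs (s x) \<in> topspace ?B" if "x \<in> topspace Z" for x
      by (rule bsB) (use funcset_mem[OF continuous_map_funspace[OF s] that] in simp)
    show "continuous_map Z T (\<lambda>x. bs (s x) i)" if "i < N" for i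
      using \<xi>comp[OF s] b(2)[OF that] that by (cases "i = 0") (simp_all add: bs_def)
  qed
  have ptc: "continuous_map Z ?E (\<lambda>x. pt (s x) (y x))"
    if s: "continuous_map Z unit_interval s" and y: "continuous_map Z T y"
      and ne: "\<And>x. x \<in> topspace Z \<Longrightarrow> y x \<notin> orb (\<xi> (s x)) \<union> Bad" for s y and Z :: "'c topology"
  proof (rule continuous_map_into_config_top)
    show "pt (s x) (y x) \<in> topspace ?E" if "x \<in> topspace Z" for x
      by (rule ptE[OF _ _ ne[OF that]]) (use funcset_mem[OF continuous_map_funspace[OF s] that]
          funcset_mem[OF continuous_map_funspace[OF y] that] in simp_all)
    show "continuous_map Z T (\<lambda>x. pt (s x) (y x) i)" if iN: "i < Suc N" for i
    proof -
      consider "i = 0" | "0 < i" "i < N" | "i = N" "0 < i" using iN N by linarith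
      then show ?thesis
      proof cases
        case 1
        then show ?thesis using \<xi>comp[OF s] by (simp add: pt_def)
      next
        case 2
        then show ?thesis using b(2)[OF 2(2)] by (simp add: pt_def)
      next
        case 3
        then show ?thesis using y by (simp add: pt_def)
      qed
    qed
  qed
  let ?H = "\<lambda>s. homotopy_fibre ?E ?B ?f (bs s)" and ?c = "\<lambda>s. \<lambda>t\<in>{0..1::real}. bs s"
  let ?F = "\<lambda>s. subtopology ?E {e. ?f e = bs s}"
  have lastc: "continuous_map (?F s) (subtopology T (- (orb (\<xi> s) \<union> Bad))) (\<lambda>e. e N)" if "s \<in> {0..1}" for s
    by (intro continuous_map_into_subtopology continuous_map_from_subtopology continuous_map_config_coord)
      (use fibre[OF _ _ that] in auto)
  \<comment> \<open>Every base path built below runs along \<open>bs\<close>, so it is described by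
    its real parameter \<open>l x t\<close>.\<close>
  have Hc: "continuous_map Z (?H v) (\<lambda>x. (pt (s x) (y x), \<lambda>t\<in>{0..1}. bs (l x t)))"
    if "continuous_map Z unit_interval s" "continuous_map Z T y"
      "\<And>x. x \<in> topspace Z \<Longrightarrow> y x \<notin> orb (\<xi> (s x)) \<union> Bad"
      and l: "continuous_map (prod_topology Z unit_interval) euclideanreal (\<lambda>w. l (fst w) (snd w))"
      "\<And>x t. x \<in> topspace Z \<Longrightarrow> t \<in> {0..1} \<Longrightarrow> l x t \<in> {0..1}"
      "\<And>x. x \<in> topspace Z \<Longrightarrow> l x 0 = s x \<and> l x 1 = v" for s y l v and Z :: "'c topology"
    by (rule continuous_map_into_homotopy_fibre[OF ptc[OF that(1-3)]
          bsc[OF continuous_map_into_unit_interval[OF l(1)]]]) (use l in \<open>auto simp: fpt\<close>)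
  \<comment> \<open>The position along the path: 1 on the middle third of the cube, where the sphere
    sits over \<open>bs 1\<close>, and 0 on the boundary, where a based map has to lie over
    \<open>bs 0\<close>.\<close>
  let ?s = "\<lambda>z. 1 - cube_collar q z" and ?\<rho> = "cube_expand q 1"
  have I0: "0 \<in> {0..1::real}" and I1: "1 \<in> {0..1::real}" by auto
  have sc: "continuous_map Z unit_interval (\<lambda>x. ?s (z x))" if "continuous_map Z (cube q) z"
    for z and Z :: "'c topology"
    using continuous_map_cube_collar[OF that]
    by (auto simp: continuous_map_in_subtopology Pi_iff intro!: continuous_map_diff)
  have sI: "?s z \<in> {0..1}" if "z \<in> topspace (cube q)" for z
    using cube_collar_bounds[OF that] by auto
  have sb: "?s z = 0" if "z \<in> cube_boundary q" for z using cube_collar_boundary[OF that] by simp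
  have \<sigma>c: "continuous_map (cube q) T \<sigma>" and \<sigma>b: "\<And>z. z \<in> cube_boundary q \<Longrightarrow> \<sigma> z = y0"
    and \<sigma>X: "\<And>z. z \<in> topspace (cube q) \<Longrightarrow> \<sigma> z \<notin> orb (\<xi> 1) \<union> Bad"
    using \<sigma> by (auto simp: based_maps_def continuous_map_in_subtopology)
  \<comment> \<open>On the middle third the parameter is 1 and \<open>\<sigma>\<close> avoids that
    orbit; on the collar \<open>\<sigma>\<close> is at \<open>y0\<close>, which avoids all orbits
    along \<open>\<xi>\<close>.\<close>
  have \<sigma>\<rho>: "\<sigma> (?\<rho> z) \<notin> orb (\<xi> (max v (?s z))) \<union> Bad" if "z \<in> topspace (cube q)" "v \<in> {0..1}" for z v
  proof (cases "cube_collar q z = 0")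
    case True
    then show ?thesis using \<sigma>X[OF cube_expand_in_cube] that by (simp add: max_absorb2)
  next
    case False
    then have "\<sigma> (?\<rho> z) = y0" using cube_collar_expand[OF that(1)] \<sigma>b by blast
    moreover have "max v (?s z) \<in> {0..1}" using that sI[OF that(1)] by auto
    ultimately show ?thesis using y0[of "max v (?s z)"] by simp
  qed
  have y0T: "y0 \<in> topspace T"
  proof -
    have "(\<lambda>i\<in>{..<q}. 0) \<in> cube_boundary q" using q by (auto simp: cube_boundary_def topspace_cube)
    then show ?thesis using \<sigma>b continuous_map_funspace[OF \<sigma>c] cube_boundary_subset by fastforce
  qed
  have \<sigma>\<rho>c: "continuous_map Z T (\<lambda>x. \<sigma> (?\<rho> (z x)))" if "continuous_map Z (cube q) z"
    for z and Z :: "'c topology"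
    by (rule continuous_map_compose'[OF \<sigma>c continuous_map_cube_expand[OF that]]) simp

  \<comment> \<open>\<open>g\<close> carries the separating sphere along the path from the fibre over \<open>bs 1\<close> to the homotopy
    fibre over \<open>bs 0\<close>.\<close>
  define g where "g = (\<lambda>z. (pt (?s z) (\<sigma> (?\<rho> z)), \<lambda>t\<in>{0..1}. bs (?s z * (1 - t))))"
  have g: "g \<in> based_maps q (?H 0) (pt 0 y0, ?c 0)"
    unfolding based_maps_def
  proof (intro CollectI conjI ballI)
    show "continuous_map (cube q) (?H 0) g"
      unfolding g_def
    proof (rule Hc[OF sc \<sigma>\<rho>c])
      show "\<sigma> (?\<rho> z) \<notin> orb (\<xi> (?s z)) \<union> Bad" if "z \<in> topspace (cube q)" for z
        using \<sigma>\<rho>[OF that I0] sI[OF that] by (simp add: max_absorb2)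
      show "continuous_map (prod_topology (cube q) unit_interval) euclideanreal (\<lambda>w. ?s (fst w) * (1 - snd w))"
        by (intro continuous_map_real_mult continuous_map_diff
            continuous_map_from_unit_interval[OF continuous_map_snd]
            continuous_map_from_unit_interval[OF sc[OF continuous_map_fst]]) simp
      show "?s z * (1 - t) \<in> {0..1}" if "z \<in> topspace (cube q)" "t \<in> {0..1}" for z t
        using that(2) sI[OF that(1)] by (auto intro!: mult_le_one)
    qed simp_all
    show "g z = (pt 0 y0, ?c 0)" if "z \<in> cube_boundary q" for z
      using sb[OF that] \<sigma>b[OF cube_expand_boundary[OF that]] by (simp add: g_def cong: restrict_cong)
  qed
  have e0: "pt 0 y0 \<in> topspace ?E" "pt 1 y0 \<in> topspace ?E"
    using ptE[OF _ y0T y0] by auto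
  obtain \<tau>' where \<tau>': "\<tau>' \<in> based_maps q (?F 0) (pt 0 y0)"
    and \<tau>'g: "(\<lambda>z. (\<tau>' z, ?c 0), g) \<in> based_homotopy q (?H 0) (pt 0 y0, ?c 0)"
    using quasifibration_surjective[OF quasi e0(1), of g q] bsB[OF I0] g unfolding fpt by metis
  define \<tau> where "\<tau> = (\<lambda>z. \<tau>' z N)"
  have \<xi>0T: "orb (\<xi> 0) = orb p" by (simp add: \<xi>0)
  have \<tau>: "\<tau> \<in> based_maps q ?Y y0"
    using \<tau>' continuous_map_compose'[OF lastc[OF I0], of "cube q" \<tau>']
    by (auto simp: based_maps_def \<tau>_def \<xi>0T ptN)
  have \<tau>c: "continuous_map (cube q) ?Y \<tau>" and \<tau>b: "\<And>z. z \<in> cube_boundary q \<Longrightarrow> \<tau> z = y0"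
    using \<tau> by (auto simp: based_maps_def)
  have \<tau>pt: "\<tau>' z = pt 0 (\<tau> z)" if "z \<in> topspace (cube q)" for z
  proof -
    have "continuous_map (cube q) (?F 0) \<tau>'" using \<tau>' by (simp add: based_maps_def)
    then have "\<tau>' z \<in> topspace (?F 0)" using that by (auto simp: continuous_map_def)
    then show ?thesis using fibre[of "\<tau>' z" 0] by (auto simp: \<tau>_def)
  qed
  \<comment> \<open>The pushed sphere avoids the orbits of all \<open>\<xi> s\<close> at once, so it
    makes sense in the fibre over every \<open>bs s\<close>.\<close>
  define \<upsilon> where "\<upsilon> = (\<lambda>z. P (1, \<tau> z))"
  have \<tau>\<upsilon>: "(\<tau>, \<upsilon>) \<in> based_homotopy q ?Y y0"
    unfolding \<upsilon>_def
  proof (rule based_homotopyI[where h = "\<lambda>w. P (fst w, \<tau> (snd w))"])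
    show "continuous_map (cylinder q) ?Y (\<lambda>w. P (fst w, \<tau> (snd w)))"
      by (rule continuous_map_homotopy_slices[OF Pc continuous_map_fst
          continuous_map_compose'[OF \<tau>c continuous_map_snd]])
    show "P (fst (0, z), \<tau> (snd (0::real, z))) = \<tau> z" if "z \<in> topspace (cube q)" for z
      using P0[of "\<tau> z"] continuous_map_funspace[OF \<tau>c] that by auto
  qed (use \<tau>b Py0 in auto)
  have \<upsilon>T: "continuous_map (cube q) T \<upsilon>" and \<upsilon>b: "\<And>z. z \<in> cube_boundary q \<Longrightarrow> \<upsilon> z = y0"
    using based_homotopy_maps(2)[OF \<tau>\<upsilon>] by (auto simp: based_maps_def continuous_map_in_subtopology)
  have \<upsilon>S: "\<upsilon> z \<notin> orb (\<xi> s) \<union> Bad" if "z \<in> topspace (cube q)" "s \<in> {0..1}" for z s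
    unfolding \<upsilon>_def by (rule P1[OF that(2)]) (use continuous_map_funspace[OF \<tau>c] that in auto)
  have Y0: "continuous_map ?Y (?H 0) (\<lambda>y. (pt 0 y, ?c 0))"
  proof (rule continuous_map_into_homotopy_fibre)
    have "continuous_map ?Y T (\<lambda>y. y)" by (rule continuous_map_from_subtopology) simp
    then show "continuous_map ?Y ?E (pt 0)"
      by (intro ptc continuous_map_const[THEN iffD2]) (auto simp: \<xi>0)
    show "continuous_map (prod_topology ?Y unit_interval) ?B (\<lambda>w. bs 0)"
      using bsB[OF I0] by simp
  qed (simp add: fpt)
  have "(\<lambda>z. (pt 0 (\<tau> z), ?c 0), \<lambda>z. (pt 0 (\<upsilon> z), ?c 0)) \<in> based_homotopy q (?H 0) (pt 0 y0, ?c 0)"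
    by (rule based_homotopy_compose[OF \<tau>\<upsilon> Y0])
  then have "(\<lambda>z. (\<tau>' z, ?c 0), \<lambda>z. (pt 0 (\<upsilon> z), ?c 0)) \<in> based_homotopy q (?H 0) (pt 0 y0, ?c 0)"
    by (rule based_homotopy_cong) (auto simp: \<tau>pt)
  then have \<upsilon>g: "(\<lambda>z. (pt 0 (\<upsilon> z), ?c 0), g) \<in> based_homotopy q (?H 0) (pt 0 y0, ?c 0)"
    using \<tau>'g by (meson based_homotopy_trans based_homotopy_sym)

  \<comment> \<open>Appends the path from \<open>bs 0\<close> to \<open>bs 1\<close>; the point of
    the total space stays.\<close>
  define app where "app = (\<lambda>y :: (nat \<Rightarrow> 'a) \<times> (real \<Rightarrow> nat \<Rightarrow> 'a).
      (fst y, \<lambda>t\<in>{0..1::real}. if t \<le> 1/2 then snd y (2 * t) else bs (2 * t - 1)))"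
  have app: "continuous_map (?H 0) (?H 1) app"
    unfolding app_def
  proof (rule continuous_map_into_homotopy_fibre[OF continuous_map_homotopy_fibre_fst])
    let ?Z = "prod_topology (?H 0) unit_interval"
    have sndR: "continuous_map ?Z euclideanreal snd"
      by (rule continuous_map_from_unit_interval[OF continuous_map_snd])
    show "continuous_map ?Z ?B (\<lambda>w. if snd w \<le> 1/2 then snd (fst w) (2 * snd w) else bs (2 * snd w - 1))"
    proof (rule continuous_map_cases_le[OF sndR])
      let ?W = "subtopology ?Z {w \<in> topspace ?Z. snd w \<le> 1/2}"
      have "continuous_map ?W (path_space ?B) (\<lambda>w. snd (fst w))"
        by (intro continuous_map_from_subtopology continuous_map_compose'[OF continuous_map_homotopy_fibre_snd
              continuous_map_fst])
      moreover have "continuous_map ?W unit_interval (\<lambda>w. 2 * snd w)"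
        by (intro continuous_map_into_unit_interval continuous_map_real_mult
            continuous_map_from_subtopology sndR) auto
      ultimately show "continuous_map ?W ?B (\<lambda>w. snd (fst w) (2 * snd w))"
        by (rule continuous_map_path_eval')
      show "continuous_map (subtopology ?Z {w \<in> topspace ?Z. 1/2 \<le> snd w}) ?B (\<lambda>w. bs (2 * snd w - 1))"
        by (rule bsc, intro continuous_map_into_unit_interval continuous_map_diff continuous_map_real_mult
            continuous_map_from_subtopology sndR) auto
      show "snd (fst w) (2 * snd w) = bs (2 * snd w - 1)" if "w \<in> topspace ?Z" "snd w = 1/2" for w
      proof -
        have 1: "2 * snd w = 1" using that(2) by simp
        show ?thesis unfolding 1 using that(1) by (auto simp: topspace_homotopy_fibre)
      qed
    qed simp
    show "(if (0::real) \<le> 1/2 then snd y (2 * 0) else bs (2 * 0 - 1)) = ?f (fst y) \<and>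
        (if (1::real) \<le> 1/2 then snd y (2 * 1) else bs (2 * 1 - 1)) = bs 1" if "y \<in> topspace (?H 0)" for y
      using that by (auto simp: topspace_homotopy_fibre)
  qed
  \<comment> \<open>Free homotopies that move the initial point of the appended path to \<open>bs 1\<close> and so bring both
    maps back to the fibre over \<open>bs 1\<close>; on the boundary of the cube they agree.\<close>
  define A where "A = (\<lambda>w. (pt (fst w) (\<upsilon> (snd w)), \<lambda>t\<in>{0..1::real}. bs (max (fst w) (2 * t - 1))))"
  define A' where "A' = (\<lambda>w. (pt (max (fst w) (?s (snd w))) (\<sigma> (?\<rho> (snd w))),
      \<lambda>t\<in>{0..1::real}. bs (max (fst w) (max (?s (snd w) * (1 - 2 * t)) (2 * t - 1)))))"
  define d where "d = (\<lambda>v. (pt v y0, \<lambda>t\<in>{0..1::real}. bs (max v (2 * t - 1))))"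
  let ?I = "cylinder q"
  have Ac: "continuous_map ?I (?H 1) A"
    unfolding A_def
  proof (rule Hc[OF continuous_map_fst continuous_map_compose'[OF \<upsilon>T continuous_map_snd]])
    show "continuous_map (prod_topology ?I unit_interval) euclideanreal (\<lambda>x. max (fst (fst x)) (2 * snd x - 1))"
      by (intro continuous_map_real_max continuous_map_diff
          continuous_map_real_mult continuous_map_from_unit_interval[OF continuous_map_snd]
          continuous_map_from_unit_interval[OF continuous_map_fst'[OF continuous_map_fst]]) auto
  qed (use \<upsilon>S in auto)
  have A'c: "continuous_map ?I (?H 1) A'"
    unfolding A'_def
  proof (rule Hc[OF _ \<sigma>\<rho>c[OF continuous_map_snd]])
    show "continuous_map ?I unit_interval (\<lambda>w. max (fst w) (?s (snd w)))"
    proof (rule continuous_map_into_unit_interval)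
      show "continuous_map ?I euclideanreal (\<lambda>w. max (fst w) (?s (snd w)))"
        by (intro continuous_map_real_max continuous_map_from_unit_interval[OF continuous_map_fst]
            continuous_map_from_unit_interval[OF sc[OF continuous_map_snd]])
      show "max (fst w) (?s (snd w)) \<in> {0..1}" if "w \<in> topspace ?I" for w
        using that sI[of "snd w"] by auto
    qed
    show "continuous_map (prod_topology ?I unit_interval) euclideanreal
        (\<lambda>x. max (fst (fst x)) (max (?s (snd (fst x)) * (1 - 2 * snd x)) (2 * snd x - 1)))"
      by (intro continuous_map_real_max continuous_map_diff continuous_map_real_mult
          continuous_map_from_unit_interval[OF continuous_map_snd]
          continuous_map_from_unit_interval[OF continuous_map_fst'[OF continuous_map_fst]]
          continuous_map_from_unit_interval[OF sc[OF continuous_map_snd'[OF continuous_map_fst]]]) simp_all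
    fix w assume w: "w \<in> topspace ?I"
    then have s: "fst w \<in> {0..1}" "?s (snd w) \<in> {0..1}" using sI[of "snd w"] by auto
    show "\<sigma> (?\<rho> (snd w)) \<notin> orb (\<xi> (max (fst w) (?s (snd w)))) \<union> Bad" using w \<sigma>\<rho> by auto
    show "max (fst w) (max (?s (snd w) * (1 - 2 * 0)) (2 * 0 - 1)) = max (fst w) (?s (snd w)) \<and>
        max (fst w) (max (?s (snd w) * (1 - 2 * 1)) (2 * 1 - 1)) = 1"
      using s by (auto simp: max_absorb1 max_absorb2)
    fix t :: real assume t: "t \<in> {0..1}"
    have "?s (snd w) * (1 - 2 * t) \<le> ?s (snd w) * 1" using s t by (intro mult_left_mono) auto
    then have "?s (snd w) * (1 - 2 * t) \<le> 1" using s by auto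
    then show "max (fst w) (max (?s (snd w) * (1 - 2 * t)) (2 * t - 1)) \<in> {0..1}" using s t by auto
  qed
  have dc: "continuous_map unit_interval (?H 1) d"
    unfolding d_def
  proof (rule Hc)
    show "continuous_map (prod_topology unit_interval unit_interval) euclideanreal
        (\<lambda>x. max (fst x) (2 * snd x - 1))"
      by (intro continuous_map_real_max continuous_map_diff
          continuous_map_real_mult continuous_map_from_unit_interval[OF continuous_map_snd]
          continuous_map_from_unit_interval[OF continuous_map_fst]) auto
  qed (use y0 y0T in auto)
  have Ad: "A (v, z) = d v" if "v \<in> {0..1}" "z \<in> cube_boundary q" for v z
    using \<upsilon>b[OF that(2)] by (simp add: A_def d_def)
  have A'd: "A' (v, z) = d v" if "v \<in> {0..1}" "z \<in> cube_boundary q" for v z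
  proof -
    have "max v (max (?s z * (1 - 2 * t)) (2 * t - 1)) = max v (2 * t - 1)" for t
      using that(1) unfolding sb[OF that(2)] by (auto simp: max_def)
    moreover have "max v (?s z) = v" using that(1) unfolding sb[OF that(2)] by simp
    ultimately show ?thesis
      using \<sigma>b[OF cube_expand_boundary[OF that(2)]] by (simp add: A'_def d_def)
  qed
  have K: "(\<lambda>z. A (0, z), \<lambda>z. A' (0, z)) \<in> based_homotopy q (?H 1) (d 0)"
  proof -
    \<comment> \<open>In the parameter of \<open>bs\<close>, going from \<open>s\<close> down to 0
      and then up to 1 is the maximum of \<open>s * (1 - 2 * t)\<close> and
      \<open>2 * t - 1\<close>: on each half of the interval one is nonnegative and the other
      nonpositive.\<close>
    have half: "max 0 (2 * t - 1) = (if t \<le> 1/2 then 0 else 2 * t - 1)" for t :: real by auto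
    have app_pt: "app (pt 0 y, ?c 0) = (pt 0 y, \<lambda>t\<in>{0..1}. bs (max 0 (2 * t - 1)))" for y
      by (auto simp: app_def half fun_eq_iff)
    have app_g: "app (g z) = A' (0, z)" if z: "z \<in> topspace (cube q)" for z
    proof -
      have s: "?s z \<ge> 0" "?s z \<le> 1" using sI[OF z] by auto
      have eq: "(if t \<le> 1/2 then (\<lambda>t\<in>{0..1}. bs (?s z * (1 - t))) (2 * t) else bs (2 * t - 1))
          = bs (max 0 (max (?s z * (1 - 2 * t)) (2 * t - 1)))" if t: "t \<in> {0..1}" for t
      proof (cases "t \<le> 1/2")
        case True
        then have "?s z * (1 - 2 * t) \<ge> 0" "2 * t - 1 \<le> 0" using s by auto
        then show ?thesis using True t by (simp add: max_absorb1 max_absorb2)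
      next
        case False
        then have "?s z * (1 - 2 * t) \<le> 0" "2 * t - 1 \<ge> 0" using s by (auto simp: mult_le_0_iff)
        then show ?thesis using False by (simp add: max_absorb1 max_absorb2)
      qed
      have "(\<lambda>t\<in>{0..1}. if t \<le> 1/2 then snd (g z) (2 * t) else bs (2 * t - 1))
          = (\<lambda>t\<in>{0..1}. bs (max 0 (max (?s z * (1 - 2 * t)) (2 * t - 1))))"
        by (rule restrict_ext) (simp only: g_def snd_conv eq)
      moreover have "fst (g z) = pt (max 0 (?s z)) (\<sigma> (?\<rho> z))"
        using s by (simp add: g_def max_absorb2)
      ultimately show ?thesis unfolding app_def A'_def by (simp only: fst_conv snd_conv)
    qed
    have "(\<lambda>z. app (pt 0 (\<upsilon> z), ?c 0), \<lambda>z. app (g z)) \<in> based_homotopy q (?H 1) (app (pt 0 y0, ?c 0))"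
      by (rule based_homotopy_compose[OF \<upsilon>g app])
    then have "(\<lambda>z. app (pt 0 (\<upsilon> z), ?c 0), \<lambda>z. app (g z)) \<in> based_homotopy q (?H 1) (d 0)"
      by (simp only: app_pt d_def)
    then show ?thesis
      by (rule based_homotopy_cong) (simp only: app_pt A_def fst_conv snd_conv, rule app_g)
  qed
  \<comment> \<open>At time 1 all parameters are clipped to 1 and the paths are constant, so both
    maps come from the actual fibre and injectivity applies.\<close>
  have "(\<lambda>z. A (1, z), \<lambda>z. A' (1, z)) \<in> based_homotopy q (?H 1) (d 1)"
    by (rule based_homotopy_transport[OF Ac A'c dc Ad A'd K])
  moreover have c1: "(\<lambda>t\<in>{0..1::real}. bs (max 1 (2 * t - 1))) = ?c 1"
    by (auto simp: fun_eq_iff max_absorb1)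
  ultimately have "(\<lambda>z. A (1, z), \<lambda>z. A' (1, z)) \<in> based_homotopy q (?H 1) (pt 1 y0, ?c 1)"
    by (simp only: d_def)
  then have hom1: "(\<lambda>z. (pt 1 (\<upsilon> z), ?c 1), \<lambda>z. (pt 1 (\<sigma> (?\<rho> z)), ?c 1))
      \<in> based_homotopy q (?H 1) (pt 1 y0, ?c 1)"
  proof (rule based_homotopy_cong)
    show "A (1, z) = (pt 1 (\<upsilon> z), ?c 1)" for z by (simp only: A_def fst_conv snd_conv c1)
    show "A' (1, z) = (pt 1 (\<sigma> (?\<rho> z)), ?c 1)" if "z \<in> topspace (cube q)" for z
    proof -
      have s: "?s z \<in> {0..1}" by (rule sI[OF that])
      have "?s z * (1 - 2 * t) \<le> 1" if "t \<in> {0..1}" for t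
        using mult_left_mono[of "1 - 2 * t" 1 "?s z"] s that by auto
      then have "max 1 (max (?s z * (1 - 2 * t)) (2 * t - 1)) = 1" if "t \<in> {0..1}" for t
        using that by (auto simp: max_absorb1)
      moreover have "max 1 (?s z) = 1" using s by simp
      ultimately show ?thesis by (simp add: A'_def cong: restrict_cong)
    qed
  qed
  have F1: "(\<lambda>z. pt 1 (y z)) \<in> based_maps q (?F 1) (pt 1 y0)"
    if "continuous_map (cube q) T y" "\<And>z. z \<in> topspace (cube q) \<Longrightarrow> y z \<notin> orb (\<xi> 1) \<union> Bad"
      "\<And>z. z \<in> cube_boundary q \<Longrightarrow> y z = y0" for y
    unfolding based_maps_def
    using that by (auto simp: fpt intro!: continuous_map_into_subtopology ptc)
  have "(\<lambda>z. pt 1 (\<upsilon> z), \<lambda>z. pt 1 (\<sigma> (?\<rho> z))) \<in> based_homotopy q (?F 1) (pt 1 y0)"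
  proof (rule quasifibration_injective[OF quasi e0(2), unfolded fpt])
    show "bs 1 \<in> topspace ?B" by (rule bsB[OF I1])
    show "(\<lambda>z. pt 1 (\<upsilon> z)) \<in> based_maps q (?F 1) (pt 1 y0)"
      by (rule F1[OF \<upsilon>T \<upsilon>S[OF _ I1] \<upsilon>b])
    show "(\<lambda>z. pt 1 (\<sigma> (?\<rho> z))) \<in> based_maps q (?F 1) (pt 1 y0)"
      by (rule F1[OF \<sigma>\<rho>c]) (use \<sigma>X[OF cube_expand_in_cube] \<sigma>b cube_expand_boundary in auto)
  qed (rule hom1)
  from based_homotopy_compose[OF this lastc[OF I1]]
  have "(\<upsilon>, \<lambda>z. \<sigma> (?\<rho> z)) \<in> based_homotopy q (subtopology T (- (orb (\<xi> 1) \<union> Bad))) y0" by (simp add: ptN)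
  then have "(\<sigma>, \<upsilon>) \<in> based_homotopy q (subtopology T (- (orb (\<xi> 1) \<union> Bad))) y0"
    using based_homotopy_expand[OF \<sigma>] by (meson based_homotopy_trans based_homotopy_sym)
  then show False using sep[OF \<tau>] by (simp add: \<upsilon>_def)
qed

end

section \<open>Configuration groupoids of translation groupoids\<close>

text \<open>Applied to the action of one group element, this stands in for the linearization of the action at a
  fixed point. A boundary point of the interior of the fixed point set will do, and any fixed point if
  that interior is empty.\<close>

lemma fixed_point_with_moved_neighbours:
  assumes T: "Hausdorff_space T" "connected_space T" and f: "continuous_map T T f"
    and x: "x \<in> topspace T" "f x = x" and y: "y \<in> topspace T" "f y \<noteq> y"
  obtains p where "p \<in> topspace T" "f p = p" "\<And>W. openin T W \<Longrightarrow> p \<in> W \<Longrightarrow> \<exists>w\<in>W. f w \<noteq> w"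
proof -
  let ?F = "{w \<in> topspace T. f w = w}"
  have F: "closedin T ?F"
    using closedin_continuous_maps_eq[OF T(1) f, of "\<lambda>w. w"] by simp
  have "T interior_of ?F \<noteq> topspace T" using y interior_of_subset[of T ?F] by auto
  then have "\<exists>p\<in>?F. p \<notin> T interior_of ?F"
  proof (cases "T interior_of ?F = {}")
    case False
    then have "\<not> closedin T (T interior_of ?F)"
      using T(2) \<open>T interior_of ?F \<noteq> topspace T\<close> connected_space_clopen_in openin_interior_of by blast
    then have "T closure_of (T interior_of ?F) \<noteq> T interior_of ?F"
      by (metis closedin_closure_of)
    moreover have "T closure_of (T interior_of ?F) \<subseteq> ?F"
      by (intro closure_of_minimal F interior_of_subset)
    moreover have "T interior_of ?F \<subseteq> T closure_of (T interior_of ?F)"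
      by (intro closure_of_subset interior_of_subset_topspace)
    ultimately show ?thesis by blast
  qed (use x in auto)
  then obtain p where p: "p \<in> ?F" "p \<notin> T interior_of ?F" by blast
  show thesis
  proof (rule that[of p])
    fix W assume W: "openin T W" "p \<in> W"
    show "\<exists>w\<in>W. f w \<noteq> w"
    proof (rule ccontr)
      assume "\<not> ?thesis"
      then have "W \<subseteq> ?F" using openin_subset[OF W(1)] by auto
      then have "W \<subseteq> T interior_of ?F" using W(1) by (simp add: interior_of_maximal)
      then show False using W(2) p(2) by blast
    qed
  qed (use p in auto)
qed

section \<open>Object spaces of the configuration groupoids\<close>

lemma mtop_PB_obj: "mtop (PB_obj n G) = config_top (mtop (gobj G)) (gorbit G) n"
  by (simp add: PB_obj_def sub_mfd_def power_mfd_def config_top_def)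

lemma gobj_PBa: "gobj (PBa (Suc n) G) = PB_obj (Suc n) G"
  by (cases n) (simp_all add: Let_def)

lemma gobj_PBb: "gobj (PBb n G) = PB_obj n G"
  by (simp add: PBb_def)

lemma gorbit_translation_groupoid:
  assumes "x \<in> mspace M"
  shows "gorbit (translation_groupoid M H \<phi>) x = (\<lambda>h. \<phi> h x) ` carrier H"
  using assms by (force simp: gorbit_def translation_groupoid_def prod_mfd_def discrete_mfd_def)

lemma orbit_space_translation_groupoid:
  assumes gq: "global_quotient M H \<phi>"
  shows "orbit_space (mtop M) \<phi> (carrier H) (gorbit (translation_groupoid M H \<phi>))"
proof -
  interpret faithful_action H "mspace M" \<phi> using gq by (simp add: global_quotient_def)
  have orb: "gorbit (translation_groupoid M H \<phi>) x = orbit H \<phi> x" if "x \<in> mspace M" for x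
    unfolding gorbit_translation_groupoid[OF that] by (auto simp: orbit_def)
  show ?thesis
  proof
    show "Hausdorff_space (mtop M)" "finite (carrier H)"
      using gq by (auto simp: global_quotient_def smooth_manifold_def)
    show "continuous_map (mtop M) (mtop M) (\<phi> h)" if "h \<in> carrier H" for h
      using gq that by (auto simp: global_quotient_def smooth_map_def)
    fix x assume x: "x \<in> mspace M"
    show "gorbit (translation_groupoid M H \<phi>) x = (\<lambda>h. \<phi> h x) ` carrier H"
      by (rule gorbit_translation_groupoid[OF x])
    fix y assume y: "y \<in> mspace M"
    have sub: "orbit H \<phi> b \<subseteq> orbit H \<phi> a" if "a \<in> mspace M" "b \<in> mspace M" "b \<in> orbit H \<phi> a" for a b
    proof
      fix z assume z: "z \<in> orbit H \<phi> b"
      then have "z \<in> mspace M" using element_image[OF _ that(2)] by (auto simp: orbit_def)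
      then show "z \<in> orbit H \<phi> a" using orbit_trans[OF that(1,2) _ that(3) z] by blast
    qed
    have "orbit H \<phi> x = orbit H \<phi> y \<longleftrightarrow> y \<in> orbit H \<phi> x"
      using sub[OF x y] sub[OF y x] orbit_sym[OF x y] orbit_refl[OF y] by blast
    then show "gorbit (translation_groupoid M H \<phi>) x = gorbit (translation_groupoid M H \<phi>) y
        \<longleftrightarrow> y \<in> gorbit (translation_groupoid M H \<phi>) x"
      unfolding orb[OF x] orb[OF y] .
  qed
qed

lemma PB_projection_not_quasifibration:
  assumes gq: "global_quotient M H \<phi>" and dim: "mdim M \<ge> 2"
    and sing: "singular_points M H \<phi> \<noteq> {}" and N: "N > 0"
  defines "G \<equiv> translation_groupoid M H \<phi>"
  shows "\<not> quasifibration (mtop (PB_obj (Suc N) G)) (mtop (PB_obj N G)) (first_coords N)"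
proof -
  interpret faithful_action H "mspace M" \<phi> using gq by (simp add: global_quotient_def)
  interpret orbit_space "mtop M" \<phi> "carrier H" "gorbit G"
    unfolding G_def by (rule orbit_space_translation_groupoid[OF gq])
  obtain x where x: "x \<in> mspace M" "stabilizer H \<phi> x \<noteq> {\<one>\<^bsub>H\<^esub>}"
    using sing by (auto simp: singular_points_def)
  have "\<one>\<^bsub>H\<^esub> \<in> stabilizer H \<phi> x" by (rule stabilizer_one_closed[OF x(1)])
  then obtain h where h: "h \<in> carrier H" "h \<noteq> \<one>\<^bsub>H\<^esub>" "\<phi> h x = x"
    using x(2) by (auto simp: stabilizer_def)
  \<comment> \<open>Effectiveness: \<open>\<phi> h\<close> is extensional, so fixing every point
    would make it equal to \<open>\<phi>\<close> of the unit.\<close>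
  have "\<exists>y\<in>mspace M. \<phi> h y \<noteq> y"
  proof (rule ccontr)
    assume "\<not> ?thesis"
    then have "\<phi> h = (\<lambda>x\<in>mspace M. x)"
      using bij_prop0[OF h(1)] by (auto simp: Bij_def extensional_def fun_eq_iff)
    then have "\<phi> h = \<phi> \<one>\<^bsub>H\<^esub>" using id_eq_one by simp
    moreover have "\<one>\<^bsub>H\<^esub> \<in> carrier H"
      using gq by (simp add: global_quotient_def group.is_monoid monoid.one_closed)
    ultimately show False using faithful h(1,2) by (auto dest: inj_onD)
  qed
  then obtain y where y: "y \<in> mspace M" "\<phi> h y \<noteq> y" by blast
  have conn: "connected_space (mtop M)" using gq by (simp add: global_quotient_def)
  obtain p where p: "p \<in> mspace M" "\<phi> h p = p"
    "\<And>W. openin (mtop M) W \<Longrightarrow> p \<in> W \<Longrightarrow> \<exists>w\<in>W. \<phi> h w \<noteq> w"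
    using fixed_point_with_moved_neighbours[OF T conn \<phi>[OF h(1)] x(1) h(3) y] by metis
  \<comment> \<open>The sphere dimension is \<open>mdim M - 1\<close>; the dimension bound makes its
    successor \<open>mdim M\<close> and the number itself positive.\<close>
  have chart: "\<exists>U \<psi>. x \<in> U \<and> is_chart (mtop M) (Suc (mdim M - 1)) (U, \<psi>)" if "x \<in> mspace M" for x
  proof -
    have "x \<in> (\<Union>c\<in>atlas M. fst c)" and ch: "\<And>c. c \<in> atlas M \<Longrightarrow> is_chart (mtop M) (mdim M) c"
      using gq that by (auto simp: global_quotient_def smooth_manifold_def)
    then obtain c where "c \<in> atlas M" "x \<in> fst c" by blast
    then show ?thesis using ch[of c] dim by (intro exI[of _ "fst c"] exI[of _ "snd c"]) simp
  qed
  have "gobj G = M" by (simp add: G_def translation_groupoid_def)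
  then show ?thesis
    unfolding mtop_PB_obj
    using configuration_projection_not_quasifibration[OF _ N chart p(1) h(1) p(2,3)] dim
    by simp
qed

theorem proposition2p11:
  fixes M :: "'a mfd"
    and H :: "('g, 'z) monoid_scheme"
    and \<phi> :: "'g \<Rightarrow> 'a \<Rightarrow> 'a"
    and G :: "('a, 'g \<times> 'a) groupoid"
    and n :: nat
  assumes "global_quotient M H \<phi>"
    and "mdim M \<ge> 2"
    and "singular_points M H \<phi> \<noteq> {}"
    and "n \<ge> 2"
    and "G = translation_groupoid M H \<phi>"
  shows "\<not> a_fibration (PBa n G) (PBa (n - 1) G) (first_coords (n - 1)) lower \<and>
    \<not> b_fibration (PBb n G) (PBb (n - 1) G) (first_coords (n - 1)) (first_coords (n - 1)) \<and>
    \<not> quasifibration (mtop (gobj (PBa n G))) (mtop (gobj (PBa (n - 1) G)))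
        (first_coords (n - 1)) \<and>
    \<not> quasifibration (mtop (gobj (PBb n G))) (mtop (gobj (PBb (n - 1) G)))
        (first_coords (n - 1))"
proof -
  obtain N where n: "n = Suc N" "N > 0" using assms(4) by (cases n) auto
  have not_quasi: "\<not> quasifibration (mtop (PB_obj n G)) (mtop (PB_obj (n - 1) G)) (first_coords (n - 1))"
    using PB_projection_not_quasifibration[OF assms(1-3) n(2)] unfolding n(1) assms(5) by simp
  then have "\<not> hurewicz_fibration (mtop (PB_obj n G)) (mtop (PB_obj (n - 1) G)) (first_coords (n - 1))"
    using hurewicz_fibration_imp_quasifibration by blast
  \<comment> \<open>The equations of \<open>PBa\<close> begin at \<open>Suc 0\<close>, so unfolding
    \<open>PBa (n - 1) G\<close> relies on \<open>N > 0\<close>.\<close>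
  moreover have "gobj (PBa n G) = PB_obj n G" "gobj (PBa (n - 1) G) = PB_obj (n - 1) G"
    using n gobj_PBa[of N G] gobj_PBa[of "N - 1" G] by simp_all
  ultimately show ?thesis
    using not_quasi by (simp add: a_fibration_def b_fibration_def gobj_PBb)
qed

end
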